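(* Let $n\geq 1$. For every germ of biholomorphism $h\in\operatorname{Diff}(\mathbb{C}^n,0)$ there exist a matrix $A\in\mathfrak{gl}(n,\mathbb{C})$ and a holomorphic germ $G\colon(\mathbb{C}^{n+1},0)\to(\mathbb{C}^n,0)$ with $G(x,0)\equiv 0$ and $dG(0)=0$ such that the holonomy of the invariant curve $S=\{y=0\}$ of the foliation defined by the system $$x'=x,\qquad y'=A\cdot y+G(x,y)\qquad (x\in\mathbb{C},\ y=(y_1,\dots,y_n)\in\mathbb{C}^n)$$ is holomorphically conjugate to $h$. Equivalently, the map $[\mathrm{hol}]$ from the moduli space of $\mathrm{Fol}(n+1)$ to the moduli space of $\operatorname{Diff}(\mathbb{C}^n,0)$ (for analytic classification) is surjective.
   Context: $\operatorname{Diff}(\mathbb{C}^n,0)$ denotes the group of germs of biholomorphisms of $(\mathbb{C}^n,0)$ fixing $0$. $\mathrm{Fol}(n+1)$ denotes the set of germs of singular holomorphic foliations on $(\mathbb{C}^{n+1},0)$ defined by a system $x'=x$, $y'=A\cdot y+G(x,y)$ with $A\in\mathfrak{gl}(n,\mathbb{C})$ and $G$ holomorphic, $G(x,0)\equiv 0$, $dG(0)=0$. For such a foliation the origin is an isolated singularity and $S=\{y=0\}$ is invariant, with $S\setminus\{0\}$ a regular leaf. The holonomy $\mathrm{hol}(\mathcal{F})$ is the holonomy map of the leaf $S\setminus\{0\}$ along a small positively oriented simple loop around the origin in $S\setminus\{0\}$, computed on a transversal $\{x=x_0\}$; it is a germ in $\operatorname{Diff}(\mathbb{C}^n,0)$ of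 the form $y\mapsto e^{2\pi i A}y+\text{h.o.t.}$, well defined up to holomorphic conjugation. Two foliations in $\mathrm{Fol}(n+1)$ are identified in the moduli space if they are conjugated by a germ of biholomorphism preserving $S$; two diffeomorphisms if holomorphically conjugate. *)

theory Defs
  imports "HOL-Analysis.Analysis"
begin

text \<open>C^n is modelled as complex^'n (n = CARD('n) >= 1); C^(n+1) as complex \<times> (complex^'n),
  the first coordinate being x and the second y.\<close>

definition holo_vec :: "(complex^'n) set \<Rightarrow> (complex^'n \<Rightarrow> complex^'m) \<Rightarrow> bool" where
  "holo_vec U f \<longleftrightarrow> (\<forall>z\<in>U. \<exists>L. (f has_derivative L) (at z) \<and> (\<forall>c v. L (c *s v) = c *s L v))"

definition holo_pair :: "(complex \<times> (complex^'n)) set \<Rightarrow> (complex \<times> (complex^'n) \<Rightarrow> complex^'m) \<Rightarrow> bool" where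
  "holo_pair U G \<longleftrightarrow> (\<forall>p\<in>U. \<exists>L. (G has_derivative L) (at p) \<and>
      (\<forall>c a v. L (c * a, c *s v) = c *s L (a, v)))"

definition biholo_germ :: "(complex^'n \<Rightarrow> complex^'n) \<Rightarrow> bool" where
  "biholo_germ h \<longleftrightarrow> h 0 = 0 \<and> (\<exists>U. open U \<and> 0 \<in> U \<and> holo_vec U h \<and> inj_on h U \<and>
      open (h ` U) \<and> holo_vec (h ` U) (inv_into U h))"

definition holo_conj :: "(complex^'n \<Rightarrow> complex^'n) \<Rightarrow> (complex^'n \<Rightarrow> complex^'n) \<Rightarrow> bool" where
  "holo_conj f g \<longleftrightarrow> (\<exists>\<phi>. biholo_germ \<phi> \<and>
      (\<exists>W. open W \<and> 0 \<in> W \<and> (\<forall>y\<in>W. \<phi> (f y) = g (\<phi> y))))"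

text \<open>Solution of the foliation x' = x, y' = A y + G(x,y) in complex time \<tau> = i t, t \<in> [0,2\<pi>],
  starting at (x0, y0) on the transversal {x = x0}: then x(t) = x0 e^{it} runs once
  positively around the origin in S, and y satisfies y'(t) = i (A y(t) + G(x0 e^{it}, y(t))),
  the path staying in the domain U of G.\<close>
definition hol_path ::
  "complex^'n^'n \<Rightarrow> (complex \<times> (complex^'n) \<Rightarrow> complex^'n) \<Rightarrow> (complex \<times> (complex^'n)) set
    \<Rightarrow> complex \<Rightarrow> complex^'n \<Rightarrow> (real \<Rightarrow> complex^'n) \<Rightarrow> bool" where
  "hol_path A G U x0 y0 y \<longleftrightarrow> y 0 = y0 \<and>
     (\<forall>t\<in>{0..2*pi}. (x0 * exp (\<i> * complex_of_real t), y t) \<in> U \<and>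
        (y has_vector_derivative (\<i> *s (A *v y t + G (x0 * exp (\<i> * complex_of_real t), y t))))
          (at t within {0..2*pi}))"

definition is_holonomy ::
  "complex^'n^'n \<Rightarrow> (complex \<times> (complex^'n) \<Rightarrow> complex^'n) \<Rightarrow> (complex \<times> (complex^'n)) set
    \<Rightarrow> complex \<Rightarrow> (complex^'n \<Rightarrow> complex^'n) \<Rightarrow> bool" where
  "is_holonomy A G U x0 H \<longleftrightarrow> (\<exists>V. open V \<and> 0 \<in> V \<and>
     (\<forall>y0\<in>V. (\<exists>y. hol_path A G U x0 y0 y) \<and> (\<forall>y. hol_path A G U x0 y0 y \<longrightarrow> y (2*pi) = H y0)))"

end

theory Submission
  imports Defs "HOL-Complex_Analysis.Complex_Analysis" "HOL-Probability.Sinc_Integral"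
    "Jordan_Normal_Form.Schur_Decomposition"
begin

text \<open>
  Put \<open>x = e\<^sup>\<tau>\<close> and let \<open>g\<close> be the inverse of \<open>h\<close>.  A foliation with the required holonomy is found by
  constructing a fibrewise map \<open>\<psi>\<close> with \<open>\<psi> (\<tau> + 2\<pi>i) Y = g (\<psi> \<tau> Y)\<close>: the curves along which \<open>\<psi>\<close> is constant
  are the leaves of a \<open>2\<pi>i\<close>-periodic vector field in the \<open>Y\<close>-space, and following them once around
  \<open>x = 0\<close> yields \<open>h\<close> in the chart \<open>\<psi> \<tau>\<^sub>0\<close>.  After triangularizing \<open>g'(0)\<close> one writes
  \<open>\<psi> \<tau> Y = E \<tau> (Y + w \<tau> Y)\<close> with a diagonal frame \<open>E\<^sub>j = (\<mu> x e\<^sup>-\<^sup>x)\<^bsup>N\<^sub>j\<^esup> x\<^bsup>\<beta>\<^sub>j\<^esup>\<close>, where \<open>e\<^bsup>2\<pi>i\<beta>\<^sub>j\<^esup>\<close> is the \<open>j\<close>-th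
  eigenvalue.  Then \<open>w (\<tau> + 2\<pi>i) - w \<tau> = R (\<tau>, Y + w \<tau>)\<close> near the real axis, a nonlinear Cousin problem.
  The large integer weights \<open>N\<^sub>j\<close>, spread out along the triangular ordering, make \<open>R\<close> small
  and integrable along horizontal lines.  Since \<open>w\<close> enters \<open>R\<close> only through pointwise composition, Picard
  iteration converges without any loss of domain in \<open>Y\<close>; the linear Cousin problem is solved with
  Cauchy integrals over two parallel horizontal lines, each point of the strip using the one it is
  far from.  The solution is \<open>O(x)\<close>, so the vector field extends to \<open>x = 0\<close>, and its linear part there
  is diagonal.
\<close>

subsection \<open>Holomorphy along complex lines\<close>

text \<open>No normal form of h can be relied on: resonances may block linearization, and the linear
  part need not be diagonalizable. What replaces it is that the multipliers determine the exponents
  \<open>\<beta>_j\<close> only up to integers. Raising the order of vanishing of the frame at x = 0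
  turns the off-diagonal linear terms and all terms of order two and more into small perturbations.
  The factor \<open>exp (- x)\<close> serves the other end: the Cauchy integrals run over entire
  lines, so the data must also decay as Re \<tau> tends to infinity, far from x = 0. Being a
  function of x, this factor leaves the multipliers alone. It is small only where Re x is large and
  positive, which suffices because the gluing data live near the real axis. The inverse g, and not
  h, is glued in because of the direction of transport: a leaf from \<open>y0\<close> to
  \<open>y1\<close> satisfies \<open>psi (\<tau>0 + 2 \<pi> i) y1 = psi \<tau>0 y0\<close>, hence
  \<open>g (psi \<tau>0 y1) = psi \<tau>0 y0\<close>, so that h sends \<open>psi \<tau>0 y0\<close>
  to \<open>psi \<tau>0 y1\<close>.\<close>

no_notation fps_nth (infixl "$" 75)
no_notation Matrix.vec_index (infixl "$" 100)

lemmas vec_eq_iff = Finite_Cartesian_Product.vec_eq_iff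

lemma norm_vector_smult: "norm (c *s (v :: complex^'n)) = cmod c * norm v"
  by (simp add: norm_vec_def norm_mult L2_set_right_distrib)

lemma norm_vec_le_sum: "norm (v :: complex^'n) \<le> (\<Sum>i\<in>UNIV. cmod (v $ i))"
  by (simp add: norm_vec_def L2_set_le_sum)

lemma norm_vec_le_card:
  assumes "\<And>i. cmod ((v :: complex^'n) $ i) \<le> B"
  shows "norm v \<le> real CARD('n) * B"
proof -
  have "(\<Sum>i\<in>UNIV. cmod (v $ i)) \<le> real CARD('n) * B"
    using sum_bounded_above[of UNIV "\<lambda>i. cmod (v $ i)" B] assms by simp
  then show ?thesis using norm_vec_le_sum[of v] by linarith
qed

text \<open>The complex structure of C^(n+1) on the product type, in the form in which
  \<open>holo_pair\<close> uses it.\<close>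

definition cscale :: "complex \<Rightarrow> complex \<times> (complex^'n) \<Rightarrow> complex \<times> (complex^'n)" where
  "cscale c p = (c * fst p, c *s snd p)"

lemma norm_cscale [simp]: "norm (cscale c p) = cmod c * norm p"
  by (simp add: cscale_def norm_prod_def norm_mult norm_vector_smult power_mult_distrib
      flip: distrib_left) (simp add: real_sqrt_mult)

lemma cscale_0 [simp]: "cscale 0 p = 0" "cscale c 0 = 0"
  by (simp_all add: cscale_def zero_prod_def)

lemma cscale_1 [simp]: "cscale 1 p = p"
  by (simp add: cscale_def)

lemma cscale_simps:
  "cscale (a + b) p = cscale a p + cscale b p" "cscale (a * b) p = cscale a (cscale b p)"
  "cscale c (p + q) = cscale c p + cscale c q" "cscale (- c) p = - cscale c p" "cscale (a - b) p = cscale a p - cscale b p"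
  by (auto simp: cscale_def prod_eq_iff vec_eq_iff algebra_simps)

lemma cscale_of_real: "cscale (complex_of_real r) p = r *\<^sub>R p"
  by (simp add: cscale_def prod_eq_iff vec_eq_iff scaleR_conv_of_real[where 'a = complex])

lemma fst_cscale [simp]: "fst (cscale c p) = c * fst p" and snd_cscale [simp]: "snd (cscale c p) = c *s snd p"
  by (simp_all add: cscale_def)

lemma bounded_linear_cscaleale: "bounded_linear (\<lambda>z. cscale z p)"
  by (intro linear_conv_bounded_linear[THEN iffD1] linearI)
    (auto simp: cscale_def prod_eq_iff vec_eq_iff algebra_simps)

lemma continuous_on_cscale [continuous_intros]:
  "continuous_on S f \<Longrightarrow> continuous_on S (\<lambda>x. cscale (f x) p)"
  using bounded_linear.continuous_on[OF bounded_linear_cscaleale] .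

lemma open_cscale_line:
  assumes "open U" shows "open {z. p + cscale z v \<in> U}"
proof -
  have "continuous_on UNIV (\<lambda>z. p + cscale z v)" by (intro continuous_intros)
  then show ?thesis using assms
    by (metis (full_types) continuous_on_open_vimage open_UNIV vimage_def Int_UNIV_right)
qed

text \<open>Continuous and holomorphic along every complex line; for open sets this is joint holomorphy
  (see below), but it can be checked by means of the theory of one variable.\<close>

definition ghol :: "(complex \<times> (complex^'n)) set \<Rightarrow> (complex \<times> (complex^'n) \<Rightarrow> complex) \<Rightarrow> bool" where
  "ghol U f \<longleftrightarrow> continuous_on U f \<and> (\<forall>p v. (\<lambda>z. f (p + cscale z v)) holomorphic_on {z. p + cscale z v \<in> U})"

lemma ghol_continuous: "ghol U f \<Longrightarrow> continuous_on U f"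
  by (simp add: ghol_def)

lemma ghol_line: "ghol U f \<Longrightarrow> (\<And>z. z \<in> S \<Longrightarrow> p + cscale z v \<in> U) \<Longrightarrow> (\<lambda>z. f (p + cscale z v)) holomorphic_on S"
  unfolding ghol_def by (metis (mono_tags, lifting) holomorphic_on_subset mem_Collect_eq subsetI)

lemma ghol_lineU: "ghol U f \<Longrightarrow> (\<lambda>z. f (p + cscale z v)) holomorphic_on {z. p + cscale z v \<in> U}"
  unfolding ghol_def by blast

lemma ghol_subset: "ghol U f \<Longrightarrow> V \<subseteq> U \<Longrightarrow> ghol V f"
  unfolding ghol_def by (meson Collect_mono continuous_on_subset holomorphic_on_subset subsetD)

lemma ghol_cong: "(\<And>p. p \<in> U \<Longrightarrow> f p = g p) \<Longrightarrow> ghol U f \<longleftrightarrow> ghol U g"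
  unfolding ghol_def
  by (intro conj_cong continuous_on_cong all_cong1 holomorphic_cong) auto

lemma ghol_const [simp]: "ghol U (\<lambda>p. c)"
  and ghol_fst: "ghol U fst"
  and ghol_snd: "ghol U (\<lambda>p. snd p $ i)"
  unfolding ghol_def by (auto intro!: continuous_intros holomorphic_intros)

lemma ghol_add: "ghol U f \<Longrightarrow> ghol U g \<Longrightarrow> ghol U (\<lambda>p. f p + g p)"
  and ghol_diff: "ghol U f \<Longrightarrow> ghol U g \<Longrightarrow> ghol U (\<lambda>p. f p - g p)"
  and ghol_mult: "ghol U f \<Longrightarrow> ghol U g \<Longrightarrow> ghol U (\<lambda>p. f p * g p)"
  and ghol_uminus: "ghol U f \<Longrightarrow> ghol U (\<lambda>p. - f p)"
  unfolding ghol_def by (auto intro!: continuous_intros holomorphic_intros)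

lemma ghol_divide: "ghol U f \<Longrightarrow> ghol U g \<Longrightarrow> (\<And>p. p \<in> U \<Longrightarrow> g p \<noteq> 0) \<Longrightarrow> ghol U (\<lambda>p. f p / g p)"
  unfolding ghol_def by (intro conjI allI continuous_on_divide holomorphic_on_divide) (auto simp del: split_paired_All)

lemma ghol_sum: "(\<And>i. i \<in> I \<Longrightarrow> ghol U (f i)) \<Longrightarrow> ghol U (\<lambda>p. \<Sum>i\<in>I. f i p)"
  and ghol_prod: "(\<And>i. i \<in> I \<Longrightarrow> ghol U (f i)) \<Longrightarrow> ghol U (\<lambda>p. \<Prod>i\<in>I. f i p)"
  unfolding ghol_def by (auto intro!: continuous_intros holomorphic_intros)

lemma ghol_compose:
  assumes "ghol U f" "k holomorphic_on S" "\<And>p. p \<in> U \<Longrightarrow> f p \<in> S"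
  shows "ghol U (\<lambda>p. k (f p))"
  unfolding ghol_def
proof (intro conjI allI)
  show "continuous_on U (\<lambda>p. k (f p))"
    by (rule continuous_on_compose2[OF holomorphic_on_imp_continuous_on[OF assms(2)] ghol_continuous[OF assms(1)]])
      (use assms(3) in blast)
  show "(\<lambda>z. k (f (p + cscale z v))) holomorphic_on {z. p + cscale z v \<in> U}" for p v
    using holomorphic_on_compose_gen[of "\<lambda>z. f (p + cscale z v)" "{z. p + cscale z v \<in> U}" k S] assms
    unfolding ghol_def o_def by blast
qed

lemma ghol_affine:
  assumes "ghol U f" "continuous_on V A" "\<And>p z v. A (p + cscale z v) = A p + cscale z (B v)"
    "\<And>p. p \<in> V \<Longrightarrow> A p \<in> U"
  shows "ghol V (\<lambda>p. f (A p))"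
  unfolding ghol_def
proof (intro conjI allI)
  show "continuous_on V (\<lambda>p. f (A p))"
    using assms by (auto intro!: continuous_on_compose2[OF ghol_continuous[OF assms(1)]])
  show "(\<lambda>z. f (A (p + cscale z v))) holomorphic_on {z. p + cscale z v \<in> V}" for p v
    unfolding assms(3) by (rule ghol_line[OF assms(1)]) (metis assms(3,4) mem_Collect_eq)
qed

text \<open>Serves functions given by cases along a seam (\<open>cousin\<close>,
  \<open>cousin_ext\<close>, \<open>G\<close>): they are checked on overlapping open pieces, on each
  of which one formula is valid.\<close>

lemma ghol_local:
  assumes "\<And>p. p \<in> U \<Longrightarrow> \<exists>V. open V \<and> p \<in> V \<and> ghol V f"
  shows "ghol U f"
  unfolding ghol_def
proof (intro conjI allI)
  show "continuous_on U f"
    by (metis assms continuous_at_imp_continuous_on continuous_on_eq_continuous_at ghol_continuous)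
  fix p v
  show "(\<lambda>z. f (p + cscale z v)) holomorphic_on {z. p + cscale z v \<in> U}"
    unfolding holomorphic_on_def
  proof
    fix z assume "z \<in> {z. p + cscale z v \<in> U}"
    then obtain V where V: "open V" "p + cscale z v \<in> V" "ghol V f" using assms by blast
    have "(\<lambda>z. f (p + cscale z v)) holomorphic_on {z. p + cscale z v \<in> V}"
      using V by (simp add: ghol_lineU)
    then show "(\<lambda>z. f (p + cscale z v)) field_differentiable at z within {z. p + cscale z v \<in> U}"
      using V open_cscale_line[OF V(1), of p v]
      by (metis (mono_tags, lifting) field_differentiable_at_within holomorphic_on_imp_differentiable_at mem_Collect_eq)
  qed
qed

text \<open>Weierstrass' theorem on each complex line. It is applied to difference quotients, to
  truncated improper integrals and to the Picard iterates.\<close>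

lemma ghol_uniform_limit:
  assumes "open U" "\<And>n::nat. ghol U (f n)" "uniform_limit U f g sequentially"
  shows "ghol U g"
  unfolding ghol_def
proof (intro conjI allI)
  show "continuous_on U g"
    using uniform_limit_theorem[OF _ assms(3)] assms(2) by (simp add: ghol_continuous)
  fix p v
  let ?S = "{z. p + cscale z v \<in> U}"
  show "(\<lambda>z. g (p + cscale z v)) holomorphic_on ?S"
  proof (rule holomorphic_uniform_sequence[where f = "\<lambda>n z. f n (p + cscale z v)"])
    show o: "open ?S" by (rule open_cscale_line[OF assms(1)])
    show "(\<lambda>z. f n (p + cscale z v)) holomorphic_on ?S" for n using assms(2) by (rule ghol_lineU)
    fix z assume "z \<in> ?S"
    then obtain d where d: "0 < d" "cball z d \<subseteq> ?S" using o open_contains_cball by blast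
    moreover have "uniform_limit (cball z d) (\<lambda>n z. f n (p + cscale z v)) (\<lambda>z. g (p + cscale z v)) sequentially"
      using assms(3) d(2) 
      unfolding uniform_limit_iff
    proof (intro allI impI)
      fix e :: real assume "\<forall>e>0. \<forall>\<^sub>F n in sequentially. \<forall>x\<in>U. dist (f n x) (g x) < e" "0 < e"
      then have "\<forall>\<^sub>F n in sequentially. \<forall>x\<in>U. dist (f n x) (g x) < e" by blast
      then show "\<forall>\<^sub>F n in sequentially. \<forall>x\<in>cball z d. dist (f n (p + cscale x v)) (g (p + cscale x v)) < e"
        by (rule eventually_mono) (use d(2) in auto)
    qed
    ultimately show "\<exists>d>0. cball z d \<subseteq> ?S \<and> uniform_limit (cball z d) (\<lambda>n z. f n (p + cscale z v)) (\<lambda>z. g (p + cscale z v)) sequentially"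
      by blast
  qed
qed

lemma ghol_locally_bounded:
  assumes "open U" "ghol U f" "p \<in> U"
  obtains r M where "0 < r" "cball p r \<subseteq> U" "0 < M" "\<And>q. q \<in> cball p r \<Longrightarrow> cmod (f q) \<le> M"
proof -
  obtain r where r: "0 < r" "cball p r \<subseteq> U" using assms open_contains_cball by blast
  have "compact (f ` cball p r)"
    by (rule compact_continuous_image) (use assms r in \<open>auto intro: continuous_on_subset ghol_continuous\<close>)
  then obtain M where "0 < M" "\<And>q. q \<in> cball p r \<Longrightarrow> cmod (f q) \<le> M"
    using compact_imp_bounded bounded_pos by (metis image_eqI)
  then show ?thesis using that r by blast
qed

section \<open>Directional derivatives and complex differentiability\<close>

text \<open>Around every point of the closed unit disc the disc of radius R/2 still lies in
  \<open>ball 0 R\<close>, so Cauchy's inequality bounds the second derivative by 2! M / (R/2)^2,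
  the source of the 8. The explicit power of R becomes the factor |v|^2 once a line is parametrized
  by v.\<close>

lemma Taylor1_bound:
  assumes hol: "g holomorphic_on ball 0 R" and R: "2 < R" and M: "\<And>z. z \<in> ball 0 R \<Longrightarrow> cmod (g z) \<le> M"
  shows "cmod (g 1 - g 0 - deriv g 0) \<le> 8 * M / R\<^sup>2"
proof -
  have d2: "cmod (deriv (deriv g) z) \<le> 8 * M / R\<^sup>2" if "z \<in> cball 0 1" for z
  proof -
    have sub: "cball z (R/2) \<subseteq> ball 0 R" 
    proof
      fix x assume "x \<in> cball z (R/2)"
      then have "dist 0 x \<le> dist 0 z + dist z x" "dist z x \<le> R/2" "dist 0 z \<le> 1"
        using that dist_triangle[of 0 x z] by auto
      then show "x \<in> ball 0 R" using R by simp
    qed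
    have "norm ((deriv ^^ 2) g z) \<le> fact 2 * M / (R/2)^2"
    proof (rule Cauchy_inequality)
      show "g holomorphic_on ball z (R/2)" "continuous_on (cball z (R/2)) g"
        using sub hol ball_subset_cball by (meson holomorphic_on_subset holomorphic_on_imp_continuous_on order_trans)+
      show "norm (g x) \<le> M" if "norm (z - x) = R / 2" for x
        using sub that by (intro M) (auto simp: dist_norm subset_iff)
    qed (use R in auto)
    then show ?thesis by (simp add: numeral_2_eq_2 field_simps)
  qed
  have hol1: "deriv g holomorphic_on ball 0 R" by (intro holomorphic_deriv hol) auto
  have "cmod (g 1 - (\<Sum>i\<le>1. (if i = 0 then g else if i = 1 then deriv g else deriv (deriv g)) 0 * (1 - 0) ^ i / fact i)) \<le>
      8 * M / R\<^sup>2 * cmod (1 - 0) ^ (Suc 1) / fact 1"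
  proof (rule complex_Taylor[where S = "cball 0 1" and
        f = "\<lambda>i::nat. if i = 0 then g else if i = 1 then deriv g else deriv (deriv g)", of "1::nat", simplified if_P simp_thms])
    fix i::nat and x :: complex assume "x \<in> cball 0 1" "i \<le> 1"
    then have "x \<in> ball 0 R" using R by auto
    then show "((if i = 0 then g else if i = 1 then deriv g else deriv (deriv g)) has_field_derivative
      (if Suc i = 0 then g else if Suc i = 1 then deriv g else deriv (deriv g)) x) (at x within cball 0 1)"
      using \<open>i \<le> 1\<close> holomorphic_derivI[OF hol, of x] holomorphic_derivI[OF hol1, of x] 
      by (auto intro: has_field_derivative_at_within)
  qed (use d2 in auto)
  then show ?thesis by (simp add: diff_diff_eq)
qed

text \<open>A one-variable derivative along the line through p. Homogeneity in v is the chain rule;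
  additivity is a theorem, \<open>ddir_add\<close>.\<close>

definition ddir :: "(complex \<times> (complex^'n) \<Rightarrow> complex) \<Rightarrow> complex \<times> (complex^'n) \<Rightarrow> complex \<times> (complex^'n) \<Rightarrow> complex" where
  "ddir f p v = deriv (\<lambda>z. f (p + cscale z v)) 0"

lemma ddir_Taylor:
  assumes "ghol U f" "\<And>q. q \<in> cball p r \<Longrightarrow> q \<in> U \<and> cmod (f q) \<le> M" "norm v < r / 2"
  shows "cmod (f (p + v) - f p - ddir f p v) \<le> 8 * M / r\<^sup>2 * (norm v)\<^sup>2"
proof (cases "v = 0")
  case True
  have "(\<lambda>z. f (p + cscale z 0)) = (\<lambda>z. f p)" by simp
  then show ?thesis using True by (simp add: ddir_def)
next
  case False
  have r: "0 < r" using assms(3) by (smt (verit) norm_ge_zero divide_nonpos_pos)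
  let ?g = "\<lambda>z. f (p + cscale z v)"
  have in_ball: "p + cscale z v \<in> cball p r" if "z \<in> ball 0 (r / norm v)" for z
    using that False by (auto simp: dist_norm field_simps)
  have "cmod (?g 1 - ?g 0 - deriv ?g 0) \<le> 8 * M / (r / norm v)\<^sup>2"
  proof (rule Taylor1_bound)
    show "?g holomorphic_on ball 0 (r / norm v)"
      using assms in_ball by (intro ghol_line[OF assms(1)]) blast
    show "2 < r / norm v" using assms(3) False by (simp add: field_simps)
  qed (use assms(2) in_ball in auto)
  then show ?thesis by (simp add: ddir_def power_divide)
qed

lemma ghol_line_deriv:
  assumes "open U" "ghol U f" "q \<in> U"
  shows "((\<lambda>z. f (q + cscale z w)) has_field_derivative ddir f q w) (at 0)"
proof -
  have "(\<lambda>z. f (q + cscale z w)) holomorphic_on {z. q + cscale z w \<in> U}" by (rule ghol_lineU[OF assms(2)])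
  then show ?thesis
    unfolding ddir_def using open_cscale_line[OF assms(1), of q w] assms(3) by (auto intro!: holomorphic_derivI)
qed

lemma ddir_cscale:
  assumes "open U" "ghol U f" "q \<in> U"
  shows "ddir f q (cscale a w) = a * ddir f q w"
proof -
  have "((\<lambda>z. f (q + cscale z w)) has_field_derivative ddir f q w) (at (0 * a))"
    using ghol_line_deriv[OF assms] by simp
  then have "((\<lambda>z. f (q + cscale (z * a) w)) has_field_derivative ddir f q w * a) (at 0)"
    by (rule DERIV_chain2) (auto intro!: derivative_eq_intros)
  then show ?thesis unfolding ddir_def[of f q "cscale a w"] by (simp add: cscale_simps DERIV_imp_deriv mult.commute)
qed

text \<open>Difference quotients with a fixed step are again continuous and holomorphic on lines,
  and \<open>ddir_Taylor\<close> makes them converge uniformly near p with an error proportional to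
  the step.\<close>

lemma ghol_ddir:
  assumes U: "open U" and f: "ghol U f"
  shows "ghol U (\<lambda>p. ddir f p v)"
proof (rule ghol_local)
  fix p assume p: "p \<in> U"
  obtain r M where r: "0 < r" "cball p r \<subseteq> U" "0 < M" "\<And>q. q \<in> cball p r \<Longrightarrow> cmod (f q) \<le> M"
    using ghol_locally_bounded[OF U f p] by blast
  let ?V = "ball p (r/4)"
  have in1: "x \<in> cball p r" if "q \<in> ?V" "x \<in> cball q (r/2)" for q x
    using that dist_triangle[of p x q] zero_le_dist[of q x] unfolding mem_cball mem_ball by linarith
  \<comment> \<open>The steps are 1/(n + N) with N so large that every shift by \<open>c n\<close>
    times v is shorter than r/4. Quotients based in \<open>ball p (r/4)\<close> then only use values
    of f in \<open>cball p r\<close>, where M is a bound.\<close>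
  obtain N0 :: nat where N0: "norm v * 4 / r < real N0" using reals_Archimedean2 by blast
  define N where "N = Suc N0"
  have N: "norm v * 4 / r < real N" "0 < N" using N0 by (auto simp: N_def)
  define c where "c n = complex_of_real (1 / real (n + N))" for n
  have c: "cmod (c n) = 1 / real (n + N)" for n unfolding c_def norm_of_real by simp
  have c0: "c n \<noteq> 0" for n using N unfolding c_def of_real_eq_0_iff by simp
  have nv: "norm (cscale (c n) v) < r / 2 / 2" for n
  proof -
    have "norm v * 4 < r * real N" using N r(1) by (simp add: field_simps)
    also have "\<dots> \<le> r * real (n + N)" using r(1) by simp
    finally have "norm v * 4 < r * real (n + N)" .
    then show ?thesis unfolding norm_cscale c using N r(1) by (simp add: field_simps)
  qed
  define F where "F n q = (f (q + cscale (c n) v) - f q) / c n" for n q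
  have sub: "q \<in> U" if "q \<in> ?V" for q using in1[OF that, of q] r(1,2) by (auto simp del: split_paired_All split_paired_Ex)
  have hF: "ghol ?V (F n)" for n
    unfolding F_def
  proof (intro ghol_divide ghol_diff ghol_const)
    show "ghol ?V (\<lambda>q. f (q + cscale (c n) v))"
    proof (rule ghol_affine[OF f, where B = "\<lambda>v. v"])
      show "q + cscale (c n) v \<in> U" if "q \<in> ?V" for q
      proof -
        have "dist q (q + cscale (c n) v) = norm (cscale (c n) v)" by (simp add: dist_norm)
        then have "q + cscale (c n) v \<in> cball q (r/2)" using nv[of n] r(1) unfolding mem_cball by linarith
        then show ?thesis using in1[OF that] r(2) by blast
      qed
    qed (auto intro!: continuous_intros)
    show "ghol ?V f" using sub by (intro ghol_subset[OF f]) auto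
  qed (use c0 in auto)
  define C where "C = 8 * M / (r/2)\<^sup>2 * (norm v)\<^sup>2"
  have est: "cmod (F n q - ddir f q v) \<le> C * (1 / real (n + N))" if q: "q \<in> ?V" for n q
  proof -
    have "cmod (f (q + cscale (c n) v) - f q - ddir f q (cscale (c n) v)) \<le> 8 * M / (r/2)\<^sup>2 * (norm (cscale (c n) v))\<^sup>2"
    proof (rule ddir_Taylor[OF f])
      show "x \<in> U \<and> cmod (f x) \<le> M" if "x \<in> cball q (r/2)" for x
        using in1[OF q that] r(2,4) by blast
    qed (rule nv)
    also have "\<dots> = C * (cmod (c n))\<^sup>2" by (simp add: C_def power_mult_distrib)
    finally have *: "cmod (f (q + cscale (c n) v) - f q - c n * ddir f q v) \<le> C * (cmod (c n))\<^sup>2"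
      using ddir_cscale[OF U f sub[OF q]] by simp
    have "F n q - ddir f q v = (f (q + cscale (c n) v) - f q - c n * ddir f q v) / c n"
      using c0 by (simp add: F_def field_simps)
    then have "cmod (F n q - ddir f q v) \<le> C * (cmod (c n))\<^sup>2 / cmod (c n)"
      using * by (simp add: norm_divide divide_right_mono)
    also have "\<dots> = C * (1 / real (n + N))" using c0[of n] unfolding c[symmetric] by (simp add: power2_eq_square)
    finally show ?thesis .
  qed
  have "ghol ?V (\<lambda>q. ddir f q v)"
  proof (rule ghol_uniform_limit[of _ F, OF _ hF])
    have "(\<lambda>n. C * (1 / real (n + N))) \<longlonglongrightarrow> C * 0"
      by (intro tendsto_intros LIMSEQ_ignore_initial_segment[of "\<lambda>n. 1 / real n"] lim_1_over_n)
    then have lim: "(\<lambda>n. C * (1 / real (n + N))) \<longlonglongrightarrow> 0" by simp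
    show "uniform_limit ?V F (\<lambda>q. ddir f q v) sequentially"
      unfolding uniform_limit_iff
    proof (intro allI impI)
      fix e :: real assume "0 < e"
      then have "\<forall>\<^sub>F n in sequentially. C * (1 / real (n + N)) < e" by (rule order_tendstoD(2)[OF lim])
      then show "\<forall>\<^sub>F n in sequentially. \<forall>x\<in>?V. dist (F n x) (ddir f x v) < e"
      proof (rule eventually_mono, intro ballI)
        fix n x assume "C * (1 / real (n + N)) < e" "x \<in> ?V"
        then show "dist (F n x) (ddir f x v) < e" using est[of x n] unfolding dist_norm by linarith
      qed
    qed
  qed auto
  then show "\<exists>V. open V \<and> p \<in> V \<and> ghol V (\<lambda>q. ddir f q v)" using r(1) by (intro exI[of _ ?V]) auto
qed

text \<open>The increment along t(v + w) is split at p + t w. Comparing the three first-order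
  expansions, each with an error O(t^2), and dividing by t gives additivity up to O(t), except that
  the v-derivative sits at p + t w; its continuity in the base point, from \<open>ghol_ddir\<close>,
  moves it back to p.\<close>

lemma ddir_add:
  assumes U: "open U" and f: "ghol U f" and p: "p \<in> U"
  shows "ddir f p (v + w) = ddir f p v + ddir f p w"
proof -
  obtain r M where r: "0 < r" "cball p r \<subseteq> U" "0 < M" "\<And>q. q \<in> cball p r \<Longrightarrow> cmod (f q) \<le> M"
    using ghol_locally_bounded[OF U f p] by blast
  have in1: "x \<in> cball p r" if "q \<in> cball p (r/2)" "x \<in> cball q (r/2)" for q x
    using that dist_triangle[of p x q] by auto
  define S where "S = norm v + norm w + 1"
  have S: "0 < S" "norm v \<le> S" "norm w \<le> S" "norm (v + w) \<le> S" 
    using norm_triangle_ineq[of v w] norm_ge_zero[of v] norm_ge_zero[of w] unfolding S_def by linarith+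
  define K where "K = 8 * M / (r/2)\<^sup>2 * S\<^sup>2"
  have K0: "0 \<le> K" using r by (simp add: K_def)
  \<comment> \<open>The defect of additivity with the v-derivative taken at the shifted point. It
    tends to the true defect by continuity and to 0 by \<open>Eb\<close>.\<close>
  define E where "E t = ddir f (p + cscale (complex_of_real t) w) v - (ddir f p (v + w) - ddir f p w)" for t
  have tay: "cmod (f (q + cscale (of_real t) u) - f q - of_real t * ddir f q u) \<le> K * t\<^sup>2"
    if q: "q \<in> cball p (r/2)" and t: "0 < t" "t * S < r / 4" and u: "norm u \<le> S" for q t u
  proof -
    have tu: "t * norm u \<le> t * S" using t u by simp
    have qU: "q \<in> U" using in1[OF q, of q] r by auto
    have "cmod (f (q + cscale (of_real t) u) - f q - ddir f q (cscale (of_real t) u)) \<le> 8 * M / (r/2)\<^sup>2 * (norm (cscale (of_real t) u))\<^sup>2"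
    proof (intro ddir_Taylor[OF f])
      show "norm (cscale (complex_of_real t) u) < r / 2 / 2"
        unfolding norm_cscale norm_of_real abs_of_pos[OF t(1)] using t tu by linarith
      show "x \<in> U \<and> cmod (f x) \<le> M" if "x \<in> cball q (r/2)" for x
        using in1[OF q that] r(2,4) by blast
    qed
    also have "\<dots> \<le> 8 * M / (r/2)\<^sup>2 * (t * S)\<^sup>2"
      using t tu r by (intro mult_left_mono power_mono) auto
    finally show ?thesis using ddir_cscale[OF U f qU] by (simp add: K_def power_mult_distrib mult_ac)
  qed
  have Eb: "cmod (E t) \<le> 3 * K * t" if t: "0 < t" "t * S < r / 4" for t
  proof -
    let ?t = "complex_of_real t"
    let ?q = "p + cscale ?t w"
    have "t * norm w \<le> t * S" using t S by simp
    then have q: "?q \<in> cball p (r/2)" 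
    proof -
      have "dist p ?q = t * norm w" using t by (simp add: dist_norm)
      then show ?thesis using t r(1) \<open>t * norm w \<le> t * S\<close> unfolding mem_cball by linarith
    qed
    have pq: "p \<in> cball p (r/2)" using r by auto
    have "of_real t * E t = (f (p + cscale ?t (v + w)) - f p - ?t * ddir f p (v + w)) 
       - (f (?q + cscale ?t v) - f ?q - ?t * ddir f ?q v)
       - (f (p + cscale ?t w) - f p - ?t * ddir f p w)"
      by (simp add: E_def cscale_simps algebra_simps)
    then have "cmod (of_real t * E t) \<le> K * t\<^sup>2 + K * t\<^sup>2 + K * t\<^sup>2"
      using tay[OF pq t S(4)] tay[OF q t S(2)] tay[OF pq t S(3)] 
      by (smt (verit) norm_triangle_ineq4)
    then have "t * cmod (E t) \<le> t * (3 * K * t)" using t by (simp add: norm_mult power2_eq_square mult_ac)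
    then show ?thesis using t by simp
  qed
  have cont: "continuous_on U (\<lambda>q. ddir f q v)" using ghol_ddir[OF U f] by (rule ghol_continuous)
  have "isCont (\<lambda>q. ddir f q v) (p + cscale (complex_of_real 0) w)" 
    using cont U p by (simp add: continuous_on_eq_continuous_at)
  moreover have "isCont (\<lambda>t. p + cscale (complex_of_real t) w) 0"
  proof -
    have "continuous_on UNIV (\<lambda>t. p + cscale (complex_of_real t) w)" by (intro continuous_intros)
    then show ?thesis by (simp add: continuous_on_eq_continuous_at)
  qed
  ultimately have "isCont (\<lambda>t. ddir f (p + cscale (complex_of_real t) w) v) 0"
    by (rule isCont_o2[rotated])
  then have "(\<lambda>t. ddir f (p + cscale (complex_of_real t) w) v) \<midarrow>0\<rightarrow> ddir f p v"
    unfolding isCont_def by simp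
  then have lim1: "(E \<longlongrightarrow> ddir f p v - (ddir f p (v + w) - ddir f p w)) (at_right 0)"
    unfolding E_def by (intro tendsto_intros) (auto intro: filterlim_mono at_le)
  have lim2: "(E \<longlongrightarrow> 0) (at_right 0)"
  proof (rule Lim_null_comparison)
    show "((\<lambda>t. 3 * K * t) \<longlongrightarrow> 0) (at_right 0)" by (rule tendsto_eq_intros | simp)+
    have "\<forall>\<^sub>F t in at_right 0. t \<in> {0<..<r / (4 * S)}"
      using r S by (intro eventually_at_right_real) auto
    then show "\<forall>\<^sub>F t in at_right 0. cmod (E t) \<le> 3 * K * t"
      by (rule eventually_mono) (use Eb S r in \<open>auto simp: field_simps\<close>)
  qed
  show ?thesis using tendsto_unique[OF _ lim1 lim2] by simp
qed

text \<open>Linearity comes from \<open>ddir_add\<close> and \<open>ddir_cscale\<close>, and the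
  Taylor estimate along lines is uniform in the direction, so the directional derivatives assemble
  to a total derivative.\<close>

lemma ghol_has_derivative:
  assumes U: "open U" and f: "ghol U f" and p: "p \<in> U"
  shows "(f has_derivative ddir f p) (at p)"
proof -
  obtain r M where r: "0 < r" "cball p r \<subseteq> U" "0 < M" "\<And>q. q \<in> cball p r \<Longrightarrow> cmod (f q) \<le> M"
    using ghol_locally_bounded[OF U f p] by blast
  define K where "K = 8 * M / r\<^sup>2"
  have lin: "bounded_linear (ddir f p)"
  proof (intro linear_conv_bounded_linear[THEN iffD1] linearI)
    show "ddir f p (v + w) = ddir f p v + ddir f p w" for v w by (rule ddir_add[OF assms])
    show "ddir f p (c *\<^sub>R v) = c *\<^sub>R ddir f p v" for c v
      using ddir_cscale[OF assms, of "of_real c" v] by (simp add: cscale_of_real scaleR_conv_of_real)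
  qed
  show ?thesis
    unfolding has_derivative_at
  proof (intro conjI lin)
    show "(\<lambda>h. norm (f (p + h) - f p - ddir f p h) / norm h) \<midarrow>0\<rightarrow> 0"
    proof (rule Lim_null_comparison)
      show "(\<lambda>h. K * norm h) \<midarrow>0\<rightarrow> 0" 
        by (rule tendsto_eq_intros refl tendsto_norm_zero | simp)+
      have "norm (norm (f (p + h) - f p - ddir f p h) / norm h) \<le> K * norm h" if "dist h 0 < r / 2" "h \<noteq> 0" for h
      proof -
        have "cmod (f (p + h) - f p - ddir f p h) \<le> K * (norm h)\<^sup>2"
          using that r unfolding K_def by (intro ddir_Taylor[OF f]) auto
        then show ?thesis using that by (simp add: divide_le_eq power2_eq_square mult_ac)
      qed
      then show "\<forall>\<^sub>F h in at 0. norm (norm (f (p + h) - f p - ddir f p h) / norm h) \<le> K * norm h"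
        unfolding eventually_at using r by (intro exI[of _ "r/2"]) auto
    qed
  qed
qed

lemma has_derivative_vecI:
  fixes F :: "'a::real_normed_vector \<Rightarrow> complex^'m"
  assumes "\<And>i. ((\<lambda>p. F p $ i) has_derivative (\<lambda>v. D v $ i)) (at p within S)"
  shows "(F has_derivative D) (at p within S)"
proof -
  have F: "F = (\<lambda>p. \<Sum>i\<in>UNIV. axis i (F p $ i))" and D: "D = (\<lambda>v. \<Sum>i\<in>UNIV. axis i (D v $ i))"
    by (auto simp: fun_eq_iff vec_eq_iff axis_def)
  have ax: "bounded_linear (\<lambda>c::complex. axis i c :: complex^'m)" for i :: 'm
    by (intro linear_conv_bounded_linear[THEN iffD1] linearI) (auto simp: axis_def vec_eq_iff)
  show ?thesis
    by (subst F, subst D) (intro has_derivative_sum bounded_linear.has_derivative[OF ax] assms)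
qed

lemma ghol_vec_has_derivative:
  assumes "open U" "\<And>i. ghol U (\<lambda>p. F p $ i)" "p \<in> U"
  shows "(F has_derivative (\<lambda>v. \<chi> i. ddir (\<lambda>p. F p $ i) p v)) (at p)"
  by (rule has_derivative_vecI) (use ghol_has_derivative[OF assms(1,2,3)] in simp)

lemma ghol_vec_imp_holo_pair:
  assumes "open U" "\<And>i. ghol U (\<lambda>p. F p $ i)"
  shows "holo_pair U F"
  unfolding holo_pair_def
proof
  fix p assume p: "p \<in> U"
  have "ddir (\<lambda>p. F p $ i) p (c * a, c *s v) = c * ddir (\<lambda>p. F p $ i) p (a, v)" for i c a v
    using ddir_cscale[OF assms(1,2) p, of i c "(a, v)"] by (simp add: cscale_def)
  then show "\<exists>L. (F has_derivative L) (at p) \<and> (\<forall>c a v. L (c * a, c *s v) = c *s L (a, v))"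
    using ghol_vec_has_derivative[OF assms(1,2) p] by (intro exI conjI) (auto simp: vec_eq_iff)
qed

section \<open>Composition of holomorphic maps\<close>

text \<open>The inner maps restricted to a line form a holomorphic curve, and complex linearity of L
  turns the real chain rule into a complex derivative. The outer map is only asked to be complex
  differentiable at the points reached, so that both \<open>ghol\<close> and \<open>holo_vec\<close>
  maps can take its place.\<close>

lemma ghol_compose_diff:
  fixes A :: "complex \<times> (complex^'n) \<Rightarrow> complex" and B :: "complex \<times> (complex^'n) \<Rightarrow> complex^'m"
  assumes U: "open U" and A: "ghol U A" and B: "\<And>i. ghol U (\<lambda>p. B p $ i)"
    and V: "\<And>p. p \<in> U \<Longrightarrow> \<exists>L. (f has_derivative L) (at (A p, B p)) \<and> (\<forall>c v. L (cscale c v) = c * L v)"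
  shows "ghol U (\<lambda>p. f (A p, B p))"
  unfolding ghol_def
proof (intro conjI allI)
  have c2: "continuous_on U B"
    using continuous_on_vec_lambda[of U "\<lambda>i p. B p $ i"] B by (simp add: ghol_continuous)
  show "continuous_on U (\<lambda>p. f (A p, B p))"
  proof (rule continuous_at_imp_continuous_on, rule ballI)
    fix p assume p: "p \<in> U"
    have "isCont (\<lambda>p. (A p, B p)) p"
      using c2 ghol_continuous[OF A] U p by (auto simp: continuous_on_eq_continuous_at intro!: continuous_intros)
    moreover have "isCont f (A p, B p)" using V[OF p] has_derivative_continuous by blast
    ultimately show "isCont (\<lambda>p. f (A p, B p)) p" by (rule isCont_o2)
  qed
  fix p v
  let ?S = "{z. p + cscale z v \<in> U}"
  have o: "open ?S" by (rule open_cscale_line[OF U])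
  have "(\<lambda>z. f (A (p + cscale z v), B (p + cscale z v))) field_differentiable at z" if z: "z \<in> ?S" for z
  proof -
    let ?q = "p + cscale z v"
    obtain L where L: "(f has_derivative L) (at (A ?q, B ?q))" "\<And>c v. L (cscale c v) = c * L v" using V z by blast
    have h: "(\<lambda>z. A (p + cscale z v)) holomorphic_on ?S" "(\<lambda>z. B (p + cscale z v) $ i) holomorphic_on ?S" for i
      using ghol_lineU[OF A] ghol_lineU[OF B] by blast+
    obtain d1 where d1: "((\<lambda>z. A (p + cscale z v)) has_field_derivative d1) (at z)"
      using h(1) z o holomorphic_derivI by blast
    have "\<exists>d. ((\<lambda>z. B (p + cscale z v) $ i) has_field_derivative d) (at z)" for i
      using h(2) z o holomorphic_derivI by blast
    then obtain d2 where d2: "\<And>i. ((\<lambda>z. B (p + cscale z v) $ i) has_field_derivative d2 i) (at z)" by metis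
    have "((\<lambda>z. B (p + cscale z v)) has_derivative (\<lambda>h. h *s (\<chi> i. d2 i))) (at z)"
      by (rule has_derivative_vecI) (use d2 in \<open>simp add: has_field_derivative_def mult_commute_abs\<close>)
    then have "((\<lambda>z. (A (p + cscale z v), B (p + cscale z v))) has_derivative (\<lambda>h. cscale h (d1, \<chi> i. d2 i))) (at z)"
      using d1 unfolding has_field_derivative_def
      by (auto intro!: derivative_eq_intros simp: cscale_def mult.commute)
    then have "((\<lambda>z. f (A (p + cscale z v), B (p + cscale z v))) has_derivative (\<lambda>h. L (cscale h (d1, \<chi> i. d2 i)))) (at z)"
      by (rule has_derivative_compose) (use L in auto)
    then show ?thesis
      unfolding field_differentiable_def has_field_derivative_def L(2)
      by (intro exI[of _ "L (d1, \<chi> i. d2 i)"]) (auto simp: mult.commute[of "L _"] elim!: has_derivative_eq_rhs)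
  qed
  then show "(\<lambda>z. f (A (p + cscale z v), B (p + cscale z v))) holomorphic_on ?S"
    by (auto simp: holomorphic_on_def intro: field_differentiable_at_within)
qed

lemma ghol_compose_ghol:
  assumes "open U" "ghol U A" "\<And>i. ghol U (\<lambda>p. B p $ i)" "open V" "ghol V f"
    "\<And>p. p \<in> U \<Longrightarrow> (A p, B p) \<in> V"
  shows "ghol U (\<lambda>p. f (A p, B p))"
  using assms by (intro ghol_compose_diff) (auto intro!: ghol_has_derivative ddir_cscale exI)

lemma ghol_compose_holo_vec:
  assumes "open U" "\<And>i. ghol U (\<lambda>p. F p $ i)" "holo_vec V g" "\<And>p. p \<in> U \<Longrightarrow> F p \<in> V"
  shows "ghol U (\<lambda>p. g (F p) $ j)"
proof -
  \<comment> \<open>A dummy first coordinate 0 lets g be read as a function on C^(n+1).\<close>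
  have "ghol U (\<lambda>p. (\<lambda>q. g (snd q) $ j) (0::complex, F p))"
  proof (rule ghol_compose_diff[where f = "\<lambda>q. g (snd q) $ j" and A = "\<lambda>_. 0" and B = F])
    show "open U" "ghol U (\<lambda>p. 0)" "ghol U (\<lambda>p. F p $ i)" for i using assms by auto
    fix p assume "p \<in> U"
    then obtain L where L: "(g has_derivative L) (at (F p))" "\<And>c v. L (c *s v) = c *s L v"
      using assms(3,4) unfolding holo_vec_def by blast
    have "((\<lambda>q. g (snd q)) has_derivative (\<lambda>v. L (snd v))) (at (0::complex, F p))"
      by (rule has_derivative_compose[where f = snd]) (use L in \<open>auto intro!: derivative_eq_intros\<close>)
    then have "((\<lambda>q. g (snd q) $ j) has_derivative (\<lambda>v. L (snd v) $ j)) (at (0::complex, F p))"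
      using bounded_linear.has_derivative[OF bounded_linear_vec_nth] by blast
    then show "\<exists>L. ((\<lambda>q. g (snd q) $ j) has_derivative L) (at (0::complex, F p)) \<and> (\<forall>c v. L (cscale c v) = c * L v)"
      using L(2) by (intro exI conjI) auto
  qed
  then show ?thesis by simp
qed

subsection \<open>Integrals over horizontal lines\<close>

text \<open>Morera's theorem: the integral over a triangle is interchanged with the parameter
  integral, and the inner contour integrals vanish by Cauchy.\<close>

lemma holomorphic_on_integral_param:
  fixes F :: "complex \<Rightarrow> real \<Rightarrow> complex"
  assumes S: "open S" and cont: "continuous_on (S \<times> {a..b}) (\<lambda>(z, s). F z s)"
    and hol: "\<And>s. s \<in> {a..b} \<Longrightarrow> (\<lambda>z. F z s) holomorphic_on S"
  shows "(\<lambda>z. integral {a..b} (F z)) holomorphic_on S"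
proof (rule analytic_imp_holomorphic, rule Morera_triangle[OF _ S], goal_cases)
  case 1
  show ?case using integral_continuous_on_param[of S a b F] cont by simp
next
  case (2 p q r)
  show ?case
  proof
    assume sub: "convex hull {p, q, r} \<subseteq> S"
    have swap: "contour_integral (linepath x y) (\<lambda>z. integral {a..b} (F z)) =
        integral {a..b} (\<lambda>s. contour_integral (linepath x y) (\<lambda>z. F z s))"
      and int: "(\<lambda>s. contour_integral (linepath x y) (\<lambda>z. F z s)) integrable_on {a..b}"
      if "x \<in> {p,q,r}" "y \<in> {p,q,r}" for x y
    proof -
      have "closed_segment x y \<subseteq> convex hull {p,q,r}"
        using that by (intro closed_segment_subset) (auto intro: hull_inc)
      then have seg: "linepath x y t \<in> S" if "t \<in> {0..1}" for t
        using that sub linepath_in_path by blast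
      have c: "continuous_on (cbox (0, a) (1, b)) (\<lambda>(t, s). F (linepath x y t) s * (y - x))"
        unfolding split_def
      proof (intro continuous_intros)
        show "continuous_on (cbox (0, a) (1, b)) (\<lambda>u. F (linepath x y (fst u)) (snd u))"
          by (rule continuous_on_compose2[OF cont[unfolded split_def], of _ "\<lambda>u. (linepath x y (fst u), snd u)", simplified])
            (use seg in \<open>auto intro!: continuous_intros continuous_on_linepath simp: cbox_Pair_eq linepath_def\<close>)
      qed
      have "contour_integral (linepath x y) (\<lambda>z. integral {a..b} (F z)) =
          integral {0..1} (\<lambda>t. integral {a..b} (\<lambda>s. F (linepath x y t) s * (y - x)))"
        unfolding contour_integral_integral by simp
      also have "\<dots> = integral {a..b} (\<lambda>s. integral {0..1} (\<lambda>t. F (linepath x y t) s * (y - x)))"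
        using integral_swap_continuous[OF c] by simp
      finally show "contour_integral (linepath x y) (\<lambda>z. integral {a..b} (F z)) =
        integral {a..b} (\<lambda>s. contour_integral (linepath x y) (\<lambda>z. F z s))"
        unfolding contour_integral_integral by simp
      have "continuous_on (cbox a b) (\<lambda>s. integral (cbox 0 1) (\<lambda>t. F (linepath x y t) s * (y - x)))"
      proof (rule integral_continuous_on_param)
        show "continuous_on (cbox a b \<times> cbox 0 1) (\<lambda>(s, t). F (linepath x y t) s * (y - x))"
          using swap_continuous[OF c] by (simp add: cbox_Pair_eq)
      qed
      then show "(\<lambda>s. contour_integral (linepath x y) (\<lambda>z. F z s)) integrable_on {a..b}"
        unfolding contour_integral_integral using integrable_continuous[of a b] by simp
    qed
    have zero: "contour_integral (linepath p q) (\<lambda>z. F z s) + contour_integral (linepath q r) (\<lambda>z. F z s) +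
        contour_integral (linepath r p) (\<lambda>z. F z s) = 0" if s: "s \<in> {a..b}" for s
    proof -
      have h: "(\<lambda>z. F z s) holomorphic_on convex hull {p,q,r}" using hol[OF s] sub by (rule holomorphic_on_subset)
      have i: "(\<lambda>z. F z s) contour_integrable_on linepath x y" if "x \<in> {p,q,r}" "y \<in> {p,q,r}" for x y
        using that by (intro contour_integrable_continuous_linepath continuous_on_subset[OF holomorphic_on_imp_continuous_on[OF h]]
          closed_segment_subset) (auto intro: hull_inc)
      have "contour_integral (linepath p q +++ linepath q r +++ linepath r p) (\<lambda>z. F z s) = 0"
        by (rule contour_integral_unique, rule Cauchy_theorem_triangle[OF h])
      then show ?thesis using i by (simp add: add.assoc)
    qed
    have "integral {a..b} (\<lambda>s. contour_integral (linepath p q) (\<lambda>z. F z s)) +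
      integral {a..b} (\<lambda>s. contour_integral (linepath q r) (\<lambda>z. F z s)) +
      integral {a..b} (\<lambda>s. contour_integral (linepath r p) (\<lambda>z. F z s)) =
      integral {a..b} (\<lambda>s. contour_integral (linepath p q) (\<lambda>z. F z s) + contour_integral (linepath q r) (\<lambda>z. F z s) +
        contour_integral (linepath r p) (\<lambda>z. F z s))"
      using int by (simp add: integral_add integrable_add)
    also have "\<dots> = integral {a..b} (\<lambda>s. 0)" by (rule integral_cong) (use zero in auto)
    finally show "contour_integral (linepath p q) (\<lambda>z. integral {a..b} (F z)) + contour_integral (linepath q r) (\<lambda>z. integral {a..b} (F z)) +
        contour_integral (linepath r p) (\<lambda>z. integral {a..b} (F z)) = 0"
      by (simp add: swap)
  qed
qed

section \<open>An integrable majorant on the real line\<close>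

text \<open>The common majorant of all integrands on horizontal lines; its total mass \<pi> cancels
  against the normalization 2 \<pi> i of the Cauchy integral.\<close>

definition lorentz :: "real \<Rightarrow> real" where "lorentz s = inverse (1 + s\<^sup>2)"

lemma lorentz_pos: "0 < lorentz s" and lorentz_le_1: "lorentz s \<le> 1"
  unfolding lorentz_def by (auto intro!: positive_imp_inverse_positive add_pos_nonneg inverse_le_1_iff[THEN iffD2] simp: not_le)

lemma continuous_on_lorentz: "continuous_on S lorentz"
  unfolding lorentz_def by (intro continuous_intros) (simp add: add_nonneg_eq_0_iff)

lemma lorentz_integrable: "lorentz integrable_on UNIV" and lorentz_integral: "integral UNIV lorentz = pi"
proof -
  have *: "einterval (-\<infinity>) \<infinity> = UNIV" by (simp add: einterval_eq_UNIV)
  have i: "set_integrable lborel UNIV lorentz"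
    using integrable_inverse_1_plus_square unfolding * lorentz_def .
  have "(LBINT x:UNIV. lorentz x) = pi"
    using LBINT_inverse_1_plus_square unfolding interval_lebesgue_integral_def * lorentz_def by simp
  then show "lorentz integrable_on UNIV" "integral UNIV lorentz = pi"
    using set_borel_integral_eq_integral[OF i] by simp_all
qed

lemma integrable_lorentz_bound:
  fixes g :: "real \<Rightarrow> complex"
  assumes c: "continuous_on UNIV g" and b: "\<And>s. cmod (g s) \<le> M * lorentz s"
  shows "g integrable_on UNIV" "(\<lambda>n. integral {-real n..real n} g) \<longlonglongrightarrow> integral UNIV g"
    "cmod (integral UNIV g) \<le> M * pi"
proof -
  define h where "h n s = (if s \<in> {-real n..real n} then g s else 0)" for n s
  have M0: "0 \<le> M" using b[of 0] lorentz_pos[of 0] norm_ge_zero[of "g 0"] by (metis order_trans mult_nonneg_nonneg zero_le_mult_iff less_le_not_le)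
  have hi: "h n integrable_on UNIV" for n
  proof -
    have "g integrable_on {-real n..real n}"
      by (intro integrable_continuous_real continuous_on_subset[OF c]) auto
    then show ?thesis unfolding h_def by (subst integrable_restrict_UNIV)
  qed
  have hint: "integral UNIV (h n) = integral {-real n..real n} g" for n
    unfolding h_def by (rule integral_restrict_UNIV)
  have Mi: "(\<lambda>s. M * lorentz s) integrable_on UNIV"
    using integrable_on_cmult_left[OF lorentz_integrable, of M] by simp
  have hb: "norm (h n s) \<le> M * lorentz s" for n s
    using b M0 lorentz_pos[of s] by (auto simp: h_def)
  have lim: "(\<lambda>n. h n s) \<longlonglongrightarrow> g s" for s
  proof (rule tendsto_eventually)
    obtain N :: nat where "\<bar>s\<bar> \<le> real N" using real_arch_simple by blast
    then have "h n s = g s" if "N \<le> n" for n using that by (auto simp: h_def)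
    then show "\<forall>\<^sub>F n in sequentially. h n s = g s" unfolding eventually_sequentially by blast
  qed
  note dc = dominated_convergence[OF hi Mi hb lim]
  show "g integrable_on UNIV" by (rule dc(1))
  show "(\<lambda>n. integral {-real n..real n} g) \<longlonglongrightarrow> integral UNIV g" using dc(2) by (simp add: hint)
  have "cmod (integral UNIV g) \<le> integral UNIV (\<lambda>s. M * lorentz s)"
    by (rule integral_norm_bound_integral[OF dc(1) Mi]) (use b in auto)
  then show "cmod (integral UNIV g) \<le> M * pi" by (simp add: lorentz_integral)
qed

text \<open>The rate \<open>e\<close> depends on the majorant alone: it is the mass of
  \<open>lorentz\<close> outside [-n, n]. Truncated integrals therefore converge uniformly in any
  parameter, as \<open>ghol_uniform_limit\<close> demands.\<close>

lemma lorentz_tail: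
  obtains e :: "nat \<Rightarrow> real" where "e \<longlonglongrightarrow> 0" 
    "\<And>(g :: real \<Rightarrow> complex) M n. continuous_on UNIV g \<Longrightarrow> (\<And>s. cmod (g s) \<le> M * lorentz s) \<Longrightarrow>
      cmod (integral UNIV g - integral {-real n..real n} g) \<le> M * e n"
proof
  define e where "e n = pi - integral {-real n..real n} lorentz" for n
  have lorentz_n: "lorentz integrable_on {-real n..real n}" for n
    by (intro integrable_continuous_real continuous_on_lorentz)
  have eq: "of_real (integral {-real n..real n} lorentz) = integral {-real n..real n} (\<lambda>s. complex_of_real (lorentz s))" for n
    by (rule integral_unique[OF has_integral_of_real[OF integrable_integral[OF lorentz_n]], symmetric])
  have eq': "of_real (integral UNIV lorentz) = integral UNIV (\<lambda>s. complex_of_real (lorentz s))"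
    by (rule integral_unique[OF has_integral_of_real[OF integrable_integral[OF lorentz_integrable]], symmetric])
  have "(\<lambda>n. integral {-real n..real n} (\<lambda>s. complex_of_real (lorentz s))) \<longlonglongrightarrow> integral UNIV (\<lambda>s. complex_of_real (lorentz s))"
    by (rule integrable_lorentz_bound(2)[of _ 1]) (auto intro!: continuous_intros continuous_on_lorentz simp: lorentz_pos less_imp_le)
  then have "(\<lambda>n. complex_of_real (integral {-real n..real n} lorentz)) \<longlonglongrightarrow> of_real (integral UNIV lorentz)"
    by (simp only: eq eq')
  then have "(\<lambda>n. integral {-real n..real n} lorentz) \<longlonglongrightarrow> pi"
    by (simp add: tendsto_of_real_iff lorentz_integral)
  then have "(\<lambda>n. pi - integral {-real n..real n} lorentz) \<longlonglongrightarrow> pi - pi" by (intro tendsto_intros)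
  then show "e \<longlonglongrightarrow> 0" by (simp add: e_def[abs_def])
  fix g :: "real \<Rightarrow> complex" and M n
  assume c: "continuous_on UNIV g" and b: "\<And>s. cmod (g s) \<le> M * lorentz s"
  let ?I = "{-real n..real n}"
  define k where "k s = g s - (if s \<in> ?I then g s else 0)" for s
  define l where "l s = M * lorentz s - (if s \<in> ?I then M * lorentz s else 0)" for s
  have gi: "g integrable_on UNIV" by (rule integrable_lorentz_bound(1)[OF c b])
  have Mi: "(\<lambda>s. M * lorentz s) integrable_on UNIV"
    using integrable_on_cmult_left[OF lorentz_integrable, of M] by simp
  have gi2: "(\<lambda>s. if s \<in> ?I then g s else 0) integrable_on UNIV"
    unfolding integrable_restrict_UNIV by (intro integrable_continuous_real continuous_on_subset[OF c]) auto
  have Mi2: "(\<lambda>s. if s \<in> ?I then M * lorentz s else 0) integrable_on UNIV"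
    unfolding integrable_restrict_UNIV using integrable_on_cmult_left[OF lorentz_n, of M n] by simp
  have "cmod (integral UNIV k) \<le> integral UNIV l"
  proof (rule integral_norm_bound_integral)
    show "k integrable_on UNIV" unfolding k_def[abs_def] by (rule integrable_diff[OF gi gi2])
    show "l integrable_on UNIV" unfolding l_def[abs_def] by (rule integrable_diff[OF Mi Mi2])
    show "cmod (k s) \<le> l s" for s using b[of s] by (auto simp: k_def l_def)
  qed
  moreover have "integral UNIV k = integral UNIV g - integral ?I g"
    unfolding k_def using integral_diff[OF gi gi2] by (simp only: integral_restrict_UNIV)
  moreover have "integral UNIV l = M * e n"
    unfolding l_def e_def integral_diff[OF Mi Mi2] integral_restrict_UNIV
    by (simp add: lorentz_integral algebra_simps)
  ultimately show "cmod (integral UNIV g - integral ?I g) \<le> M * e n" by simp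
qed

section \<open>The periodic Cauchy kernel\<close>

text \<open>The 2 \<pi> i-periodic kernel with simple poles of residue 1. With x' = exp \<sigma> and
  x = exp \<tau>, the form d\<sigma> / (exp (\<sigma> - \<tau>) - 1) equals x dx' / (x' (x' - x)),
  the Cauchy kernel normalized to vanish at x = 0. This is why the solutions are O(x).\<close>

definition periodic_kernel :: "complex \<Rightarrow> complex" where "periodic_kernel w = 1 / (exp w - 1)"

text \<open>Plane geometry: \<open>exp w\<close> has an angle of at least d with the positive real
  axis. Hence 1 has distance at least sin d from the ray through \<open>exp w\<close>, and
  \<open>exp w\<close> has distance at least sin d times its modulus from the positive axis.\<close>

lemma norm_exp_minus_1_ge:
  assumes d: "0 < d" "d \<le> pi/2" and w: "d \<le> \<bar>Im w\<bar>" "\<bar>Im w\<bar> \<le> 2 * pi - d"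
  shows "sin d \<le> cmod (exp w - 1)" "sin d * exp (Re w) \<le> cmod (exp w - 1)"
proof -
  let ?r = "exp (Re w)" and ?c = "cos (Im w)" and ?s = "sin (Im w)"
  have n2: "(cmod (exp w - 1))\<^sup>2 = (?r * ?c - 1)\<^sup>2 + (?r * ?s)\<^sup>2"
    by (simp add: cmod_power2 Re_exp Im_exp)
  have sc: "?s\<^sup>2 + ?c\<^sup>2 = 1" by simp
  have ring: "(r * c - 1)\<^sup>2 + (r * s)\<^sup>2 = r\<^sup>2 * (s\<^sup>2 + c\<^sup>2) - 2 * r * c + 1"
    "(r - c)\<^sup>2 + s\<^sup>2 = r\<^sup>2 - 2 * r * c + (s\<^sup>2 + c\<^sup>2)" for r c s :: real
    by (simp_all add: power2_eq_square algebra_simps)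
  have e3: "(cmod (exp w - 1))\<^sup>2 = ?r\<^sup>2 - 2 * ?r * ?c + 1" unfolding n2 ring(1) sc by simp
  have e1: "(cmod (exp w - 1))\<^sup>2 = (?r - ?c)\<^sup>2 + ?s\<^sup>2" unfolding e3 ring(2) sc by simp
  have e2: "(cmod (exp w - 1))\<^sup>2 = (1 - ?r * ?c)\<^sup>2 + (?r * ?s)\<^sup>2" unfolding n2 by (simp add: power2_commute)
  have r: "0 < ?r" by simp
  have sd: "0 \<le> sin d" "sin d \<le> 1" using d by (auto intro!: sin_ge_zero)
  \<comment> \<open>For an obtuse angle the law of cosines \<open>e3\<close> bounds the distance
    below by both 1 and \<open>?r\<close>. Otherwise the sine is at least sin d, and the
    decompositions \<open>e1\<close> and \<open>e2\<close> into two squares give one bound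
    each.\<close>
  consider "?c \<le> 0" | "sin d \<le> \<bar>?s\<bar>"
  proof -
    have ca: "?c = cos \<bar>Im w\<bar>" by (simp add: abs_if)
    have sa: "\<bar>?s\<bar> = \<bar>sin \<bar>Im w\<bar>\<bar>" by (simp add: abs_if)
    consider "\<bar>Im w\<bar> \<le> pi/2" | "pi/2 \<le> \<bar>Im w\<bar>" "\<bar>Im w\<bar> \<le> 3*pi/2" | "3*pi/2 \<le> \<bar>Im w\<bar>" by linarith
    then show thesis
    proof cases
      case 1
      have "sin d \<le> sin \<bar>Im w\<bar>" using d w 1 by (intro sin_monotone_2pi_le) auto
      then show ?thesis using that(2) sa by linarith
    next
      case 2
      have "cos (\<bar>Im w\<bar> - pi) \<ge> 0" using 2 by (intro cos_ge_zero) auto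
      then have "?c \<le> 0" unfolding ca cos_diff by simp
      then show ?thesis by (rule that(1))
    next
      case 3
      have "sin d \<le> sin (2 * pi - \<bar>Im w\<bar>)" using d w 3 by (intro sin_monotone_2pi_le) auto
      also have "\<dots> = - sin \<bar>Im w\<bar>" by (simp add: sin_diff)
      finally show ?thesis using that(2) sa by linarith
    qed
  qed
  then have "(sin d)\<^sup>2 \<le> (cmod (exp w - 1))\<^sup>2 \<and> (sin d * ?r)\<^sup>2 \<le> (cmod (exp w - 1))\<^sup>2"
  proof cases
    case 1
    have "?r * ?c \<le> 0" using 1 r by (simp add: mult_nonneg_nonpos)
    then have "1 \<le> (cmod (exp w - 1))\<^sup>2" "?r\<^sup>2 \<le> (cmod (exp w - 1))\<^sup>2" 
      unfolding e3 using r zero_le_power2[of ?r] by linarith+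
    moreover have "(sin d)\<^sup>2 \<le> 1" using sd by (simp add: power_le_one)
    moreover have "(sin d * ?r)\<^sup>2 \<le> ?r\<^sup>2" using sd by (simp add: power_mult_distrib power_le_one mult_left_le_one_le)
    ultimately show ?thesis by linarith
  next
    case 2
    have "(sin d)\<^sup>2 \<le> ?s\<^sup>2" using 2 sd by (metis abs_of_nonneg power2_abs power_mono)
    moreover then have "(sin d * ?r)\<^sup>2 \<le> (?r * ?s)\<^sup>2" by (simp add: power_mult_distrib mult.commute)
    ultimately show ?thesis using e1 e2 by (smt (verit) zero_le_power2)
  qed
  then show "sin d \<le> cmod (exp w - 1)" "sin d * exp (Re w) \<le> cmod (exp w - 1)"
    by (auto intro: power2_le_imp_le)
qed

lemma periodic_kernel_bound:
  assumes d: "0 < d" "d \<le> pi/2" and w: "d \<le> \<bar>Im w\<bar>" "\<bar>Im w\<bar> \<le> 2 * pi - d"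
  shows "exp w \<noteq> 1" "cmod (periodic_kernel w) \<le> 1 / sin d" "cmod (periodic_kernel w) \<le> exp (- Re w) / sin d"
proof -
  have sd: "0 < sin d" using d by (intro sin_gt_zero) auto
  note b = norm_exp_minus_1_ge[OF assms]
  show "exp w \<noteq> 1" using b(1) sd by auto
  show "cmod (periodic_kernel w) \<le> 1 / sin d"
    unfolding periodic_kernel_def norm_divide using b(1) sd by (simp add: frac_le)
  have "cmod (periodic_kernel w) \<le> 1 / (sin d * exp (Re w))"
    unfolding periodic_kernel_def norm_divide using b(2) sd by (simp add: frac_le)
  also have "\<dots> = exp (- Re w) / sin d" by (simp add: exp_minus field_simps)
  finally show "cmod (periodic_kernel w) \<le> exp (- Re w) / sin d" .
qed

text \<open>The Cauchy lines have heights 1/2 and -1/2, and they are used only at points whose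
  vertical distance from the line lies between 1/4 and 2 \<pi> - 1/4. The kernel is then bounded by
  1 / sin (1/4), hence by 5.\<close>

lemma sin_quarter: "1 / 5 \<le> sin (1/4::real)"
proof -
  have "\<bar>sin (1/4) - 1/4\<bar> \<le> (1/96 :: real)" "(0::real) \<le> 1/96"
    using Maclaurin_sin_bound[of "1/4" 3] by (auto simp: sin_coeff_def eval_nat_numeral)
  then show ?thesis by linarith
qed

section \<open>Cauchy integrals over horizontal lines\<close>

definition hline :: "real \<Rightarrow> real \<Rightarrow> complex" where "hline \<eta> s = of_real s + of_real \<eta> * \<i>"

lemma hline_simps [simp]: "Re (hline \<eta> s) = s" "Im (hline \<eta> s) = \<eta>"
  by (simp_all add: hline_def)

lemma continuous_on_hline [continuous_intros]: "continuous_on S f \<Longrightarrow> continuous_on S (\<lambda>x. hline \<eta> (f x))"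
  unfolding hline_def by (intro continuous_intros)

definition strip :: "real \<Rightarrow> real \<Rightarrow> complex set" where "strip a b = {z. a < Im z \<and> Im z < b}"

lemma open_strip [simp]: "open (strip a b)"
proof -
  have "strip a b = {z. a < Im z} \<inter> {z. Im z < b}" by (auto simp: strip_def)
  then show ?thesis by (simp add: open_halfspace_Im_gt open_halfspace_Im_lt open_Int)
qed

text \<open>The Lorentz factor makes the data integrable. The exponential factor pays for exp (- Re
  \<sigma>) in the second bound of \<open>periodic_kernel_bound\<close>, so that what remains of the
  kernel is exp (Re \<tau>).\<close>

definition decay :: "real \<Rightarrow> real" where "decay s = min 1 (exp s) * lorentz s"

lemma decay_le: "decay s \<le> lorentz s" "decay s \<le> exp s * lorentz s" "0 < decay s"
  using lorentz_pos[of s] by (auto simp: decay_def min_def mult_right_le_one_le)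

definition line_integral :: "real \<Rightarrow> (complex \<Rightarrow> complex) \<Rightarrow> complex \<Rightarrow> complex" where
  "line_integral \<eta> f \<tau> = integral UNIV (\<lambda>s. f (hline \<eta> s) * periodic_kernel (hline \<eta> s - \<tau>)) / (2 * of_real pi * \<i>)"

lemma continuous_on_periodic_kernel: "(\<And>w. w \<in> S \<Longrightarrow> exp w \<noteq> 1) \<Longrightarrow> continuous_on S periodic_kernel"
  unfolding periodic_kernel_def by (intro continuous_intros) auto

lemma holomorphic_on_periodic_kernel: "(\<And>w. w \<in> S \<Longrightarrow> exp w \<noteq> 1) \<Longrightarrow> periodic_kernel holomorphic_on S"
  unfolding periodic_kernel_def by (intro holomorphic_intros) auto

text \<open>Two majorants from the two bounds of the kernel: one uniform in \<tau>, one of order exp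
  (Re \<tau>). Together they yield the factor min 1 (exp (Re \<tau>)) in
  \<open>line_integral_bound\<close>.\<close>

lemma line_integral_integrand:
  assumes f: "continuous_on (strip (-1) 1) f" "\<And>\<sigma>. \<sigma> \<in> strip (-1) 1 \<Longrightarrow> cmod (f \<sigma>) \<le> M * decay (Re \<sigma>)"
    and \<eta>: "\<bar>\<eta>\<bar> < 1" and d: "0 < d" "d \<le> pi / 2" "d \<le> \<bar>Im \<tau> - \<eta>\<bar>" "\<bar>Im \<tau> - \<eta>\<bar> \<le> 2 * pi - d"
  shows "continuous_on UNIV (\<lambda>s. f (hline \<eta> s) * periodic_kernel (hline \<eta> s - \<tau>))"
    "cmod (f (hline \<eta> s) * periodic_kernel (hline \<eta> s - \<tau>)) \<le> M / sin d * lorentz s"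
    "cmod (f (hline \<eta> s) * periodic_kernel (hline \<eta> s - \<tau>)) \<le> M / sin d * exp (Re \<tau>) * lorentz s"
proof -
  have w: "d \<le> \<bar>Im (hline \<eta> s - \<tau>)\<bar>" "\<bar>Im (hline \<eta> s - \<tau>)\<bar> \<le> 2 * pi - d" for s
    using d by (auto simp: abs_minus_commute)
  have sd: "0 < sin d" using d by (intro sin_gt_zero) auto
  have st: "hline \<eta> s \<in> strip (-1) 1" for s using \<eta> by (auto simp: strip_def)
  note cb = periodic_kernel_bound[OF d(1,2) w]
  have "0 \<le> M * decay (Re (hline \<eta> 0))" using f(2)[OF st[of 0]] norm_ge_zero order_trans by blast
  then have M0: "0 \<le> M" using decay_le(3)[of 0] by (auto simp: zero_le_mult_iff)
  show "continuous_on UNIV (\<lambda>s. f (hline \<eta> s) * periodic_kernel (hline \<eta> s - \<tau>))"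
    by (intro continuous_intros continuous_on_compose2[OF f(1)]
      continuous_on_compose2[OF continuous_on_periodic_kernel[of "range (\<lambda>s. hline \<eta> s - \<tau>)"]]) (use st cb(1) in auto)
  have "cmod (f (hline \<eta> s) * periodic_kernel (hline \<eta> s - \<tau>)) \<le> (M * decay s) * (1 / sin d)"
    unfolding norm_mult using f(2)[OF st[of s]] cb(2)[of s] M0 decay_le(3)[of s] by (intro mult_mono) auto
  also have "\<dots> \<le> (M * lorentz s) * (1 / sin d)"
    using M0 sd decay_le(1) by (intro mult_right_mono mult_left_mono) auto
  finally show "cmod (f (hline \<eta> s) * periodic_kernel (hline \<eta> s - \<tau>)) \<le> M / sin d * lorentz s" by simp
  have "cmod (f (hline \<eta> s) * periodic_kernel (hline \<eta> s - \<tau>)) \<le> (M * decay s) * (exp (- Re (hline \<eta> s - \<tau>)) / sin d)"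
    unfolding norm_mult using f(2)[OF st[of s]] cb(3)[of s] M0 decay_le(3)[of s] by (intro mult_mono) auto
  also have "\<dots> \<le> (M * (exp s * lorentz s)) * (exp (- Re (hline \<eta> s - \<tau>)) / sin d)"
    using M0 sd decay_le(2) by (intro mult_right_mono mult_left_mono) auto
  also have "\<dots> = M / sin d * exp (Re \<tau>) * lorentz s" by (simp add: exp_diff exp_minus field_simps)
  finally show "cmod (f (hline \<eta> s) * periodic_kernel (hline \<eta> s - \<tau>)) \<le> M / sin d * exp (Re \<tau>) * lorentz s" .
qed

lemma quarter: "0 < (1/4::real)" "1/4 \<le> pi/2" "1 / sin (1/4::real) \<le> 5"
  using sin_quarter pi_gt3 by (auto simp: divide_le_eq)

text \<open>The constant is 5 \<pi> / (2 \<pi>) = 5/2, rounded up to 3.\<close>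

lemma line_integral_bound:
  assumes f: "continuous_on (strip (-1) 1) f" "\<And>\<sigma>. \<sigma> \<in> strip (-1) 1 \<Longrightarrow> cmod (f \<sigma>) \<le> M * decay (Re \<sigma>)"
    and \<eta>: "\<bar>\<eta>\<bar> < 1" and d: "1/4 \<le> \<bar>Im \<tau> - \<eta>\<bar>" "\<bar>Im \<tau> - \<eta>\<bar> \<le> 2 * pi - 1/4" and M0: "0 \<le> M"
  shows "cmod (line_integral \<eta> f \<tau>) \<le> 3 * M * min 1 (exp (Re \<tau>))"
proof -
  note b = line_integral_integrand[OF f \<eta> quarter(1,2) d]
  have M5: "M / sin (1/4) \<le> 5 * M" using mult_left_mono[OF quarter(3) M0] by simp
  have "cmod (integral UNIV (\<lambda>s. f (hline \<eta> s) * periodic_kernel (hline \<eta> s - \<tau>))) \<le> M / sin (1/4) * pi"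
    by (rule integrable_lorentz_bound(3)[OF b(1,2)])
  also have "\<dots> \<le> 5 * M * pi" using M5 by (intro mult_right_mono) auto
  finally have "cmod (line_integral \<eta> f \<tau>) \<le> 5 * M / 2" unfolding line_integral_def by (simp add: norm_divide norm_mult field_simps)
  moreover have "cmod (integral UNIV (\<lambda>s. f (hline \<eta> s) * periodic_kernel (hline \<eta> s - \<tau>))) \<le> M / sin (1/4) * exp (Re \<tau>) * pi"
    by (rule integrable_lorentz_bound(3)[OF b(1,3)])
  then have "cmod (integral UNIV (\<lambda>s. f (hline \<eta> s) * periodic_kernel (hline \<eta> s - \<tau>))) \<le> 5 * M * exp (Re \<tau>) * pi"
    using mult_right_mono[OF M5, of "exp (Re \<tau>) * pi"] by (simp add: mult.assoc)
  then have "cmod (line_integral \<eta> f \<tau>) \<le> 5 * M * exp (Re \<tau>) / 2" unfolding line_integral_def by (simp add: norm_divide norm_mult field_simps)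
  moreover have "5 * M / 2 \<le> 3 * M" "5 * M * exp (Re \<tau>) / 2 \<le> 3 * M * exp (Re \<tau>)"
    using M0 by (auto simp: field_simps)
  ultimately have "cmod (line_integral \<eta> f \<tau>) \<le> 3 * M" "cmod (line_integral \<eta> f \<tau>) \<le> 3 * M * exp (Re \<tau>)" by linarith+
  then show ?thesis by (simp add: min_def)
qed

lemma line_integral_diff:
  assumes f: "continuous_on (strip (-1) 1) f" "\<And>\<sigma>. \<sigma> \<in> strip (-1) 1 \<Longrightarrow> cmod (f \<sigma>) \<le> M * decay (Re \<sigma>)"
    and g: "continuous_on (strip (-1) 1) g" "\<And>\<sigma>. \<sigma> \<in> strip (-1) 1 \<Longrightarrow> cmod (g \<sigma>) \<le> M * decay (Re \<sigma>)"
    and \<eta>: "\<bar>\<eta>\<bar> < 1" and d: "1/4 \<le> \<bar>Im \<tau> - \<eta>\<bar>" "\<bar>Im \<tau> - \<eta>\<bar> \<le> 2 * pi - 1/4"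
  shows "line_integral \<eta> (\<lambda>\<sigma>. f \<sigma> - g \<sigma>) \<tau> = line_integral \<eta> f \<tau> - line_integral \<eta> g \<tau>"
proof -
  note bf = line_integral_integrand[OF f \<eta> quarter(1,2) d]
  note bg = line_integral_integrand[OF g \<eta> quarter(1,2) d]
  show ?thesis
    unfolding line_integral_def left_diff_distrib
    using integral_diff[OF integrable_lorentz_bound(1)[OF bf(1,2)] integrable_lorentz_bound(1)[OF bg(1,2)]]
    by (simp add: diff_divide_distrib)
qed

text \<open>Integrals over [-n, n] are holomorphic by Morera, jointly in \<tau> and the parameter Y,
  and converge uniformly by \<open>lorentz_tail\<close>.\<close>

lemma line_integral_ghol:
  fixes f :: "complex \<times> (complex^'n) \<Rightarrow> complex"
  assumes f: "ghol (strip (-1) 1 \<times> B) f" and B: "open B" and M0: "0 \<le> M"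
    and b: "\<And>p. p \<in> strip (-1) 1 \<times> B \<Longrightarrow> cmod (f p) \<le> M * decay (Re (fst p))"
    and \<eta>: "\<bar>\<eta>\<bar> < 1"
  shows "ghol ({\<tau>. 1/4 < \<bar>Im \<tau> - \<eta>\<bar> \<and> \<bar>Im \<tau> - \<eta>\<bar> < 2 * pi - 1/4} \<times> B)
    (\<lambda>p. line_integral \<eta> (\<lambda>\<sigma>. f (\<sigma>, snd p)) (fst p))"
proof -
  let ?T = "{\<tau>. 1/4 < \<bar>Im \<tau> - \<eta>\<bar> \<and> \<bar>Im \<tau> - \<eta>\<bar> < 2 * pi - 1/4}"
  let ?U = "?T \<times> B"
  have oT: "open ?T" by (intro open_Collect_conj open_Collect_less continuous_intros)
  have oU: "open ?U" using oT B by (rule open_Times)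
  define g where "g p s = f (hline \<eta> s, snd p) * periodic_kernel (hline \<eta> s - fst p)" for p s
  have st: "hline \<eta> s \<in> strip (-1) 1" for s using \<eta> by (auto simp: strip_def)
  have ne: "exp (hline \<eta> s - \<tau>) \<noteq> 1" if "\<tau> \<in> ?T" for s \<tau>
    by (rule periodic_kernel_bound(1)[OF quarter(1,2)]) (use that in \<open>auto simp: abs_minus_commute\<close>)
  have cg: "continuous_on (?U \<times> UNIV) (\<lambda>(p, s). g p s)"
    unfolding g_def split_def
    by (intro continuous_intros continuous_on_compose2[OF ghol_continuous[OF f]]
      continuous_on_compose2[OF continuous_on_periodic_kernel[of "(\<lambda>x. hline \<eta> (snd x) - fst (fst x)) ` (?U \<times> UNIV)"]])
     (use st ne in auto)
  have fY: "continuous_on (strip (-1) 1) (\<lambda>\<sigma>. f (\<sigma>, Y))" "\<And>\<sigma>. \<sigma> \<in> strip (-1) 1 \<Longrightarrow> cmod (f (\<sigma>, Y)) \<le> M * decay (Re \<sigma>)"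
    if "Y \<in> B" for Y
    using b that by (auto intro!: continuous_on_compose2[OF ghol_continuous[OF f]] continuous_intros)
  have gb: "continuous_on UNIV (g p)" "cmod (g p s) \<le> M / sin (1/4) * lorentz s" if "p \<in> ?U" for p s
    using line_integral_integrand(1,2)[OF fY \<eta> quarter(1,2), of "snd p" "fst p"] that
    unfolding g_def by (auto simp: mem_Times_iff)
  define J where "J n p = integral {-real n..real n} (g p)" for n p
  have J: "ghol ?U (J n)" for n
    unfolding ghol_def
  proof (intro conjI allI)
    have "continuous_on (?U \<times> cbox (-real n) (real n)) (\<lambda>(p, s). g p s)"
      by (rule continuous_on_subset[OF cg]) auto
    from integral_continuous_on_param[OF this] show "continuous_on ?U (J n)" by (simp add: J_def[abs_def])
    fix p v
    let ?S = "{z. p + cscale z v \<in> ?U}"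
    have "(\<lambda>z. integral {-real n..real n} (\<lambda>s. g (p + cscale z v) s)) holomorphic_on ?S"
    proof (rule holomorphic_on_integral_param)
      show "open ?S" by (rule open_cscale_line[OF oU])
      show "continuous_on (?S \<times> {-real n..real n}) (\<lambda>(z, s). g (p + cscale z v) s)"
        unfolding split_def
        by (rule continuous_on_compose2[OF cg[unfolded split_def], of _ "\<lambda>u. (p + cscale (fst u) v, snd u)", simplified])
          (auto intro!: continuous_intros)
      show "(\<lambda>z. g (p + cscale z v) s) holomorphic_on ?S" for s
        unfolding g_def
      proof (intro holomorphic_on_mult)
        have "(\<lambda>z. f ((hline \<eta> s, snd p) + cscale z (0, snd v))) holomorphic_on ?S"
          by (rule ghol_line[OF f]) (use st in \<open>auto simp: mem_Times_iff\<close>)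
        then show "(\<lambda>z. f (hline \<eta> s, snd (p + cscale z v))) holomorphic_on ?S" by (simp add: cscale_def)
        have h: "periodic_kernel holomorphic_on {w. exp w \<noteq> 1}" by (rule holomorphic_on_periodic_kernel) auto
        have "(\<lambda>z. hline \<eta> s - fst (p + cscale z v)) holomorphic_on ?S" by (simp add: cscale_def) (intro holomorphic_intros)
        note hh = this
        show "(\<lambda>z. periodic_kernel (hline \<eta> s - fst (p + cscale z v))) holomorphic_on ?S"
        proof -
          have "(\<lambda>z. hline \<eta> s - fst (p + cscale z v)) ` ?S \<subseteq> {w. exp w \<noteq> 1}"
          proof (rule image_subsetI)
            fix z assume "z \<in> ?S"
            then have "p + cscale z v \<in> ?U" by (rule CollectD)
            then have "fst (p + cscale z v) \<in> ?T" by (simp only: mem_Times_iff)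
            from ne[OF this] show "hline \<eta> s - fst (p + cscale z v) \<in> {w. exp w \<noteq> 1}" by blast
          qed
          then show ?thesis using holomorphic_on_compose_gen[OF hh h] unfolding o_def by blast
        qed
      qed
    qed
    then show "(\<lambda>z. J n (p + cscale z v)) holomorphic_on ?S" by (simp add: J_def)
  qed
  obtain e :: "nat \<Rightarrow> real" where e: "e \<longlonglongrightarrow> 0"
    "\<And>(g :: real \<Rightarrow> complex) M n. continuous_on UNIV g \<Longrightarrow> (\<And>s. cmod (g s) \<le> M * lorentz s) \<Longrightarrow>
      cmod (integral UNIV g - integral {-real n..real n} g) \<le> M * e n" by (rule lorentz_tail) blast
  have "ghol ?U (\<lambda>p. integral UNIV (g p))"
  proof (rule ghol_uniform_limit[OF oU J])
    have lim: "(\<lambda>n. M / sin (1/4) * e n) \<longlonglongrightarrow> 0" using tendsto_mult_left[OF e(1), of "M / sin (1/4)"] by simp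
    show "uniform_limit ?U J (\<lambda>p. integral UNIV (g p)) sequentially"
      unfolding uniform_limit_iff
    proof (intro allI impI)
      fix \<epsilon> :: real assume "0 < \<epsilon>"
      then have "\<forall>\<^sub>F n in sequentially. M / sin (1/4) * e n < \<epsilon>" by (rule order_tendstoD(2)[OF lim])
      then show "\<forall>\<^sub>F n in sequentially. \<forall>p\<in>?U. dist (J n p) (integral UNIV (g p)) < \<epsilon>"
      proof (rule eventually_mono, intro ballI)
        fix n p assume "M / sin (1/4) * e n < \<epsilon>" "p \<in> ?U"
        then show "dist (J n p) (integral UNIV (g p)) < \<epsilon>"
          using e(2)[OF gb, of p n] unfolding J_def by (simp add: dist_norm norm_minus_commute)
      qed
    qed
  qed
  then have "ghol ?U (\<lambda>p. integral UNIV (g p) * (1 / (2 * of_real pi * \<i>)))" by (intro ghol_mult ghol_const)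
  then show ?thesis by (simp add: line_integral_def g_def[abs_def])
qed

section \<open>Moving the line: the jump across a pole\<close>

lemma lorentz_tendsto_0: "(\<lambda>n. lorentz (real n)) \<longlonglongrightarrow> 0"
proof (rule Lim_null_comparison)
  show "(\<lambda>n. 1 / real n) \<longlonglongrightarrow> 0" by (rule lim_1_over_n)
  have "norm (lorentz (real n)) \<le> 1 / real n" if "1 \<le> n" for n
  proof -
    have "real n * 1 \<le> real n * real n" using that by (intro mult_left_mono) auto
    then have "real n \<le> 1 + (real n)\<^sup>2" by (simp add: power2_eq_square)
    then have "inverse (1 + (real n)\<^sup>2) \<le> inverse (real n)" using that by (intro le_imp_inverse_le) auto
    then show ?thesis using lorentz_pos[of "real n"] by (simp add: lorentz_def inverse_eq_divide)
  qed
  then show "\<forall>\<^sub>F n in sequentially. norm (lorentz (real n)) \<le> 1 / real n"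
    unfolding eventually_sequentially by blast
qed

lemma contour_integral_hline:
  assumes "0 < n"
  shows "contour_integral (linepath (hline \<eta> (- n)) (hline \<eta> n)) f = integral {-n..n} (\<lambda>s. f (hline \<eta> s))"
proof -
  have "contour_integral (linepath (of_real (- n)) (of_real n)) (\<lambda>z. f (z + of_real \<eta> * \<i>)) =
      integral {-n..n} (\<lambda>s. f (of_real s + of_real \<eta> * \<i>))"
    using contour_integral_linepath_Reals_eq[of "of_real (- n)" "of_real n" "\<lambda>z. f (z + of_real \<eta> * \<i>)"] assms
    by (simp del: of_real_minus)
  moreover have "contour_integral (linepath (of_real (- n)) (of_real n)) (\<lambda>z. f (z + of_real \<eta> * \<i>)) =
      contour_integral (linepath (hline \<eta> (- n)) (hline \<eta> n)) f"
    unfolding contour_integral_integral hline_def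
    by (intro integral_cong) (simp add: linepath_def scaleR_conv_of_real algebra_simps)
  ultimately show ?thesis by (simp add: hline_def)
qed

text \<open>The boundary of a rectangle between the two lines is stretched to infinity; its vertical
  sides vanish because the data decay while the kernel stays bounded there. The value c collects the
  poles in between. The clearance d is arbitrary, since \<tau> may lie close to one of the
  lines.\<close>

lemma line_integral_jump_limit:
  assumes f: "continuous_on (strip (-1) 1) f" "\<And>\<sigma>. \<sigma> \<in> strip (-1) 1 \<Longrightarrow> cmod (f \<sigma>) \<le> M * decay (Re \<sigma>)"
    and ab: "-1 < a" "a < b" "b < 1" and d: "0 < d" "d \<le> pi / 2"
      "d \<le> \<bar>Im \<tau> - a\<bar>" "\<bar>Im \<tau> - a\<bar> \<le> 2 * pi - d" "d \<le> \<bar>Im \<tau> - b\<bar>" "\<bar>Im \<tau> - b\<bar> \<le> 2 * pi - d"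
    and c: "\<And>n. \<bar>Re \<tau>\<bar> + 1 < n \<Longrightarrow>
      contour_integral (rectpath (hline a (- n)) (hline b n)) (\<lambda>\<sigma>. f \<sigma> * periodic_kernel (\<sigma> - \<tau>)) = 2 * of_real pi * \<i> * c"
  shows "line_integral a f \<tau> - line_integral b f \<tau> = c"
proof -
  define \<Phi> where "\<Phi> \<sigma> = f \<sigma> * periodic_kernel (\<sigma> - \<tau>)" for \<sigma>
  have ab': "\<bar>a\<bar> < 1" "\<bar>b\<bar> < 1" using ab by auto
  note ia = line_integral_integrand[OF f ab'(1) d(1,2,3,4)]
  note ib = line_integral_integrand[OF f ab'(2) d(1,2,5,6)]
  have M0: "0 \<le> M"
  proof -
    have "0 \<in> strip (-1) 1" by (simp add: strip_def)
    then have "0 \<le> M * decay (Re 0)" using f(2)[of 0] norm_ge_zero[of "f 0"] by linarith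
    then show ?thesis using decay_le(3)[of 0] by (auto simp: zero_le_mult_iff)
  qed
  have side: "continuous_on (closed_segment (hline a m) (hline b m)) \<Phi>"
      "cmod (contour_integral (linepath (hline a m) (hline b m)) \<Phi>) \<le> 4 * M * lorentz m"
    if m: "\<bar>Re \<tau>\<bar> + 1 < \<bar>m\<bar>" for m
  proof -
    have seg: "Re \<sigma> = m" "a \<le> Im \<sigma>" "Im \<sigma> \<le> b" if "\<sigma> \<in> closed_segment (hline a m) (hline b m)" for \<sigma>
      using that closed_segment_same_Re[of "hline a m" "hline b m"] ab by (auto simp: closed_segment_eq_real_ivl)
    have ker: "exp (\<sigma> - \<tau>) \<noteq> 1" "cmod (periodic_kernel (\<sigma> - \<tau>)) \<le> 2" if "\<sigma> \<in> closed_segment (hline a m) (hline b m)" for \<sigma>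
    proof -
      have n: "cmod (exp (\<sigma> - \<tau>)) = exp (m - Re \<tau>)" using seg[OF that] by simp
      \<comment> \<open>The side is more than 1 away from the vertical line through the poles, so
        the modulus of exp (\<sigma> - \<tau>) is at least 2 or at most 1/2.\<close>
      have "1/2 \<le> \<bar>exp (m - Re \<tau>) - 1\<bar>"
      proof (cases "0 < m")
        case True
        then have "1 + 1 \<le> exp (m - Re \<tau>)" using m exp_ge_add_one_self[of "m - Re \<tau>"] by linarith
        then show ?thesis by linarith
      next
        case False
        then have "1 \<le> - (m - Re \<tau>)" using m by linarith
        then have "2 \<le> exp (- (m - Re \<tau>))" using exp_ge_add_one_self[of "- (m - Re \<tau>)"] by linarith
        then have "1 / exp (- (m - Re \<tau>)) \<le> 1/2" by (intro frac_le) auto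
        moreover have "exp (m - Re \<tau>) = 1 / exp (- (m - Re \<tau>))" by (metis exp_minus minus_minus inverse_eq_divide)
        ultimately have "exp (m - Re \<tau>) \<le> 1/2" by simp
        then show ?thesis by linarith
      qed
      also have "\<dots> \<le> cmod (exp (\<sigma> - \<tau>) - 1)" using norm_triangle_ineq3[of "exp (\<sigma> - \<tau>)" 1] n by simp
      finally have h: "1/2 \<le> cmod (exp (\<sigma> - \<tau>) - 1)" .
      then show "exp (\<sigma> - \<tau>) \<noteq> 1" by auto
      have "1 / cmod (exp (\<sigma> - \<tau>) - 1) \<le> 1 / (1/2)" using h by (intro frac_le) auto
      then show "cmod (periodic_kernel (\<sigma> - \<tau>)) \<le> 2" by (simp add: periodic_kernel_def norm_divide)
    qed
    show c: "continuous_on (closed_segment (hline a m) (hline b m)) \<Phi>"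
      unfolding \<Phi>_def
    proof (rule continuous_on_mult)
      show "continuous_on (closed_segment (hline a m) (hline b m)) f"
        by (rule continuous_on_subset[OF f(1)]) (use seg(2,3) ab in \<open>force simp: strip_def\<close>)
      have "continuous_on {w. exp w \<noteq> 1} periodic_kernel" by (rule continuous_on_periodic_kernel) auto
      then show "continuous_on (closed_segment (hline a m) (hline b m)) (\<lambda>\<sigma>. periodic_kernel (\<sigma> - \<tau>))"
        by (rule continuous_on_compose2) (use ker(1) in \<open>auto intro!: continuous_intros\<close>)
    qed
    have "cmod (contour_integral (linepath (hline a m) (hline b m)) \<Phi>) \<le> (2 * M * lorentz m) * cmod (hline b m - hline a m)"
    proof (rule contour_integral_bound_linepath)
      show "\<Phi> contour_integrable_on linepath (hline a m) (hline b m)"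
        using c by (rule contour_integrable_continuous_linepath)
      show "0 \<le> 2 * M * lorentz m" using M0 lorentz_pos[of m] by simp
      fix x assume x: "x \<in> closed_segment (hline a m) (hline b m)"
      then have "cmod (f x) \<le> M * decay m" using f(2)[of x] seg[OF x] ab by (auto simp: strip_def)
      also have "\<dots> \<le> M * lorentz m" using M0 decay_le(1) by (intro mult_left_mono)
      finally have "cmod (f x) * cmod (periodic_kernel (x - \<tau>)) \<le> (M * lorentz m) * 2"
        using ker(2)[OF x] M0 lorentz_pos[of m] by (intro mult_mono) auto
      then show "cmod (\<Phi> x) \<le> 2 * M * lorentz m" by (simp add: \<Phi>_def norm_mult)
    qed
    also have "hline b m - hline a m = of_real (b - a) * \<i>" by (simp add: hline_def algebra_simps)
    also have "cmod (of_real (b - a) * \<i>) = b - a" using ab by (simp add: norm_mult del: of_real_diff)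
    also have "(2 * M * lorentz m) * (b - a) \<le> (2 * M * lorentz m) * 2"
      using ab M0 lorentz_pos[of m] by (intro mult_left_mono) auto
    finally show "cmod (contour_integral (linepath (hline a m) (hline b m)) \<Phi>) \<le> 4 * M * lorentz m" by simp
  qed
  let ?A = "integral UNIV (\<lambda>s. \<Phi> (hline a s))" and ?B = "integral UNIV (\<lambda>s. \<Phi> (hline b s))"
  let ?c = "2 * of_real pi * \<i> * c"
  have main: "cmod (integral {-n..n} (\<lambda>s. \<Phi> (hline a s)) - integral {-n..n} (\<lambda>s. \<Phi> (hline b s)) - ?c) \<le> 8 * M * lorentz n"
    if n: "\<bar>Re \<tau>\<bar> + 1 < n" for n
  proof -
    have n0: "0 < n" using n by linarith
    have hc: "Complex n a = hline a n" "Complex (- n) b = hline b (- n)" by (auto simp: complex_eq_iff)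
    have hor: "continuous_on (closed_segment (hline e (-n)) (hline e n)) \<Phi>" if "continuous_on UNIV (\<lambda>s. \<Phi> (hline e s))" for e
    proof -
      have "continuous_on (closed_segment (hline e (-n)) (hline e n)) (\<lambda>\<sigma>. \<Phi> (hline e (Re \<sigma>)))"
        by (rule continuous_on_compose2[OF that]) (auto intro!: continuous_intros)
      moreover have "hline e (Re \<sigma>) = \<sigma>" if "\<sigma> \<in> closed_segment (hline e (-n)) (hline e n)" for \<sigma>
        using that closed_segment_same_Im[of "hline e (-n)" "hline e n"] by (auto simp: complex_eq_iff)
      ultimately show ?thesis by (simp cong: continuous_on_cong_simp)
    qed
    have s1: "continuous_on (closed_segment (hline a (-n)) (hline a n)) \<Phi>" 
      by (rule hor) (use ia(1) in \<open>simp add: \<Phi>_def\<close>)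
    have s2: "continuous_on (closed_segment (hline b (-n)) (hline b n)) \<Phi>" 
      by (rule hor) (use ib(1) in \<open>simp add: \<Phi>_def\<close>)
    have s3: "continuous_on (closed_segment (hline a n) (hline b n)) \<Phi>" by (rule side) (use n in auto)
    have s4: "continuous_on (closed_segment (hline a (-n)) (hline b (-n))) \<Phi>" by (rule side) (use n in auto)
    have "?c = contour_integral (rectpath (hline a (- n)) (hline b n)) \<Phi>"
      unfolding \<Phi>_def[abs_def] using c[OF n] by simp
    also have "\<dots> = contour_integral (linepath (hline a (-n)) (hline a n)) \<Phi> +
      (contour_integral (linepath (hline a n) (hline b n)) \<Phi> +
      (contour_integral (linepath (hline b n) (hline b (-n))) \<Phi> +
       contour_integral (linepath (hline b (-n)) (hline a (-n))) \<Phi>))"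
      unfolding rectpath_def Let_def hline_simps hc
      using s1 s2 s3 s4 by (subst contour_integral_join | simp add: contour_integrable_continuous_linepath closed_segment_commute
         contour_integrable_joinI valid_path_join)+
    also have "contour_integral (linepath (hline b n) (hline b (-n))) \<Phi> = - integral {-n..n} (\<lambda>s. \<Phi> (hline b s))"
      using contour_integral_hline[OF n0, of b \<Phi>] contour_integral_reverse_linepath[OF s2] by (metis minus_minus)
    also have "contour_integral (linepath (hline b (-n)) (hline a (-n))) \<Phi> = - contour_integral (linepath (hline a (-n)) (hline b (-n))) \<Phi>"
      using contour_integral_reverse_linepath[OF s4] by simp
    finally have eq: "?c = integral {-n..n} (\<lambda>s. \<Phi> (hline a s)) - integral {-n..n} (\<lambda>s. \<Phi> (hline b s))
       + contour_integral (linepath (hline a n) (hline b n)) \<Phi> - contour_integral (linepath (hline a (-n)) (hline b (-n))) \<Phi>"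
      using contour_integral_hline[OF n0, of a \<Phi>] by (simp add: algebra_simps)
    have "cmod (contour_integral (linepath (hline a (-n)) (hline b (-n))) \<Phi> - contour_integral (linepath (hline a n) (hline b n)) \<Phi>)
      \<le> 4 * M * lorentz (-n) + 4 * M * lorentz n"
      by (intro order_trans[OF norm_triangle_ineq4] add_mono side(2)) (use n in auto)
    also have "\<dots> = 8 * M * lorentz n" by (simp add: lorentz_def)
    finally show ?thesis unfolding eq by (simp add: algebra_simps)
  qed
  have "(\<lambda>n. integral {-real n..real n} (\<lambda>s. \<Phi> (hline a s)) - integral {-real n..real n} (\<lambda>s. \<Phi> (hline b s)) - ?c) \<longlonglongrightarrow> ?A - ?B - ?c"
    using integrable_lorentz_bound(2)[OF ia(1,2)] integrable_lorentz_bound(2)[OF ib(1,2)] unfolding \<Phi>_def by (intro tendsto_intros)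
  moreover have "(\<lambda>n. integral {-real n..real n} (\<lambda>s. \<Phi> (hline a s)) - integral {-real n..real n} (\<lambda>s. \<Phi> (hline b s)) - ?c) \<longlonglongrightarrow> 0"
  proof (rule Lim_null_comparison)
    show "(\<lambda>n. 8 * M * lorentz (real n)) \<longlonglongrightarrow> 0" using tendsto_mult_left[OF lorentz_tendsto_0, of "8 * M"] by simp
    obtain N :: nat where N: "\<bar>Re \<tau>\<bar> + 1 < real N" using reals_Archimedean2 by blast
    then show "\<forall>\<^sub>F n in sequentially. cmod (integral {-real n..real n} (\<lambda>s. \<Phi> (hline a s)) - integral {-real n..real n} (\<lambda>s. \<Phi> (hline b s)) - ?c) \<le> 8 * M * lorentz (real n)"
      unfolding eventually_sequentially by (intro exI[of _ N] allI impI main) simp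
  qed
  ultimately have "?A - ?B - ?c = 0" by (rule LIMSEQ_unique)
  then have "?A - ?B = ?c" by simp
  then show ?thesis unfolding line_integral_def \<Phi>_def[symmetric] diff_divide_distrib[symmetric] by simp
qed

text \<open>The poles \<tau> + 2 \<pi> i k all lie outside the strip between the two lines, so
  Cauchy's theorem applies with c = 0.\<close>

lemma line_integral_eq:
  assumes f: "f holomorphic_on (strip (-1) 1)" "\<And>\<sigma>. \<sigma> \<in> strip (-1) 1 \<Longrightarrow> cmod (f \<sigma>) \<le> M * decay (Re \<sigma>)"
    and \<tau>: "1/2 < Im \<tau>" "Im \<tau> < 2 * pi - 1/2"
  shows "line_integral (-1/2) f \<tau> = line_integral (1/2) f \<tau>"
proof -
  obtain d where d0: "0 < d" "d < pi/2" "d < Im \<tau> - 1/2" "d < 2 * pi - 1/2 - Im \<tau>"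
    using field_lbound_gt_zero[of "pi/2" "min (Im \<tau> - 1/2) (2 * pi - 1/2 - Im \<tau>)"] \<tau> by auto
  have d: "0 < d" "d \<le> pi/2" "d \<le> Im \<tau> - 1/2" "d \<le> 2 * pi - 1/2 - Im \<tau>"
    using d0 by auto
  have "line_integral (-1/2) f \<tau> - line_integral (1/2) f \<tau> = 0"
  proof (rule line_integral_jump_limit[OF holomorphic_on_imp_continuous_on[OF f(1)] f(2), where d = d])
    fix n assume n: "\<bar>Re \<tau>\<bar> + 1 < n"
    let ?S = "{\<sigma>. Im \<sigma> \<ge> -1/2} \<inter> {\<sigma>. Im \<sigma> \<le> 1/2}"
    have ne: "exp (\<sigma> - \<tau>) \<noteq> 1" if "\<sigma> \<in> ?S" for \<sigma>
      by (rule periodic_kernel_bound(1)[OF d(1,2)]) (use that d \<tau> in auto)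
    have "((\<lambda>\<sigma>. f \<sigma> * periodic_kernel (\<sigma> - \<tau>)) has_contour_integral 0) (rectpath (hline (-1/2) (- n)) (hline (1/2) n))"
    proof (rule Cauchy_theorem_convex_simple)
      show "convex ?S" by (intro convex_Int convex_halfspace_Im_ge convex_halfspace_Im_le)
      have h: "periodic_kernel holomorphic_on {w. exp w \<noteq> 1}" by (rule holomorphic_on_periodic_kernel) auto
      have "(periodic_kernel \<circ> (\<lambda>\<sigma>. \<sigma> - \<tau>)) holomorphic_on ?S"
        by (rule holomorphic_on_compose_gen[OF _ h]) (use ne in \<open>auto intro!: holomorphic_intros\<close>)
      then have "(\<lambda>\<sigma>. periodic_kernel (\<sigma> - \<tau>)) holomorphic_on ?S" by (simp add: o_def)
      moreover have "f holomorphic_on ?S" by (rule holomorphic_on_subset[OF f(1)]) (auto simp: strip_def)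
      ultimately show "(\<lambda>\<sigma>. f \<sigma> * periodic_kernel (\<sigma> - \<tau>)) holomorphic_on ?S" by (intro holomorphic_on_mult)
      show "path_image (rectpath (hline (-1/2) (- n)) (hline (1/2) n)) \<subseteq> ?S"
      proof -
        have "path_image (rectpath (hline (-1/2) (- n)) (hline (1/2) n)) \<subseteq> cbox (hline (-1/2) (- n)) (hline (1/2) n)"
          by (rule path_image_rectpath_subset_cbox) (use n in auto)
        then show ?thesis by (auto simp: in_cbox_complex_iff)
      qed
    qed auto
    then show "contour_integral (rectpath (hline (-1/2) (- n)) (hline (1/2) n)) (\<lambda>\<sigma>. f \<sigma> * periodic_kernel (\<sigma> - \<tau>)) = 2 * of_real pi * \<i> * 0"
      by (simp add: contour_integral_unique)
  qed (use d in auto)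
  then show ?thesis by simp
qed

text \<open>The function k is w / (exp w - 1) with its singularity at 0 removed. Splitting off 1 / w
  reduces the residue at the pole to Cauchy's integral formula.\<close>

lemma periodic_kernel_pole:
  obtains k where "k holomorphic_on {w. \<bar>Im w\<bar> < 2 * pi}" "k 0 = 1" "\<And>w. w \<noteq> 0 \<Longrightarrow> \<bar>Im w\<bar> < 2 * pi \<Longrightarrow> periodic_kernel w = k w / w"
proof
  define g where "g w = (if w = 0 then deriv exp 0 else (exp w - exp 0) / (w - 0))" for w :: complex
  have d: "deriv exp (0::complex) = 1" by (simp add: DERIV_imp_deriv[OF DERIV_exp])
  have hg: "g holomorphic_on UNIV" unfolding g_def[abs_def] by (rule pole_lemma) (auto intro: holomorphic_intros)
  have ne: "exp w \<noteq> 1" if w: "\<bar>Im w\<bar> < 2 * pi" "w \<noteq> 0" for w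
  proof
    assume "exp w = 1"
    then obtain n :: int where n: "Re w = 0" "Im w = real_of_int (2 * n) * pi" using exp_eq_1 by blast
    have "\<bar>real_of_int n\<bar> * (2 * pi) < 1 * (2 * pi)" using w(1) n by (simp add: abs_mult)
    then have "n = 0" by (simp only: mult_less_cancel_right_pos[of "2 * pi"] pi_gt_zero mult_pos_pos zero_less_numeral)
    then show False using n w(2) by (simp add: complex_eq_iff)
  qed
  have gne: "g w \<noteq> 0" if w: "\<bar>Im w\<bar> < 2 * pi" for w
    using ne[OF w] by (auto simp: g_def d)
  show "(\<lambda>w. 1 / g w) holomorphic_on {w. \<bar>Im w\<bar> < 2 * pi}"
    by (intro holomorphic_intros holomorphic_on_subset[OF hg]) (use gne in auto)
  show "1 / g 0 = 1" by (simp add: g_def d)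
  show "periodic_kernel w = 1 / g w / w" if "w \<noteq> 0" "\<bar>Im w\<bar> < 2 * pi" for w
    using that by (simp add: g_def periodic_kernel_def)
qed

text \<open>Exactly one pole, \<tau> itself, lies between the lines; it contributes f
  \<tau>.\<close>

lemma line_integral_jump:
  assumes f: "f holomorphic_on (strip (-1) 1)" "\<And>\<sigma>. \<sigma> \<in> strip (-1) 1 \<Longrightarrow> cmod (f \<sigma>) \<le> M * decay (Re \<sigma>)"
    and \<tau>: "-1/2 < Im \<tau>" "Im \<tau> < 1/2"
  shows "line_integral (-1/2) f \<tau> = line_integral (1/2) f \<tau> + f \<tau>"
proof -
  define d where "d = min (Im \<tau> + 1/2) (1/2 - Im \<tau>)"
  have d: "0 < d" "d \<le> pi/2" "d \<le> Im \<tau> + 1/2" "d \<le> 1/2 - Im \<tau>" "d \<le> 1" using \<tau> pi_gt3 by (auto simp: d_def min_def)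
  have "line_integral (-1/2) f \<tau> - line_integral (1/2) f \<tau> = f \<tau>"
  proof (rule line_integral_jump_limit[OF holomorphic_on_imp_continuous_on[OF f(1)] f(2), where d = d])
    fix n assume n: "\<bar>Re \<tau>\<bar> + 1 < n"
    let ?S = "{\<sigma>. Im \<sigma> \<ge> -1/2} \<inter> {\<sigma>. Im \<sigma> \<le> 1/2}"
    let ?\<gamma> = "rectpath (hline (-1/2) (- n)) (hline (1/2) n)"
    obtain k where k: "k holomorphic_on {w. \<bar>Im w\<bar> < 2 * pi}" "k 0 = 1" 
      "\<And>w. w \<noteq> 0 \<Longrightarrow> \<bar>Im w\<bar> < 2 * pi \<Longrightarrow> periodic_kernel w = k w / w" using periodic_kernel_pole by blast
    have box: "\<tau> \<in> box (hline (-1/2) (- n)) (hline (1/2) n)" using \<tau> n by (auto simp: in_box_complex_iff)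
    have sub: "path_image ?\<gamma> \<subseteq> ?S - {\<tau>}"
    proof -
      have "path_image ?\<gamma> = cbox (hline (-1/2) (- n)) (hline (1/2) n) - box (hline (-1/2) (- n)) (hline (1/2) n)"
        by (rule path_image_rectpath_cbox_minus_box) (use n in auto)
      moreover have "cbox (hline (-1/2) (- n)) (hline (1/2) n) \<subseteq> ?S" by (auto simp: in_cbox_complex_iff)
      ultimately show ?thesis using box by blast
    qed
    have small: "\<bar>Im (\<sigma> - \<tau>)\<bar> < 2 * pi" if "\<sigma> \<in> ?S" for \<sigma> using that \<tau> pi_gt3 by auto
    have "((\<lambda>\<sigma>. (f \<sigma> * k (\<sigma> - \<tau>)) / (\<sigma> - \<tau>)) has_contour_integral (2*pi * \<i> * winding_number ?\<gamma> \<tau> * (f \<tau> * k (\<tau> - \<tau>)))) ?\<gamma>"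
    proof (rule Cauchy_integral_formula_convex_simple[where S = ?S])
      show "convex ?S" by (intro convex_Int convex_halfspace_Im_ge convex_halfspace_Im_le)
      have "(k \<circ> (\<lambda>\<sigma>. \<sigma> - \<tau>)) holomorphic_on ?S"
        by (rule holomorphic_on_compose_gen[OF _ k(1)]) (use small in \<open>auto intro!: holomorphic_intros\<close>)
      moreover have "f holomorphic_on ?S" by (rule holomorphic_on_subset[OF f(1)]) (auto simp: strip_def)
      ultimately show "(\<lambda>\<sigma>. f \<sigma> * k (\<sigma> - \<tau>)) holomorphic_on ?S" by (auto simp: o_def intro: holomorphic_on_mult)
      have "strip (-1/2) (1/2) \<subseteq> interior ?S" by (rule interior_maximal[OF _ open_strip]) (auto simp: strip_def)
      then show "\<tau> \<in> interior ?S" using \<tau> by (auto simp: strip_def)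
    qed (use sub in auto)
    then have "((\<lambda>\<sigma>. (f \<sigma> * k (\<sigma> - \<tau>)) / (\<sigma> - \<tau>)) has_contour_integral (2 * of_real pi * \<i> * f \<tau>)) ?\<gamma>"
      using winding_number_rectpath[OF box] k(2) by simp
    then have "((\<lambda>\<sigma>. f \<sigma> * periodic_kernel (\<sigma> - \<tau>)) has_contour_integral (2 * of_real pi * \<i> * f \<tau>)) ?\<gamma>"
    proof (rule has_contour_integral_eq)
      fix \<sigma> assume "\<sigma> \<in> path_image ?\<gamma>"
      then have "\<sigma> \<in> ?S" "\<sigma> - \<tau> \<noteq> 0" using sub by auto
      then show "f \<sigma> * k (\<sigma> - \<tau>) / (\<sigma> - \<tau>) = f \<sigma> * periodic_kernel (\<sigma> - \<tau>)" using k(3)[of "\<sigma> - \<tau>"] small by simp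
    qed
    then show "contour_integral ?\<gamma> (\<lambda>\<sigma>. f \<sigma> * periodic_kernel (\<sigma> - \<tau>)) = 2 * of_real pi * \<i> * f \<tau>"
      by (rule contour_integral_unique)
  qed (use d \<tau> pi_gt3 in auto)
  then show ?thesis by (simp add: algebra_simps)
qed

subsection \<open>The Cousin problem on a strip\<close>

lemma line_integral_periodic: "line_integral \<eta> f (\<tau> + 2 * of_real pi * \<i>) = line_integral \<eta> f \<tau>"
proof -
  have "periodic_kernel (w - (\<tau> + 2 * of_real pi * \<i>)) = periodic_kernel (w - \<tau>)" for w
    unfolding periodic_kernel_def diff_add_eq_diff_diff_swap[symmetric] by (simp add: exp_diff exp_add exp_two_pi_i algebra_simps)
  then show ?thesis by (simp add: line_integral_def)
qed

text \<open>The continuation of minus the Cauchy integral over the line at -1/2 to the whole strip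
  where f lives. Below the real axis it is rewritten over the line at 1/2, the jump giving the term
  - f, so that the line used is always at least 1/2 away. The values lie where the nonlinear
  right-hand side is defined, so the operator can be iterated.\<close>

definition cousin :: "(complex \<Rightarrow> complex) \<Rightarrow> complex \<Rightarrow> complex" where
  "cousin f \<tau> = (if Im \<tau> < 0 then - line_integral (1/2) f \<tau> - f \<tau> else - line_integral (-1/2) f \<tau>)"

text \<open>The same function continued upwards over a full period. The line is exchanged at height
  \<pi>, where by \<open>line_integral_eq\<close> both give the same value; at the top the exchanged
  line produces the required jump.\<close>

definition cousin_ext :: "(complex \<Rightarrow> complex) \<Rightarrow> complex \<Rightarrow> complex" where
  "cousin_ext f \<tau> = (if Im \<tau> < pi then - line_integral (-1/2) f \<tau> else - line_integral (1/2) f \<tau>)"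

lemma half_lt: "\<bar>1/2 :: real\<bar> < 1" "\<bar>-1/2 :: real\<bar> < 1"
  by simp_all

lemma cousin_bound:
  assumes f: "continuous_on (strip (-1) 1) f" "\<And>\<sigma>. \<sigma> \<in> strip (-1) 1 \<Longrightarrow> cmod (f \<sigma>) \<le> M * decay (Re \<sigma>)"
    and \<tau>: "\<tau> \<in> strip (-1) 1" and M0: "0 \<le> M"
  shows "cmod (cousin f \<tau>) \<le> 4 * M"
proof -
  have t: "-1 < Im \<tau>" "Im \<tau> < 1" using \<tau> by (auto simp: strip_def)
  have m: "3 * M * min 1 (exp (Re \<tau>)) \<le> 3 * M" using M0 mult_left_mono[of "min 1 (exp (Re \<tau>))" 1 "3 * M"] by simp
  have fb: "cmod (f \<tau>) \<le> M"
    using f(2)[OF \<tau>] decay_le(1)[of "Re \<tau>"] lorentz_le_1[of "Re \<tau>"] M0 mult_left_mono[of "decay (Re \<tau>)" 1 M] by linarith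
  show ?thesis
  proof (cases "Im \<tau> < 0")
    case True
    have "cmod (line_integral (1/2) f \<tau>) \<le> 3 * M * min 1 (exp (Re \<tau>))"
      by (rule line_integral_bound[OF f half_lt(1) _ _ M0]) (use t True pi_gt3 in auto)
    then show ?thesis using True m fb norm_triangle_ineq4[of "- line_integral (1/2) f \<tau>" "f \<tau>"] by (simp add: cousin_def)
  next
    case False
    have "cmod (line_integral (-1/2) f \<tau>) \<le> 3 * M * min 1 (exp (Re \<tau>))"
      by (rule line_integral_bound[OF f half_lt(2) _ _ M0]) (use t False pi_gt3 in auto)
    then show ?thesis using False m M0 by (simp add: cousin_def)
  qed
qed

lemma cousin_diff:
  assumes f: "continuous_on (strip (-1) 1) f" "\<And>\<sigma>. \<sigma> \<in> strip (-1) 1 \<Longrightarrow> cmod (f \<sigma>) \<le> M * decay (Re \<sigma>)"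
    and g: "continuous_on (strip (-1) 1) g" "\<And>\<sigma>. \<sigma> \<in> strip (-1) 1 \<Longrightarrow> cmod (g \<sigma>) \<le> M * decay (Re \<sigma>)"
    and \<tau>: "\<tau> \<in> strip (-1) 1"
  shows "cousin (\<lambda>\<sigma>. f \<sigma> - g \<sigma>) \<tau> = cousin f \<tau> - cousin g \<tau>"
proof -
  have t: "-1 < Im \<tau>" "Im \<tau> < 1" using \<tau> by (auto simp: strip_def)
  have "line_integral (1/2) (\<lambda>\<sigma>. f \<sigma> - g \<sigma>) \<tau> = line_integral (1/2) f \<tau> - line_integral (1/2) g \<tau>" if "Im \<tau> < 0"
    by (rule line_integral_diff[OF f g half_lt(1)]) (use t that pi_gt3 in auto)
  moreover have "line_integral (-1/2) (\<lambda>\<sigma>. f \<sigma> - g \<sigma>) \<tau> = line_integral (-1/2) f \<tau> - line_integral (-1/2) g \<tau>" if "\<not> Im \<tau> < 0"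
    by (rule line_integral_diff[OF f g half_lt(2)]) (use t that pi_gt3 in auto)
  ultimately show ?thesis by (simp add: cousin_def)
qed

lemma ghol_slice:
  assumes "ghol (S \<times> B) f" "Y \<in> B"
  shows "(\<lambda>\<sigma>. f (\<sigma>, Y)) holomorphic_on S"
proof -
  have "(\<lambda>\<sigma>. f ((0, Y) + cscale \<sigma> (1, 0))) holomorphic_on S"
    by (rule ghol_line[OF assms(1)]) (use assms(2) in \<open>auto simp: cscale_def\<close>)
  then show ?thesis by (simp add: cscale_def)
qed

text \<open>Each of the two formulas is holomorphic slightly beyond the real axis, and
  \<open>line_integral_jump\<close> identifies them on the overlap.\<close>

lemma cousin_ghol:
  fixes f :: "complex \<times> (complex^'n) \<Rightarrow> complex"
  assumes f: "ghol (strip (-1) 1 \<times> B) f" and B: "open B" and M0: "0 \<le> M"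
    and b: "\<And>p. p \<in> strip (-1) 1 \<times> B \<Longrightarrow> cmod (f p) \<le> M * decay (Re (fst p))"
  shows "ghol (strip (-1) 1 \<times> B) (\<lambda>p. cousin (\<lambda>\<sigma>. f (\<sigma>, snd p)) (fst p))"
proof (rule ghol_local)
  fix p assume p: "p \<in> strip (-1) 1 \<times> B"
  let ?V1 = "strip (-1) (1/4) \<times> B" and ?V2 = "strip (-1/4) 1 \<times> B"
  have g1: "ghol ?V1 (\<lambda>p. - line_integral (1/2) (\<lambda>\<sigma>. f (\<sigma>, snd p)) (fst p) - f p)"
    by (intro ghol_diff ghol_uminus ghol_subset[OF line_integral_ghol[OF f B M0 b half_lt(1)]] ghol_subset[OF f])
      (use pi_gt3 in \<open>auto simp: strip_def\<close>)
  have g2: "ghol ?V2 (\<lambda>p. - line_integral (-1/2) (\<lambda>\<sigma>. f (\<sigma>, snd p)) (fst p))"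
    by (intro ghol_uminus ghol_subset[OF line_integral_ghol[OF f B M0 b half_lt(2)]])
      (use pi_gt3 in \<open>auto simp: strip_def\<close>)
  have jump: "line_integral (-1/2) (\<lambda>\<sigma>. f (\<sigma>, Y)) \<tau> = line_integral (1/2) (\<lambda>\<sigma>. f (\<sigma>, Y)) \<tau> + f (\<tau>, Y)"
    if "Y \<in> B" "-1/2 < Im \<tau>" "Im \<tau> < 1/2" for \<tau> Y
    by (rule line_integral_jump[where M = M, OF ghol_slice[OF f that(1)] _ that(2,3)]) (use b that(1) in auto)
  have e1: "cousin (\<lambda>\<sigma>. f (\<sigma>, snd q)) (fst q) = - line_integral (1/2) (\<lambda>\<sigma>. f (\<sigma>, snd q)) (fst q) - f q" if "q \<in> ?V1" for q
    using that jump[of "snd q" "fst q"] by (auto simp: cousin_def strip_def mem_Times_iff)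
  have e2: "cousin (\<lambda>\<sigma>. f (\<sigma>, snd q)) (fst q) = - line_integral (-1/2) (\<lambda>\<sigma>. f (\<sigma>, snd q)) (fst q)" if "q \<in> ?V2" for q
    using that jump[of "snd q" "fst q"] by (auto simp: cousin_def strip_def mem_Times_iff)
  have "p \<in> ?V1 \<or> p \<in> ?V2" using p by (auto simp: strip_def)
  moreover have "open ?V1" "open ?V2" using B by (auto intro: open_Times)
  moreover have "ghol ?V1 (\<lambda>p. cousin (\<lambda>\<sigma>. f (\<sigma>, snd p)) (fst p))" "ghol ?V2 (\<lambda>p. cousin (\<lambda>\<sigma>. f (\<sigma>, snd p)) (fst p))"
    using g1 g2 ghol_cong[of ?V1, OF e1] ghol_cong[of ?V2, OF e2] by simp_all
  ultimately show "\<exists>V. open V \<and> p \<in> V \<and> ghol V (\<lambda>p. cousin (\<lambda>\<sigma>. f (\<sigma>, snd p)) (fst p))" by blast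
qed

lemma cousin_ext_bound:
  assumes f: "continuous_on (strip (-1) 1) f" "\<And>\<sigma>. \<sigma> \<in> strip (-1) 1 \<Longrightarrow> cmod (f \<sigma>) \<le> M * decay (Re \<sigma>)"
    and \<tau>: "\<tau> \<in> strip (-1/4) (2 * pi + 1/4)" and M0: "0 \<le> M"
  shows "cmod (cousin_ext f \<tau>) \<le> 3 * M * min 1 (exp (Re \<tau>))"
proof -
  have t: "-1/4 < Im \<tau>" "Im \<tau> < 2 * pi + 1/4" using \<tau> by (auto simp: strip_def)
  have "cmod (line_integral (-1/2) f \<tau>) \<le> 3 * M * min 1 (exp (Re \<tau>))" if "Im \<tau> < pi"
    by (rule line_integral_bound[OF f half_lt(2) _ _ M0]) (use t that pi_gt3 in auto)
  moreover have "cmod (line_integral (1/2) f \<tau>) \<le> 3 * M * min 1 (exp (Re \<tau>))" if "\<not> Im \<tau> < pi"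
    by (rule line_integral_bound[OF f half_lt(1) _ _ M0]) (use t that pi_gt3 in auto)
  ultimately show ?thesis by (auto simp: cousin_ext_def)
qed

lemma cousin_ext_ghol:
  fixes f :: "complex \<times> (complex^'n) \<Rightarrow> complex"
  assumes f: "ghol (strip (-1) 1 \<times> B) f" and B: "open B" and M0: "0 \<le> M"
    and b: "\<And>p. p \<in> strip (-1) 1 \<times> B \<Longrightarrow> cmod (f p) \<le> M * decay (Re (fst p))"
  shows "ghol (strip (-1/4) (2 * pi + 1/4) \<times> B) (\<lambda>p. cousin_ext (\<lambda>\<sigma>. f (\<sigma>, snd p)) (fst p))"
proof (rule ghol_local)
  fix p assume p: "p \<in> strip (-1/4) (2 * pi + 1/4) \<times> B"
  let ?V1 = "strip (-1/4) (pi + 1) \<times> B" and ?V2 = "strip (pi - 1) (2 * pi + 1/4) \<times> B"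
  have g1: "ghol ?V1 (\<lambda>p. - line_integral (-1/2) (\<lambda>\<sigma>. f (\<sigma>, snd p)) (fst p))"
    by (intro ghol_uminus ghol_subset[OF line_integral_ghol[OF f B M0 b half_lt(2)]])
      (use pi_gt3 in \<open>auto simp: strip_def\<close>)
  have g2: "ghol ?V2 (\<lambda>p. - line_integral (1/2) (\<lambda>\<sigma>. f (\<sigma>, snd p)) (fst p))"
    by (intro ghol_uminus ghol_subset[OF line_integral_ghol[OF f B M0 b half_lt(1)]])
      (use pi_gt3 in \<open>auto simp: strip_def\<close>)
  have eq: "line_integral (-1/2) (\<lambda>\<sigma>. f (\<sigma>, Y)) \<tau> = line_integral (1/2) (\<lambda>\<sigma>. f (\<sigma>, Y)) \<tau>"
    if "Y \<in> B" "1/2 < Im \<tau>" "Im \<tau> < 2 * pi - 1/2" for \<tau> Y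
    by (rule line_integral_eq[where M = M, OF ghol_slice[OF f that(1)] _ that(2,3)]) (use b that(1) in auto)
  have e1: "cousin_ext (\<lambda>\<sigma>. f (\<sigma>, snd q)) (fst q) = - line_integral (-1/2) (\<lambda>\<sigma>. f (\<sigma>, snd q)) (fst q)" if "q \<in> ?V1" for q
    using that eq[of "snd q" "fst q"] pi_gt3 by (auto simp: cousin_ext_def strip_def mem_Times_iff)
  have e2: "cousin_ext (\<lambda>\<sigma>. f (\<sigma>, snd q)) (fst q) = - line_integral (1/2) (\<lambda>\<sigma>. f (\<sigma>, snd q)) (fst q)" if "q \<in> ?V2" for q
    using that eq[of "snd q" "fst q"] pi_gt3 by (auto simp: cousin_ext_def strip_def mem_Times_iff)
  have "p \<in> ?V1 \<or> p \<in> ?V2" using p by (auto simp: strip_def)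
  moreover have "open ?V1" "open ?V2" using B by (auto intro: open_Times)
  moreover have "ghol ?V1 (\<lambda>p. cousin_ext (\<lambda>\<sigma>. f (\<sigma>, snd p)) (fst p))" "ghol ?V2 (\<lambda>p. cousin_ext (\<lambda>\<sigma>. f (\<sigma>, snd p)) (fst p))"
    using g1 g2 ghol_cong[of ?V1, OF e1] ghol_cong[of ?V2, OF e2] by simp_all
  ultimately show "\<exists>V. open V \<and> p \<in> V \<and> ghol V (\<lambda>p. cousin_ext (\<lambda>\<sigma>. f (\<sigma>, snd p)) (fst p))" by blast
qed

text \<open>The additive Cousin problem is solved: one turn around x = 0 adds f.\<close>

lemma cousin_ext_cousin:
  assumes f: "f holomorphic_on (strip (-1) 1)" "\<And>\<sigma>. \<sigma> \<in> strip (-1) 1 \<Longrightarrow> cmod (f \<sigma>) \<le> M * decay (Re \<sigma>)"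
    and \<tau>: "\<bar>Im \<tau>\<bar> < 1/4"
  shows "cousin_ext f \<tau> = cousin f \<tau>" "cousin_ext f (\<tau> + 2 * of_real pi * \<i>) = cousin f \<tau> + f \<tau>"
proof -
  have j: "line_integral (-1/2) f \<tau> = line_integral (1/2) f \<tau> + f \<tau>" by (rule line_integral_jump[OF f]) (use \<tau> in auto)
  show "cousin_ext f \<tau> = cousin f \<tau>" using j \<tau> pi_gt3 by (auto simp: cousin_ext_def cousin_def)
  show "cousin_ext f (\<tau> + 2 * of_real pi * \<i>) = cousin f \<tau> + f \<tau>"
    unfolding cousin_ext_def line_integral_periodic using j \<tau> pi_gt3 by (auto simp: cousin_def)
qed

section \<open>Lipschitz estimates and the nonlinear equation\<close>

text \<open>Cauchy's inequality on a disc of radius \<rho> around each point of the segment,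
  followed by the mean value inequality.\<close>

lemma ghol_segment_bound:
  assumes f: "ghol U f" and \<rho>: "0 < \<rho>"
    and b: "\<And>t z. t \<in> closed_segment 0 1 \<Longrightarrow> z \<in> cball t \<rho> \<Longrightarrow> p + cscale z v \<in> U \<and> cmod (f (p + cscale z v)) \<le> M"
  shows "cmod (f (p + v) - f p) \<le> M / \<rho>"
proof -
  let ?g = "\<lambda>z. f (p + cscale z v)"
  have hol: "?g holomorphic_on ball t \<rho>" "continuous_on (cball t \<rho>) ?g" if "t \<in> closed_segment 0 1" for t
    using b[OF that] by (auto intro!: ghol_line[OF f] holomorphic_on_imp_continuous_on)
  have "cmod (?g 1 - ?g 0) \<le> (M / \<rho>) * cmod (1 - 0)"
  proof (rule field_differentiable_bound[where S = "closed_segment 0 1"])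
    fix t :: complex assume t: "t \<in> closed_segment 0 1"
    show "(?g has_field_derivative deriv ?g t) (at t within closed_segment 0 1)"
      using holomorphic_derivI[OF hol(1)[OF t], of t] \<rho> by (auto intro: has_field_derivative_at_within)
    have "norm ((deriv ^^ 1) ?g t) \<le> fact 1 * M / \<rho> ^ 1"
    proof (rule Cauchy_inequality[OF hol[OF t] \<rho>])
      show "cmod (?g x) \<le> M" if "norm (t - x) = \<rho>" for x using b[OF t, of x] that by (simp add: dist_norm)
    qed
    then show "cmod (deriv ?g t) \<le> M / \<rho>" by simp
  qed auto
  then show ?thesis by simp
qed

lemma ghol_Lipschitz_snd:
  fixes u u' :: "complex^'n"
  assumes f: "ghol (S \<times> ball 0 s) f" and \<tau>: "\<tau> \<in> S" and d: "0 < d" "r + d \<le> s"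
    and u: "norm u < r" "norm u' < r" and b: "\<And>v. norm v < s \<Longrightarrow> cmod (f (\<tau>, v)) \<le> M"
  shows "cmod (f (\<tau>, u) - f (\<tau>, u')) \<le> M / d * norm (u - u')"
proof (cases "u = u'")
  case False
  \<comment> \<open>A disc of this radius in the line parameter moves the point by at most d, which
    keeps it within the room between the radii r and s.\<close>
  define \<rho> where "\<rho> = d / norm (u - u')"
  have \<rho>: "0 < \<rho>" "\<rho> * norm (u - u') = d" using False d by (auto simp: \<rho>_def)
  have "cmod (f ((\<tau>, u') + (0, u - u')) - f (\<tau>, u')) \<le> M / \<rho>"
  proof (rule ghol_segment_bound[OF f \<rho>(1)])
    fix t z :: complex assume t: "t \<in> closed_segment 0 1" "z \<in> cball t \<rho>"
    obtain a where a: "t = of_real a" "0 \<le> a" "a \<le> 1"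
      using t(1) by (auto simp: closed_segment_def scaleR_conv_of_real)
    have "u' + t *s (u - u') = (1 - a) *\<^sub>R u' + a *\<^sub>R u"
      unfolding a(1) by (simp add: vec_eq_iff scaleR_conv_of_real[where 'a = complex] algebra_simps)
    then have "u' + t *s (u - u') \<in> closed_segment u' u" using a by (auto simp: closed_segment_def)
    moreover have "closed_segment u' u \<subseteq> ball 0 r" by (rule closed_segment_subset) (use u in auto)
    ultimately have n: "norm (u' + t *s (u - u')) < r" by auto
    have "u' + z *s (u - u') = (u' + t *s (u - u')) + (z - t) *s (u - u')"
      by (simp add: vec_eq_iff algebra_simps)
    then have "norm (u' + z *s (u - u')) \<le> norm (u' + t *s (u - u')) + cmod (z - t) * norm (u - u')"
      by (metis norm_triangle_ineq norm_vector_smult)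
    moreover have "cmod (z - t) * norm (u - u') \<le> \<rho> * norm (u - u')"
      using t(2) by (intro mult_right_mono) (auto simp: dist_norm norm_minus_commute)
    ultimately have "norm (u' + z *s (u - u')) < s" using n \<rho>(2) d by linarith
    then show "(\<tau>, u') + cscale z (0, u - u') \<in> S \<times> ball 0 s \<and> cmod (f ((\<tau>, u') + cscale z (0, u - u'))) \<le> M"
      using \<tau> b by (simp add: cscale_def)
  qed
  then show ?thesis by (simp add: \<rho>_def mult_ac)
qed simp

text \<open>The unknown enters the right-hand side only through pointwise composition, so the iteration
  loses no domain in the parameter Y.\<close>

lemma nonlinear_cousin:
  fixes R :: "complex \<Rightarrow> complex^'n \<Rightarrow> complex^'n"
  assumes R: "\<And>i. ghol (strip (-1) 1 \<times> ball 0 2) (\<lambda>p. R (fst p) (snd p) $ i)"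
    and b: "\<And>\<tau> v i. \<tau> \<in> strip (-1) 1 \<Longrightarrow> norm v < 2 \<Longrightarrow> cmod (R \<tau> v $ i) \<le> \<epsilon> * decay (Re \<tau>)"
    and R0: "\<And>\<tau>. \<tau> \<in> strip (-1) 1 \<Longrightarrow> R \<tau> 0 = 0"
    and \<epsilon>: "0 \<le> \<epsilon>" "real CARD('n) * \<epsilon> \<le> 1/100"
  obtains w :: "complex \<Rightarrow> complex^'n \<Rightarrow> complex^'n" where
    "\<And>i. ghol (strip (-1/4) (2 * pi + 1/4) \<times> ball 0 1) (\<lambda>p. w (fst p) (snd p) $ i)"
    "\<And>\<tau> Y i. \<tau> \<in> strip (-1/4) (2 * pi + 1/4) \<Longrightarrow> norm Y < 1 \<Longrightarrow> cmod (w \<tau> Y $ i) \<le> 3 * \<epsilon> * min 1 (exp (Re \<tau>))"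
    "\<And>\<tau>. \<tau> \<in> strip (-1/4) (2 * pi + 1/4) \<Longrightarrow> w \<tau> 0 = 0"
    "\<And>\<tau> Y. \<bar>Im \<tau>\<bar> < 1/4 \<Longrightarrow> norm Y < 1 \<Longrightarrow> norm (Y + w \<tau> Y) < 2 \<and>
       w (\<tau> + 2 * of_real pi * \<i>) Y = w \<tau> Y + R \<tau> (Y + w \<tau> Y)"
proof -
  let ?S = "strip (-1) 1" and ?B = "ball 0 1 :: (complex^'n) set"
  let ?N = "real CARD('n)"
  have N1: "1 \<le> ?N" by simp
  have oU: "open (?S \<times> ?B)" and oV: "open (?S \<times> (ball 0 2 :: (complex^'n) set))" by (auto intro!: open_Times)
  \<comment> \<open>The equation is solved as a fixed point of T on the short strip. Only the fixed
    point is afterwards continued over the full period.\<close>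
  define T where "T f = (\<lambda>\<tau> Y. \<chi> i. cousin (\<lambda>\<sigma>. R \<sigma> (Y + f \<sigma> Y) $ i) \<tau>)" for f :: "complex \<Rightarrow> complex^'n \<Rightarrow> complex^'n"
  define good where "good f \<longleftrightarrow> (\<forall>i. ghol (?S \<times> ?B) (\<lambda>p. f (fst p) (snd p) $ i)) \<and>
      (\<forall>\<tau>\<in>?S. \<forall>Y\<in>?B. \<forall>i. cmod (f \<tau> Y $ i) \<le> 4 * \<epsilon>)" for f :: "complex \<Rightarrow> complex^'n \<Rightarrow> complex^'n"
  \<comment> \<open>The bound is 1 + 4/100 at most. Staying below 3/2 leaves the room 1/2 up to the
    radius 2, which makes R Lipschitz with constant 2 \<epsilon> in \<open>Rlip\<close>.\<close>
  have small: "norm (Y + f \<tau> Y) < 3/2" if "good f" "\<tau> \<in> ?S" "Y \<in> ?B" for f \<tau> Y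
  proof -
    have "norm (f \<tau> Y) \<le> ?N * (4 * \<epsilon>)" using that by (intro norm_vec_le_card) (auto simp: good_def)
    then have "norm (f \<tau> Y) \<le> 1/25" using \<epsilon>(2) by linarith
    then show ?thesis using that(3) norm_triangle_ineq[of Y "f \<tau> Y"] by simp
  qed
  have RY: "ghol (?S \<times> ?B) (\<lambda>p. R (fst p) (snd p + f (fst p) (snd p)) $ i)" if g: "good f" for f i
  proof -
    have "ghol (?S \<times> ?B) (\<lambda>p. (\<lambda>q. R (fst q) (snd q) $ i) (fst p, snd p + f (fst p) (snd p)))"
    proof (rule ghol_compose_ghol[OF oU ghol_fst _ oV R])
      show "ghol (?S \<times> ?B) (\<lambda>p. (snd p + f (fst p) (snd p)) $ i)" for i
        using g by (auto simp: good_def intro!: ghol_add ghol_snd)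
      show "(fst p, snd p + f (fst p) (snd p)) \<in> ?S \<times> ball 0 2" if "p \<in> ?S \<times> ?B" for p
        using small[OF g, of "fst p" "snd p"] that by (auto simp: mem_Times_iff)
    qed
    then show ?thesis by simp
  qed
  have RYb: "cmod (R \<tau> (Y + f \<tau> Y) $ i) \<le> \<epsilon> * decay (Re \<tau>)" if "good f" "\<tau> \<in> ?S" "Y \<in> ?B" for f \<tau> Y i
    using small[OF that] by (intro b that) simp
  have RYs: "(\<lambda>\<sigma>. R \<sigma> (Y + f \<sigma> Y) $ i) holomorphic_on ?S" if "good f" "Y \<in> ?B" for f Y i
    using ghol_slice[OF RY[OF that(1), of i] that(2)] by simp
  note RYc = holomorphic_on_imp_continuous_on[OF RYs]
  have Tg: "good (T f)" if g: "good f" for f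
    unfolding good_def
  proof (intro conjI allI ballI)
    have "ghol (?S \<times> ?B) (\<lambda>p. cousin (\<lambda>\<sigma>. (\<lambda>q. R (fst q) (snd q + f (fst q) (snd q)) $ i) (\<sigma>, snd p)) (fst p))" for i
      by (rule cousin_ghol[OF RY[OF g] _ \<epsilon>(1)]) (use RYb[OF g] in auto)
    then show "ghol (?S \<times> ?B) (\<lambda>p. T f (fst p) (snd p) $ i)" for i by (simp add: T_def)
    show "cmod (T f \<tau> Y $ i) \<le> 4 * \<epsilon>" if "\<tau> \<in> ?S" "Y \<in> ?B" for \<tau> Y i
      unfolding T_def vec_lambda_beta using that
      by (intro cousin_bound[OF RYc[OF g] RYb[OF g]] \<epsilon>) auto
  qed
  have Rlip: "cmod (R \<tau> u $ i - R \<tau> u' $ i) \<le> (2 * \<epsilon> * norm (u - u')) * decay (Re \<tau>)"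
    if "\<tau> \<in> ?S" "norm u < 3/2" "norm u' < 3/2" for \<tau> u u' i
  proof -
    have "cmod ((\<lambda>q. R (fst q) (snd q) $ i) (\<tau>, u) - (\<lambda>q. R (fst q) (snd q) $ i) (\<tau>, u')) \<le> (\<epsilon> * decay (Re \<tau>)) / (1/2) * norm (u - u')"
      by (rule ghol_Lipschitz_snd[OF R that(1) _ _ that(2,3)]) (use b[OF that(1)] in auto)
    then show ?thesis by (simp add: mult_ac)
  qed
  have Tlip: "cmod (T f \<tau> Y $ i - T g \<tau> Y $ i) \<le> 8 * \<epsilon> * ?N * \<delta>"
    if fg: "good f" "good g" "\<tau> \<in> ?S" "Y \<in> ?B" "0 \<le> \<delta>" "\<And>\<sigma> j. \<sigma> \<in> ?S \<Longrightarrow> cmod (f \<sigma> Y $ j - g \<sigma> Y $ j) \<le> \<delta>" for f g \<tau> Y i \<delta>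
  proof -
    have d: "cmod (R \<sigma> (Y + f \<sigma> Y) $ i - R \<sigma> (Y + g \<sigma> Y) $ i) \<le> (2 * \<epsilon> * (?N * \<delta>)) * decay (Re \<sigma>)" if s: "\<sigma> \<in> ?S" for \<sigma>
    proof -
      have "norm (f \<sigma> Y - g \<sigma> Y) \<le> ?N * \<delta>" using fg(6) s by (intro norm_vec_le_card) auto
      then have "2 * \<epsilon> * norm (f \<sigma> Y - g \<sigma> Y) * decay (Re \<sigma>) \<le> 2 * \<epsilon> * (?N * \<delta>) * decay (Re \<sigma>)"
        using \<epsilon>(1) decay_le(3)[of "Re \<sigma>"] by (intro mult_right_mono mult_left_mono) auto
      moreover have "cmod (R \<sigma> (Y + f \<sigma> Y) $ i - R \<sigma> (Y + g \<sigma> Y) $ i) \<le> (2 * \<epsilon> * norm ((Y + f \<sigma> Y) - (Y + g \<sigma> Y))) * decay (Re \<sigma>)"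
        by (rule Rlip[OF s small small]) (use fg s in auto)
      ultimately show ?thesis by simp
    qed
    have "T f \<tau> Y $ i - T g \<tau> Y $ i = cousin (\<lambda>\<sigma>. R \<sigma> (Y + f \<sigma> Y) $ i - R \<sigma> (Y + g \<sigma> Y) $ i) \<tau>"
      unfolding T_def vec_lambda_beta
      by (rule cousin_diff[OF RYc[OF fg(1,4)] RYb[OF fg(1) _ fg(4)] RYc[OF fg(2,4)] RYb[OF fg(2) _ fg(4)] fg(3), symmetric]) auto
    also have "cmod \<dots> \<le> 4 * (2 * \<epsilon> * (?N * \<delta>))"
      by (rule cousin_bound[OF _ d fg(3)]) (use fg \<epsilon>(1) in \<open>auto intro!: continuous_on_diff RYc\<close>)
    finally show ?thesis by simp
  qed
  define v where "v n = (T ^^ n) (\<lambda>_ _. 0)" for n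
  have v0: "v 0 = (\<lambda>_ _. 0)" and vS: "v (Suc n) = T (v n)" for n by (simp_all add: v_def)
  have vg: "good (v n)" for n
  proof (induction n)
    case 0 show ?case unfolding v0 using \<epsilon> by (auto simp: good_def)
  qed (simp add: vS Tg)
  \<comment> \<open>T contracts by 8 n \<epsilon> with n the dimension, which is at most 8/100; the
    rate 1/2 is a coarse rounding.\<close>
  have step: "cmod (v (Suc n) \<tau> Y $ i - v n \<tau> Y $ i) \<le> 4 * \<epsilon> * (1/2)^n" if "\<tau> \<in> ?S" "Y \<in> ?B" for n \<tau> Y i
    using that(1)
  proof (induction n arbitrary: \<tau> i)
    case 0
    then show ?case using vg[of "Suc 0"] that(2) unfolding good_def v0 by auto
  next
    case (Suc n)
    have "cmod (v (Suc (Suc n)) \<tau> Y $ i - v (Suc n) \<tau> Y $ i) \<le> 8 * \<epsilon> * ?N * (4 * \<epsilon> * (1/2)^n)"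
      unfolding vS[of "Suc n"] vS[of n]
      by (rule Tlip[OF Tg[OF vg] vg Suc(2) that(2)]) (use Suc(1) \<epsilon>(1) in \<open>auto simp: vS\<close>)
    also have "8 * \<epsilon> * ?N = 8 * (?N * \<epsilon>)" by simp
    also have "8 * (?N * \<epsilon>) * (4 * \<epsilon> * (1/2)^n) \<le> (1/2) * (4 * \<epsilon> * (1/2)^n)"
      using \<epsilon> by (intro mult_right_mono) (linarith | simp)+
    finally show ?case by simp
  qed
  define L where "L i p = (\<Sum>k. v (Suc k) (fst p) (snd p) $ i - v k (fst p) (snd p) $ i)" for i and p :: "complex \<times> (complex^'n)"
  have ul: "uniform_limit (?S \<times> ?B) (\<lambda>n p. v n (fst p) (snd p) $ i) (L i) sequentially" for i
  proof -
    have "uniform_limit (?S \<times> ?B) (\<lambda>n p. \<Sum>k<n. v (Suc k) (fst p) (snd p) $ i - v k (fst p) (snd p) $ i) (L i) sequentially"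
      unfolding L_def
    proof (rule Weierstrass_m_test)
      show "summable (\<lambda>n. 4 * \<epsilon> * (1/2)^n)" by (intro summable_mult summable_geometric) simp
      show "norm (v (Suc n) (fst p) (snd p) $ i - v n (fst p) (snd p) $ i) \<le> 4 * \<epsilon> * (1/2)^n" if "p \<in> ?S \<times> ?B" for n p
        using that by (intro step) (auto simp: mem_Times_iff)
    qed
    moreover have "(\<Sum>k<n. v (Suc k) \<tau> Y $ i - v k \<tau> Y $ i) = v n \<tau> Y $ i" for n \<tau> Y
      by (subst sum_lessThan_telescope) (simp add: v0)
    ultimately show ?thesis by simp
  qed
  define vi where "vi \<tau> Y = (\<chi> i. L i (\<tau>, Y))" for \<tau> Y
  have lim: "(\<lambda>n. v n \<tau> Y $ i) \<longlonglongrightarrow> vi \<tau> Y $ i" if "\<tau> \<in> ?S" "Y \<in> ?B" for \<tau> Y i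
    using tendsto_uniform_limitI[OF ul[of i], of "(\<tau>, Y)"] that by (simp add: vi_def)
  have vig: "good vi"
    unfolding good_def
  proof (intro conjI allI ballI)
    show "ghol (?S \<times> ?B) (\<lambda>p. vi (fst p) (snd p) $ i)" for i
      using ghol_uniform_limit[OF oU _ ul[of i]] vg by (simp add: vi_def good_def)
    show "cmod (vi \<tau> Y $ i) \<le> 4 * \<epsilon>" if "\<tau> \<in> ?S" "Y \<in> ?B" for \<tau> Y i
      using vg that by (intro LIMSEQ_le_const2[OF tendsto_norm[OF lim[OF that]]]) (auto simp: good_def)
  qed
  have tail: "cmod (vi \<tau> Y $ i - v n \<tau> Y $ i) \<le> 8 * \<epsilon> * (1/2)^n" if "\<tau> \<in> ?S" "Y \<in> ?B" for n \<tau> Y i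
  proof (rule LIMSEQ_le_const2[OF tendsto_norm[OF tendsto_diff[OF lim[OF that] tendsto_const]]], intro exI allI impI)
    fix m assume "n \<le> m"
    then have "cmod (v m \<tau> Y $ i - v n \<tau> Y $ i) \<le> 8 * \<epsilon> * ((1/2)^n - (1/2)^m)"
    proof (induction m rule: dec_induct)
      case (step m)
      have "cmod (v (Suc m) \<tau> Y $ i - v n \<tau> Y $ i) \<le> cmod (v (Suc m) \<tau> Y $ i - v m \<tau> Y $ i) + cmod (v m \<tau> Y $ i - v n \<tau> Y $ i)"
        using norm_triangle_ineq[of "v (Suc m) \<tau> Y $ i - v m \<tau> Y $ i" "v m \<tau> Y $ i - v n \<tau> Y $ i"] by simp
      also have "\<dots> \<le> 4 * \<epsilon> * (1/2)^m + 8 * \<epsilon> * ((1/2)^n - (1/2)^m)"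
        using step.IH \<open>\<And>n \<tau> Y i. \<tau> \<in> ?S \<Longrightarrow> Y \<in> ?B \<Longrightarrow> cmod (v (Suc n) \<tau> Y $ i - v n \<tau> Y $ i) \<le> 4 * \<epsilon> * (1/2)^n\<close>[OF that] by (intro add_mono) auto
      finally show ?case by (simp add: algebra_simps)
    qed simp
    also have "\<dots> \<le> 8 * \<epsilon> * (1/2)^n" using \<epsilon> by (intro mult_left_mono) auto
    finally show "cmod (v m \<tau> Y $ i - v n \<tau> Y $ i) \<le> 8 * \<epsilon> * (1/2)^n" .
  qed
  have fix_eq: "vi \<tau> Y $ i = T vi \<tau> Y $ i" if "\<tau> \<in> ?S" "Y \<in> ?B" for \<tau> Y i
  proof -
    have "(\<lambda>n. T (v n) \<tau> Y $ i - T vi \<tau> Y $ i) \<longlonglongrightarrow> 0"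
    proof (rule Lim_null_comparison)
      show "(\<lambda>n. 8 * \<epsilon> * ?N * (8 * \<epsilon> * (1/2)^n)) \<longlonglongrightarrow> 0"
        by (rule tendsto_eq_intros LIMSEQ_power_zero | simp)+
      show "\<forall>\<^sub>F n in sequentially. cmod (T (v n) \<tau> Y $ i - T vi \<tau> Y $ i) \<le> 8 * \<epsilon> * ?N * (8 * \<epsilon> * (1/2)^n)"
        by (rule always_eventually, intro allI Tlip[OF vg vig that])
          (use tail[OF _ that(2)] \<epsilon>(1) in \<open>auto simp: norm_minus_commute\<close>)
    qed
    then have "(\<lambda>n. v (Suc n) \<tau> Y $ i) \<longlonglongrightarrow> T vi \<tau> Y $ i"
      unfolding vS using tendsto_add[OF _ tendsto_const[of "T vi \<tau> Y $ i"]] by fastforce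
    moreover have "(\<lambda>n. v (Suc n) \<tau> Y $ i) \<longlonglongrightarrow> vi \<tau> Y $ i"
      by (rule LIMSEQ_Suc[OF lim[OF that]])
    ultimately show ?thesis by (rule LIMSEQ_unique[symmetric])
  qed
  have ops_0: "cousin_ext (\<lambda>_. 0) \<tau> = 0" "cousin (\<lambda>_. 0) \<tau> = 0" for \<tau> by (simp_all add: cousin_ext_def cousin_def line_integral_def)
  \<comment> \<open>The Cauchy lines lie inside the strip, so the default 0 outside never enters an
    integral. It makes the integrand at Y = 0 the zero function, from which w \<tau> 0 = 0 follows
    at once.\<close>
  define w where "w \<tau> Y = (\<chi> i. cousin_ext (\<lambda>\<sigma>. if \<sigma> \<in> ?S then R \<sigma> (Y + vi \<sigma> Y) $ i else 0) \<tau>)" for \<tau> Y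
  define F where "F i q = (if fst q \<in> ?S then R (fst q) (snd q + vi (fst q) (snd q)) $ i else 0)" for i q
  have wF: "w \<tau> Y $ i = cousin_ext (\<lambda>\<sigma>. F i (\<sigma>, Y)) \<tau>" for \<tau> Y i
    by (simp only: w_def F_def fst_conv snd_conv vec_lambda_beta)
  have FR: "F i (\<sigma>, Y) = R \<sigma> (Y + vi \<sigma> Y) $ i" if "\<sigma> \<in> ?S" for i \<sigma> Y
    using that unfolding F_def fst_conv snd_conv by (rule if_P)
  have Fg: "ghol (?S \<times> ?B) (F i)" for i
    using RY[OF vig, of i] by (subst ghol_cong[where g = "\<lambda>p. R (fst p) (snd p + vi (fst p) (snd p)) $ i"]) (auto simp: F_def)
  have Fb: "cmod (F i p) \<le> \<epsilon> * decay (Re (fst p))" if "p \<in> ?S \<times> ?B" for i p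
    using RYb[OF vig] that by (auto simp: F_def)
  have Fs: "(\<lambda>\<sigma>. F i (\<sigma>, Y)) holomorphic_on ?S" "\<And>\<sigma>. \<sigma> \<in> ?S \<Longrightarrow> cmod (F i (\<sigma>, Y)) \<le> \<epsilon> * decay (Re \<sigma>)" if "Y \<in> ?B" for Y i
    using ghol_slice[OF Fg that] Fb that by auto
  have sopF: "cousin (\<lambda>\<sigma>. F i (\<sigma>, Y)) \<tau> = vi \<tau> Y $ i" if "\<tau> \<in> ?S" "Y \<in> ?B" for \<tau> Y i
  proof -
    have "line_integral \<eta> (\<lambda>\<sigma>. F i (\<sigma>, Y)) \<tau> = line_integral \<eta> (\<lambda>\<sigma>. R \<sigma> (Y + vi \<sigma> Y) $ i) \<tau>" if "\<bar>\<eta>\<bar> < 1" for \<eta>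
    proof -
      have "hline \<eta> s \<in> ?S" for s using that by (auto simp: strip_def)
      then show ?thesis unfolding line_integral_def using FR by simp
    qed
    then show ?thesis using fix_eq[OF that] that FR by (simp add: T_def cousin_def)
  qed
  have vi0: "vi \<tau> 0 = 0" if "\<tau> \<in> ?S" for \<tau>
  proof -
    have "v n \<tau> 0 = 0" if "\<tau> \<in> ?S" for n \<tau>
      using that
    proof (induction n arbitrary: \<tau>)
      case (Suc n)
      have "cousin (\<lambda>\<sigma>. R \<sigma> (0 + v n \<sigma> 0) $ i) \<tau> = cousin (\<lambda>_. 0) \<tau>" for i
      proof -
        have "R \<sigma> (0 + v n \<sigma> 0) $ i = 0" if "\<sigma> \<in> ?S" for \<sigma> using Suc(1)[OF that] R0[OF that] by simp
        then show ?thesis using Suc(2) unfolding cousin_def line_integral_def by (simp add: strip_def)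
      qed
      then show ?case by (simp add: vS T_def vec_eq_iff ops_0)
    qed (simp add: v0)
    then have "vi \<tau> 0 $ i = 0" for i using lim[OF that, of 0 i] that by (simp add: LIMSEQ_const_iff)
    then show ?thesis by (simp add: vec_eq_iff)
  qed
  show thesis
  proof (rule that[of w])
    show "ghol (strip (-1/4) (2 * pi + 1/4) \<times> ?B) (\<lambda>p. w (fst p) (snd p) $ i)" for i
      unfolding wF by (rule cousin_ext_ghol[OF Fg _ \<epsilon>(1)]) (use Fb in auto)
    show "cmod (w \<tau> Y $ i) \<le> 3 * \<epsilon> * min 1 (exp (Re \<tau>))" if "\<tau> \<in> strip (-1/4) (2 * pi + 1/4)" "norm Y < 1" for \<tau> Y i
      unfolding wF by (rule cousin_ext_bound[OF holomorphic_on_imp_continuous_on[OF Fs(1)] Fs(2) that(1) \<epsilon>(1)]) (use that in auto)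
    show "w \<tau> 0 = 0" if "\<tau> \<in> strip (-1/4) (2 * pi + 1/4)" for \<tau>
    proof -
      have "F i (\<sigma>, 0) = 0" for i \<sigma>
        using FR[of \<sigma> i 0] vi0[of \<sigma>] R0[of \<sigma>] by (cases "\<sigma> \<in> ?S") (simp_all, simp add: F_def)
      then have "(\<lambda>\<sigma>. F i (\<sigma>, 0)) = (\<lambda>_. 0)" for i by (simp add: fun_eq_iff)
      then show ?thesis by (simp add: vec_eq_iff wF ops_0)
    qed
    fix \<tau> Y assume \<tau>: "\<bar>Im \<tau>\<bar> < 1/4" and Y: "norm (Y :: complex^'n) < 1"
    have S: "\<tau> \<in> ?S" and YB: "Y \<in> ?B" using \<tau> Y by (auto simp: strip_def)
    note e = cousin_ext_cousin[OF Fs[OF YB] \<tau>]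
    have w1: "w \<tau> Y = vi \<tau> Y" using e(1) sopF[OF S YB] by (simp add: vec_eq_iff wF)
    have "w (\<tau> + 2 * of_real pi * \<i>) Y = vi \<tau> Y + R \<tau> (Y + vi \<tau> Y)"
      using e(2) sopF[OF S YB] FR[OF S] by (simp add: vec_eq_iff wF)
    then show "norm (Y + w \<tau> Y) < 2 \<and> w (\<tau> + 2 * of_real pi * \<i>) Y = w \<tau> Y + R \<tau> (Y + w \<tau> Y)"
      using w1 small[OF vig S YB] by simp
  qed
qed

subsection \<open>The frame and the size of the perturbation\<close>

lemma holo_vec_imp_ghol:
  assumes "holo_vec U g" "open U"
  shows "ghol (UNIV \<times> U) (\<lambda>p. g (snd p) $ i)"
  by (rule ghol_compose_holo_vec[OF _ _ assms(1)]) (auto intro: open_Times ghol_snd assms(2))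

text \<open>\<open>ddir_Taylor\<close> at the origin, with a dummy first coordinate. The bound M is
  taken on the compact ball of radius \<rho>/2, and the Taylor estimate then covers vectors of half
  that length.\<close>

lemma holo_vec_quadratic_remainder:
  fixes g :: "complex^'n \<Rightarrow> complex^'m"
  assumes g: "holo_vec (ball 0 \<rho>) g" "0 < \<rho>" "g 0 = 0" "(g has_derivative (\<lambda>v. T *v v)) (at 0)"
  obtains C where "0 < C" "\<And>y i. norm y < \<rho> / 4 \<Longrightarrow> cmod (g y $ i - (T *v y) $ i) \<le> C * (norm y)\<^sup>2"
proof -
  let ?f = "\<lambda>i p. g (snd (p :: complex \<times> (complex^'n))) $ i"
  let ?U = "UNIV \<times> ball 0 \<rho> :: (complex \<times> (complex^'n)) set"
  have U: "open ?U" by (auto intro: open_Times)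
  have f: "ghol ?U (?f i)" for i using holo_vec_imp_ghol[OF g(1)] by simp
  have sub: "cball 0 (\<rho> / 2) \<subseteq> ?U"
  proof
    fix p :: "complex \<times> (complex^'n)" assume "p \<in> cball 0 (\<rho>/2)"
    then have "norm (snd p) \<le> \<rho>/2" using norm_snd_le[of "snd p" "fst p"] by simp
    then show "p \<in> ?U" using g(2) by (simp add: mem_Times_iff)
  qed
  have "\<exists>M. \<forall>p\<in>cball 0 (\<rho> / 2). cmod (?f i p) \<le> M" for i
  proof -
    have "compact (?f i ` cball 0 (\<rho> / 2))"
      by (intro compact_continuous_image continuous_on_subset[OF ghol_continuous[OF f] sub] compact_cball)
    from compact_imp_bounded[OF this] show ?thesis unfolding bounded_iff by blast
  qed
  then obtain M where M: "\<And>i p. p \<in> cball 0 (\<rho> / 2) \<Longrightarrow> cmod (?f i p) \<le> M i" by metis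
  have M0: "0 \<le> M i" for i using M[of 0 i] g(2,3) by simp
  define C where "C = 8 * (\<Sum>i\<in>UNIV. M i) / (\<rho> / 2)\<^sup>2 + 1"
  have C0: "0 < C" unfolding C_def using M0 by (intro add_nonneg_pos divide_nonneg_nonneg mult_nonneg_nonneg sum_nonneg) auto
  have "cmod (g y $ i - (T *v y) $ i) \<le> C * (norm y)\<^sup>2" if y: "norm y < \<rho> / 4" for y i
  proof -
    have pU: "(0::complex \<times> (complex^'n)) \<in> ?U" using g(2) by (simp add: zero_prod_def)
    have "((\<lambda>p. g (snd p)) has_derivative (\<lambda>v. T *v snd v)) (at (0 :: complex \<times> (complex^'n)))"
      by (rule has_derivative_compose[where f = snd]) (use g(4) in \<open>auto intro!: derivative_eq_intros\<close>)
    then have "(?f i has_derivative (\<lambda>v. (T *v snd v) $ i)) (at 0)"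
      using bounded_linear.has_derivative[OF bounded_linear_vec_nth] by blast
    then have dd: "ddir (?f i) 0 = (\<lambda>v. (T *v snd v) $ i)"
      using ghol_has_derivative[OF U f pU, of i] has_derivative_unique by blast
    have "cmod (?f i (0 + (0, y)) - ?f i 0 - ddir (?f i) 0 (0, y)) \<le> 8 * M i / (\<rho> / 2)\<^sup>2 * (norm (0 :: complex, y))\<^sup>2"
      by (rule ddir_Taylor[OF f[of i]]) (use sub M[of _ i] y in auto)
    then have "cmod (g y $ i - (T *v y) $ i) \<le> 8 * M i / (\<rho> / 2)\<^sup>2 * (norm y)\<^sup>2"
      by (simp add: dd g(3) norm_Pair)
    also have "\<dots> \<le> C * (norm y)\<^sup>2"
    proof (rule mult_right_mono)
      have "M i \<le> (\<Sum>i\<in>UNIV. M i)" using M0 by (intro member_le_sum) auto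
      then have "8 * M i / (\<rho> / 2)\<^sup>2 \<le> 8 * (\<Sum>i\<in>UNIV. M i) / (\<rho> / 2)\<^sup>2" by (intro divide_right_mono) auto
      then show "8 * M i / (\<rho> / 2)\<^sup>2 \<le> C" by (simp add: C_def)
    qed auto
    finally show ?thesis .
  qed
  with C0 that show thesis by blast
qed

text \<open>The exponent 5/2 is what the frame estimate leaves over: 4 from the damping minus at
  most 3 times 1/2. Here exp (- 2 |s|) is already enough, one factor paying for min 1 (exp s), the
  other for the Lorentz factor.\<close>

lemma decay_lower: "exp (- (5/2 * \<bar>s\<bar>)) \<le> 2 * decay s"
proof -
  let ?t = "\<bar>s\<bar>"
  have "1 + ?t + ?t\<^sup>2 / 2 \<le> exp ?t" by (rule exp_lower_Taylor_quadratic) simp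
  then have a: "1 + s\<^sup>2 \<le> 2 * exp ?t" by simp
  have p: "0 < 1 + s\<^sup>2" by (simp add: add_pos_nonneg)
  have "exp (- (5/2 * ?t)) \<le> exp (- ?t - ?t)" by simp
  also have "\<dots> = exp (- ?t) * (1 / exp ?t)" by (simp only: exp_diff) simp
  also have "1 / exp ?t \<le> 2 / (1 + s\<^sup>2)" using a p by (simp add: field_simps)
  also have "exp (- ?t) * (2 / (1 + s\<^sup>2)) \<le> min 1 (exp s) * (2 / (1 + s\<^sup>2))"
    using p by (intro mult_right_mono) auto
  also have "\<dots> = 2 * decay s" by (simp add: decay_def lorentz_def inverse_eq_divide)
  finally show ?thesis by simp
qed

section \<open>The damped frame\<close>

text \<open>The function \<mu> x exp (- x) of x = exp \<tau>. The factor x is small at the left end,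
  exp (- x) at the right end near the real axis, and \<mu> adjusts the overall size.\<close>

definition damping :: "real \<Rightarrow> complex \<Rightarrow> complex" where
  "damping \<mu> \<tau> = of_real \<mu> * exp \<tau> * exp (- exp \<tau>)"

text \<open>Since 1 < \<pi>/3, the real part of exp \<tau> is at least half its modulus z, and the
  quadratic lower bound of exp (z/2) gives z^2 \<le> 8 exp (z/2).\<close>

lemma damping_bound:
  assumes "0 < \<mu>" "\<bar>Im \<tau>\<bar> < 1"
  shows "0 < cmod (damping \<mu> \<tau>)" "cmod (damping \<mu> \<tau>) \<le> 8 * \<mu> * exp (- \<bar>Re \<tau>\<bar>)"
proof -
  let ?s = "Re \<tau>"
  have eq: "cmod (damping \<mu> \<tau>) = \<mu> * exp (?s - exp ?s * cos (Im \<tau>))"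
    using assms(1) unfolding damping_def norm_mult norm_exp_eq_Re by (simp add: Re_exp flip: exp_add)
  show "0 < cmod (damping \<mu> \<tau>)" using assms by (simp add: eq)
  have "cos (pi/3) \<le> cos \<bar>Im \<tau>\<bar>" using assms pi_gt3 by (intro cos_monotone_0_pi_le) auto
  then have c: "1/2 \<le> cos (Im \<tau>)" by (simp add: cos_60)
  have "exp (?s - exp ?s * cos (Im \<tau>)) \<le> 8 * exp (- \<bar>?s\<bar>)"
  proof (cases "?s \<le> 0")
    case True
    have "exp (?s - exp ?s * cos (Im \<tau>)) \<le> exp ?s" using c by simp
    also have "\<dots> \<le> 8 * exp ?s" by simp
    finally show ?thesis using True by simp
  next
    case False
    define z where "z = exp ?s"
    have z: "0 < z" by (simp add: z_def)
    have "1 + z/2 + (z/2)\<^sup>2/2 \<le> exp (z/2)" by (rule exp_lower_Taylor_quadratic) (use z in simp)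
    then have "z\<^sup>2 \<le> 8 * exp (z/2)" using z by (simp add: power_divide)
    then have "z * z \<le> 8 * exp (z/2)" by (simp add: power2_eq_square)
    then have "z / exp (z/2) \<le> 8 / z" using z by (simp add: field_simps)
    moreover have "exp (?s - z/2) = z / exp (z/2)" by (simp only: exp_diff z_def)
    moreover have "8 / z = 8 * exp (- ?s)" by (simp only: exp_minus z_def divide_inverse)
    ultimately have "exp (?s - z/2) \<le> 8 * exp (- ?s)" by linarith
    moreover have "exp (?s - exp ?s * cos (Im \<tau>)) \<le> exp (?s - z/2)"
      using mult_left_mono[OF c, of z] z by (simp add: z_def)
    ultimately have "exp (?s - exp ?s * cos (Im \<tau>)) \<le> 8 * exp (- ?s)" by linarith
    then show ?thesis using False by (simp only: abs_of_pos not_le)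
  qed
  then show "cmod (damping \<mu> \<tau>) \<le> 8 * \<mu> * exp (- \<bar>?s\<bar>)"
    using assms(1) mult_left_mono[of _ _ \<mu>] unfolding eq by (simp add: mult_ac)
qed

definition monomial_frame :: "nat \<Rightarrow> complex \<Rightarrow> real \<Rightarrow> complex \<Rightarrow> complex" where
  "monomial_frame k \<beta> \<mu> \<tau> = damping \<mu> \<tau> ^ k * exp (\<beta> * \<tau>)"

lemma monomial_frame_nonzero: "0 < \<mu> \<Longrightarrow> monomial_frame k \<beta> \<mu> \<tau> \<noteq> 0"
  by (simp add: monomial_frame_def damping_def)

text \<open>On the strip the non-periodic factor exp (\<beta> \<tau>) differs from modulus 1 by at
  most exp (\<kappa> + |Re \<tau>| / 2) in either direction. Both directions are stated because
  quotients of frame entries have to be estimated.\<close>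

lemma monomial_frame_bound:
  assumes "0 < \<mu>" "\<bar>Im \<tau>\<bar> < 1" "\<bar>Re \<beta>\<bar> \<le> 1/2" "\<bar>Im \<beta>\<bar> \<le> \<kappa>"
  shows "cmod (monomial_frame k \<beta> \<mu> \<tau>) \<le> cmod (damping \<mu> \<tau>) ^ k * (exp \<kappa> * exp (\<bar>Re \<tau>\<bar> / 2))"
    "cmod (damping \<mu> \<tau>) ^ k \<le> cmod (monomial_frame k \<beta> \<mu> \<tau>) * (exp \<kappa> * exp (\<bar>Re \<tau>\<bar> / 2))"
proof -
  have "\<bar>Re \<beta> * Re \<tau>\<bar> \<le> 1/2 * \<bar>Re \<tau>\<bar>" unfolding abs_mult using assms by (intro mult_right_mono) auto
  moreover have "\<bar>Im \<beta> * Im \<tau>\<bar> \<le> \<kappa> * 1" unfolding abs_mult using assms by (intro mult_mono) auto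
  ultimately have r: "\<bar>Re (\<beta> * \<tau>)\<bar> \<le> \<kappa> + \<bar>Re \<tau>\<bar> / 2" by simp
  have "exp (Re (\<beta> * \<tau>)) \<le> exp (\<kappa> + \<bar>Re \<tau>\<bar> / 2)" using r by simp
  then show "cmod (monomial_frame k \<beta> \<mu> \<tau>) \<le> cmod (damping \<mu> \<tau>) ^ k * (exp \<kappa> * exp (\<bar>Re \<tau>\<bar> / 2))"
    unfolding monomial_frame_def norm_mult norm_power norm_exp_eq_Re exp_add[symmetric] by (intro mult_left_mono) auto
  have "1 \<le> exp (Re (\<beta> * \<tau>) + (\<kappa> + \<bar>Re \<tau>\<bar> / 2))" using r by simp
  then have "cmod (damping \<mu> \<tau>) ^ k * 1 \<le> cmod (damping \<mu> \<tau>) ^ k * exp (Re (\<beta> * \<tau>) + (\<kappa> + \<bar>Re \<tau>\<bar> / 2))"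
    by (intro mult_left_mono) auto
  then show "cmod (damping \<mu> \<tau>) ^ k \<le> cmod (monomial_frame k \<beta> \<mu> \<tau>) * (exp \<kappa> * exp (\<bar>Re \<tau>\<bar> / 2))"
    unfolding monomial_frame_def norm_mult norm_power norm_exp_eq_Re by (simp add: exp_add mult_ac)
qed

text \<open>The weights are chosen so that every monomial occurring in the difference between g and its
  diagonal linear part raises the weight by at least 4.\<close>

definition weight :: "('n::finite \<Rightarrow> nat) \<Rightarrow> 'n \<Rightarrow> nat" where "weight \<nu> i = 4 * (CARD('n) + \<nu> i)"

text \<open>The principal logarithm keeps |Re \<beta>| \<le> 1/2, so that each frame entry costs at
  most exp (|Re \<tau>| / 2).\<close>

definition bexp :: "complex^'n^'n \<Rightarrow> 'n \<Rightarrow> complex" where "bexp T i = Ln (T $ i $ i) / (2 * of_real pi * \<i>)"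

definition frame :: "('n \<Rightarrow> nat) \<Rightarrow> complex^'n^'n \<Rightarrow> real \<Rightarrow> complex \<Rightarrow> 'n \<Rightarrow> complex" where
  "frame \<nu> T \<mu> \<tau> i = monomial_frame (weight \<nu> i) (bexp T i) \<mu> \<tau>"

lemma bexp_Re: "T $ i $ i \<noteq> 0 \<Longrightarrow> \<bar>Re (bexp T i)\<bar> \<le> 1/2"
  and bexp_exp: "T $ i $ i \<noteq> 0 \<Longrightarrow> exp (bexp T i * (2 * of_real pi * \<i>)) = T $ i $ i"
proof -
  assume T: "T $ i $ i \<noteq> 0"
  have "Re (bexp T i) = Im (Ln (T $ i $ i)) / (2 * pi)"
    by (simp add: bexp_def Re_divide power2_eq_square)
  moreover have "\<bar>Im (Ln (T $ i $ i))\<bar> \<le> pi"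
    using mpi_less_Im_Ln[OF T] Im_Ln_le_pi[OF T] by linarith
  ultimately have "\<bar>Re (bexp T i)\<bar> \<le> pi / (2 * pi)" by (simp only: abs_divide) (simp add: divide_right_mono)
  then show "\<bar>Re (bexp T i)\<bar> \<le> 1/2" by simp
  show "exp (bexp T i * (2 * of_real pi * \<i>)) = T $ i $ i"
    using T by (simp add: bexp_def)
qed

text \<open>After division by \<open>T_ii E_i\<close> the diagonal term becomes v_i. An off-diagonal
  linear term survives only for j with \<open>\<nu> j > \<nu> i\<close> and gains at least four
  damping factors; the remainder of order two gains them through the common offset in
  \<open>weight\<close>. Four damping factors are worth t exp (- 4 s), of which up to three factors
  q = exp (s/2) are lost.\<close>

lemma small_perturbation:
  fixes g :: "complex^'n \<Rightarrow> complex^'n" and T :: "complex^'n^'n"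
  assumes g: "holo_vec (ball 0 \<rho>) g" "0 < \<rho>" "g 0 = 0" "(g has_derivative (\<lambda>v. T *v v)) (at 0)"
    and tri: "\<And>i j. \<nu> j < \<nu> i \<Longrightarrow> T $ i $ j = 0" and inj: "inj \<nu>" and lt: "\<And>i. \<nu> i < CARD('n)"
    and diag: "\<And>i. T $ i $ i \<noteq> 0" and \<epsilon>: "0 < \<epsilon>"
  obtains \<mu> where "0 < \<mu>"
    "\<And>\<tau> v. \<tau> \<in> strip (-1) 1 \<Longrightarrow> norm v < 2 \<Longrightarrow> norm (\<chi> j. frame \<nu> T \<mu> \<tau> j * v $ j) < \<rho>"
    "\<And>\<tau> v i. \<tau> \<in> strip (-1) 1 \<Longrightarrow> norm v < 2 \<Longrightarrow>
      cmod (g (\<chi> j. frame \<nu> T \<mu> \<tau> j * v $ j) $ i / (T $ i $ i * frame \<nu> T \<mu> \<tau> i) - v $ i) \<le> \<epsilon> * decay (Re \<tau>)"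
proof -
  let ?n = "real CARD('n)"
  obtain C where C: "0 < C" "\<And>y i. norm y < \<rho> / 4 \<Longrightarrow> cmod (g y $ i - (T *v y) $ i) \<le> C * (norm y)\<^sup>2"
    by (rule holo_vec_quadratic_remainder[OF g]) blast
  define \<kappa> where "\<kappa> = (\<Sum>i\<in>UNIV. \<bar>Im (bexp T i)\<bar>)"
  have \<kappa>: "\<bar>Im (bexp T i)\<bar> \<le> \<kappa>" for i unfolding \<kappa>_def by (rule member_le_sum) auto
  have \<kappa>0: "0 \<le> \<kappa>" unfolding \<kappa>_def by (intro sum_nonneg) auto
  define K where "K = exp \<kappa>"
  have K: "1 \<le> K" using \<kappa>0 by (simp add: K_def)
  define D where "D = (\<Sum>i\<in>UNIV. 1 / cmod (T $ i $ i))"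
  have D: "1 / cmod (T $ i $ i) \<le> D" for i unfolding D_def by (rule member_le_sum) auto
  have D0: "0 \<le> D" unfolding D_def by (intro sum_nonneg) auto
  define B where "B = (\<Sum>i\<in>UNIV. \<Sum>j\<in>UNIV. cmod (T $ i $ j))"
  have B: "cmod (T $ i $ j) \<le> B" for i j
  proof -
    have "cmod (T $ i $ j) \<le> (\<Sum>j\<in>UNIV. cmod (T $ i $ j))" by (rule member_le_sum) auto
    also have "\<dots> \<le> B" unfolding B_def by (rule member_le_sum) (auto intro: sum_nonneg)
    finally show ?thesis .
  qed
  have B0: "0 \<le> B" using order_trans[OF norm_ge_zero B] .
  \<comment> \<open>The first summand collects the constants of the off-diagonal linear terms, the
    second those of the quadratic remainder.\<close>
  define A where "A = ?n * (B * D * K\<^sup>2 * 2) + C * D * (?n * 2)\<^sup>2 * K ^ 3"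
  have A0: "0 \<le> A" unfolding A_def using B0 D0 K C by (intro add_nonneg_nonneg mult_nonneg_nonneg) auto
  obtain t where t: "0 < t" "t < 1" "t < \<rho> / 4 / (?n * 2 * K)" "t < \<epsilon> / (2 * (A + 1))"
  proof -
    have "0 < min 1 (\<rho> / 4 / (?n * 2 * K))" "0 < \<epsilon> / (2 * (A + 1))" using g(2) K \<epsilon> A0 by auto
    from field_lbound_gt_zero[OF this] that show thesis by auto
  qed
  \<comment> \<open>Cancels the constant 8 of \<open>damping_bound\<close>.\<close>
  define \<mu> where "\<mu> = t / 8"
  have \<mu>: "0 < \<mu>" using t by (simp add: \<mu>_def)
  have main: "norm (\<chi> j. frame \<nu> T \<mu> \<tau> j * v $ j) < \<rho> / 4 \<and>
      (\<forall>i. cmod (g (\<chi> j. frame \<nu> T \<mu> \<tau> j * v $ j) $ i / (T $ i $ i * frame \<nu> T \<mu> \<tau> i) - v $ i) \<le> \<epsilon> * decay (Re \<tau>))"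
    if \<tau>: "\<tau> \<in> strip (-1) 1" and v: "norm v < 2" for \<tau> v
  proof -
    let ?E = "frame \<nu> T \<mu> \<tau>"
    let ?y = "\<chi> j. ?E j * v $ j"
    define p where "p = cmod (damping \<mu> \<tau>)"
    define s where "s = \<bar>Re \<tau>\<bar>"
    define q where "q = exp (s / 2)"
    have im: "\<bar>Im \<tau>\<bar> < 1" using \<tau> by (auto simp: strip_def)
    have s0: "0 \<le> s" by (simp add: s_def)
    have q1: "1 \<le> q" using s0 by (simp add: q_def)
    have p0: "0 < p" and pt: "p \<le> t * exp (- s)"
      using damping_bound[OF \<mu> im] by (simp_all add: p_def s_def \<mu>_def)
    have es: "exp (- s) \<le> 1" using s0 by simp
    have "t * exp (- s) \<le> 1 * 1" using t es by (intro mult_mono) auto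
    then have p1: "p \<le> 1" using pt by linarith
    have p4: "p ^ k \<le> t * exp (- 4 * s)" if "4 \<le> k" for k
    proof -
      have "p ^ k \<le> p ^ 4" using that p0 p1 by (intro power_decreasing) auto
      also have "\<dots> \<le> (t * exp (- s)) ^ 4" using pt p0 by (intro power_mono) auto
      also have "\<dots> = t ^ 4 * exp (- 4 * s)" by (simp add: power_mult_distrib flip: exp_of_nat_mult)
      also have "\<dots> \<le> t ^ 1 * exp (- 4 * s)" using t by (intro mult_right_mono power_decreasing) auto
      finally show ?thesis by simp
    qed
    have E1: "cmod (?E j) \<le> p ^ weight \<nu> j * (K * q)" and E2: "p ^ weight \<nu> j \<le> cmod (?E j) * (K * q)" for j
      using monomial_frame_bound[OF \<mu> im bexp_Re[OF diag] \<kappa>] unfolding frame_def p_def K_def q_def s_def by auto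
    have E0: "0 < cmod (?E j)" for j using monomial_frame_nonzero[OF \<mu>] by (simp add: frame_def)
    have vj: "cmod (v $ j) \<le> 2" for j using v Finite_Cartesian_Product.norm_nth_le[of v j] by linarith
    have n4: "4 \<le> 4 * CARD('n)" by (simp add: Suc_leI)
    have Ej: "cmod (?E j) \<le> p ^ (4 * CARD('n)) * (K * q)" for j
    proof -
      have "p ^ weight \<nu> j \<le> p ^ (4 * CARD('n))" using p0 p1 by (intro power_decreasing) (auto simp: weight_def)
      then have "p ^ weight \<nu> j * (K * q) \<le> p ^ (4 * CARD('n)) * (K * q)" using K q1 by (intro mult_right_mono) auto
      then show ?thesis using E1[of j] by linarith
    qed
    have ny: "norm ?y \<le> ?n * 2 * (p ^ (4 * CARD('n)) * (K * q))"
    proof -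
      have "cmod (?y $ j) \<le> (p ^ (4 * CARD('n)) * (K * q)) * 2" for j
        unfolding vec_lambda_beta norm_mult using Ej[of j] vj[of j] by (intro mult_mono) (auto intro: order_trans[OF norm_ge_zero])
      then have "norm ?y \<le> ?n * ((p ^ (4 * CARD('n)) * (K * q)) * 2)" by (rule norm_vec_le_card)
      then show ?thesis by (simp add: mult_ac)
    qed
    have q4: "exp (- 4 * s) * q ^ 3 = exp (- (5/2 * s))" "exp (- 4 * s) * q \<le> 1" "exp (- 4 * s) * q\<^sup>2 \<le> exp (- (5/2 * s))"
      using s0 unfolding q_def by (simp_all flip: exp_of_nat_mult exp_add)
    have "norm ?y < \<rho> / 4"
    proof -
      have "p ^ (4 * CARD('n)) * (K * q) \<le> (t * exp (- 4 * s)) * (K * q)" using p4[OF n4] K q1 by (intro mult_right_mono) auto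
      also have "\<dots> = (t * K) * (exp (- 4 * s) * q)" by simp
      also have "\<dots> \<le> (t * K) * 1" using q4(2) t K by (intro mult_left_mono) auto
      finally have "?n * 2 * (p ^ (4 * CARD('n)) * (K * q)) \<le> ?n * 2 * (t * K * 1)" by (intro mult_left_mono) auto
      with ny have "norm ?y \<le> ?n * 2 * (t * K * 1)" by (rule order_trans)
      then have "norm ?y \<le> ?n * 2 * (t * K)" by (simp only: mult_1_right)
      also have "\<dots> < \<rho> / 4"
      proof -
        have "0 < ?n * 2 * K" using K by simp
        then have "t * (?n * 2 * K) < \<rho> / 4" using t(3) pos_less_divide_eq by blast
        then show ?thesis by (simp add: mult_ac)
      qed
      finally show ?thesis .
    qed
    moreover have "cmod (g ?y $ i / (T $ i $ i * ?E i) - v $ i) \<le> \<epsilon> * decay (Re \<tau>)" for i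
    proof -
      have Ti: "T $ i $ i \<noteq> 0" by (rule diag)
      have E0': "?E i \<noteq> 0" using E0[of i] by auto
      let ?c = "T $ i $ i * ?E i"
      have c: "1 / cmod ?c \<le> D * (1 / cmod (?E i))"
      proof -
        have "1 / cmod ?c = (1 / cmod (T $ i $ i)) * (1 / cmod (?E i))" by (simp add: norm_mult)
        also have "\<dots> \<le> D * (1 / cmod (?E i))" using D[of i] by (intro mult_right_mono) auto
        finally show ?thesis .
      qed
      have lin: "(T *v ?y) $ i / ?c - v $ i = (\<Sum>j\<in>UNIV - {i}. T $ i $ j * ?E j * v $ j / ?c)"
      proof -
        have "(T *v ?y) $ i / ?c = (\<Sum>j\<in>UNIV. T $ i $ j * ?E j * v $ j / ?c)"
          by (simp add: matrix_vector_mult_def sum_divide_distrib mult.assoc)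
        also have "\<dots> = T $ i $ i * ?E i * v $ i / ?c + (\<Sum>j\<in>UNIV - {i}. T $ i $ j * ?E j * v $ j / ?c)"
          by (rule sum.remove) auto
        finally show ?thesis using Ti E0' by simp
      qed
      have l1: "cmod (T $ i $ j * ?E j * v $ j / ?c) \<le> B * D * K\<^sup>2 * 2 * (t * exp (- (5/2 * s)))" if "j \<noteq> i" for j
      proof (cases "\<nu> j < \<nu> i")
        case True
        then show ?thesis using tri[OF True] B0 D0 t K by simp
      next
        case False
        then have "\<nu> i < \<nu> j" using that inj by (metis injD nat_neq_iff)
        then have "weight \<nu> i + 4 \<le> weight \<nu> j" by (simp add: weight_def)
        then obtain k where k: "weight \<nu> j = weight \<nu> i + k" "4 \<le> k"
          by (metis le_iff_add add.assoc le_add1)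
        have "cmod (?E j) * (1 / cmod (?E i)) \<le> p ^ k * (K * q)\<^sup>2"
        proof -
          have "cmod (?E j) \<le> p ^ k * p ^ weight \<nu> i * (K * q)" using E1[of j] by (simp add: k(1) power_add mult_ac)
          also have "\<dots> \<le> p ^ k * (cmod (?E i) * (K * q)) * (K * q)"
            using E2[of i] p0 K q1 by (intro mult_right_mono mult_left_mono) auto
          finally show ?thesis using E0[of i] by (simp add: divide_le_eq power2_eq_square mult_ac)
        qed
        also have "\<dots> \<le> (t * exp (- 4 * s)) * (K * q)\<^sup>2" using p4[OF k(2)] by (intro mult_right_mono) auto
        also have "\<dots> = t * K\<^sup>2 * (exp (- 4 * s) * q\<^sup>2)" by (simp add: power_mult_distrib)
        also have "\<dots> \<le> t * K\<^sup>2 * exp (- (5/2 * s))" using q4(3) t by (intro mult_left_mono) auto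
        finally have Er: "cmod (?E j) * (1 / cmod (?E i)) \<le> t * K\<^sup>2 * exp (- (5/2 * s))" .
        have "cmod (T $ i $ j * ?E j * v $ j / ?c) = cmod (T $ i $ j) * cmod (?E j) * cmod (v $ j) * (1 / cmod ?c)"
          by (simp add: norm_mult norm_divide)
        also have "\<dots> \<le> B * cmod (?E j) * 2 * (D * (1 / cmod (?E i)))"
          using B vj c B0 by (intro mult_mono) auto
        also have "\<dots> = B * 2 * D * (cmod (?E j) * (1 / cmod (?E i)))" by simp
        also have "\<dots> \<le> B * 2 * D * (t * K\<^sup>2 * exp (- (5/2 * s)))"
          using Er B0 D0 by (intro mult_left_mono) auto
        finally show ?thesis by (simp add: mult_ac)
      qed
      have l2: "cmod ((T *v ?y) $ i / ?c - v $ i) \<le> ?n * (B * D * K\<^sup>2 * 2 * (t * exp (- (5/2 * s))))"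
      proof -
        have "cmod (\<Sum>j\<in>UNIV - {i}. T $ i $ j * ?E j * v $ j / ?c) \<le> real (card (UNIV - {i} :: 'n set)) * (B * D * K\<^sup>2 * 2 * (t * exp (- (5/2 * s))))"
          using l1 by (intro sum_norm_bound) auto
        also have "\<dots> \<le> ?n * (B * D * K\<^sup>2 * 2 * (t * exp (- (5/2 * s))))"
          using B0 D0 t K by (intro mult_right_mono) (auto simp: card_mono)
        finally show ?thesis unfolding lin .
      qed
      have quad: "cmod ((g ?y $ i - (T *v ?y) $ i) / ?c) \<le> C * D * (?n * 2)\<^sup>2 * K ^ 3 * (t * exp (- (5/2 * s)))"
      proof -
        define m where "m = p ^ (4 * CARD('n)) * (K * q)"
        \<comment> \<open>From \<open>\<nu> i\<close> at most n - 1 the weight is at most 8 n - 4,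
          while a square of two frame entries has weight at least 8 n.\<close>
        have "weight \<nu> i + 4 \<le> 8 * CARD('n)" using lt[of i] by (simp add: weight_def)
        then obtain k where k: "8 * CARD('n) = weight \<nu> i + k" "4 \<le> k"
          by (metis le_iff_add add.assoc le_add1)
        have "m\<^sup>2 = p ^ k * p ^ weight \<nu> i * (K * q)\<^sup>2"
          using k(1) by (simp add: m_def power_mult_distrib flip: power_mult power_add) (simp add: mult.commute add.commute)
        also have "\<dots> \<le> p ^ k * (cmod (?E i) * (K * q)) * (K * q)\<^sup>2"
          using E2[of i] p0 by (intro mult_right_mono mult_left_mono) auto
        finally have "m\<^sup>2 * (1 / cmod (?E i)) \<le> p ^ k * (K * q) ^ 3"
          using E0[of i] by (simp add: divide_le_eq power2_eq_square power3_eq_cube mult_ac)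
        also have "\<dots> \<le> (t * exp (- 4 * s)) * (K * q) ^ 3" using p4[OF k(2)] K q1 by (intro mult_right_mono) auto
        also have "\<dots> = t * K ^ 3 * exp (- (5/2 * s))" using q4(1) by (simp add: power_mult_distrib mult_ac)
        finally have m: "m\<^sup>2 * (1 / cmod (?E i)) \<le> t * K ^ 3 * exp (- (5/2 * s))" .
        have "cmod ((g ?y $ i - (T *v ?y) $ i) / ?c) = cmod (g ?y $ i - (T *v ?y) $ i) * (1 / cmod ?c)"
          by (simp add: norm_divide)
        also have "\<dots> \<le> (C * (norm ?y)\<^sup>2) * (D * (1 / cmod (?E i)))"
          using C(2)[OF \<open>norm ?y < \<rho> / 4\<close>] C(1) c by (intro mult_mono) auto
        also have "\<dots> \<le> (C * (?n * 2 * m)\<^sup>2) * (D * (1 / cmod (?E i)))"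
          using ny C(1) D0 unfolding m_def by (intro mult_right_mono mult_left_mono power_mono) auto
        also have "\<dots> = C * D * (?n * 2)\<^sup>2 * (m\<^sup>2 * (1 / cmod (?E i)))" by (simp add: power_mult_distrib)
        also have "\<dots> \<le> C * D * (?n * 2)\<^sup>2 * (t * K ^ 3 * exp (- (5/2 * s)))"
          using m C(1) D0 by (intro mult_left_mono) auto
        finally show ?thesis by (simp add: mult_ac)
      qed
      have dec_eq: "g ?y $ i / ?c - v $ i = ((T *v ?y) $ i / ?c - v $ i) + (g ?y $ i - (T *v ?y) $ i) / ?c"
        by (simp add: diff_divide_distrib)
      have "cmod (g ?y $ i / ?c - v $ i) \<le> ?n * (B * D * K\<^sup>2 * 2 * (t * exp (- (5/2 * s)))) + C * D * (?n * 2)\<^sup>2 * K ^ 3 * (t * exp (- (5/2 * s)))"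
        unfolding dec_eq by (rule norm_triangle_mono[OF l2 quad])
      also have "\<dots> = A * t * exp (- (5/2 * s))" by (simp add: A_def algebra_simps)
      also have "\<dots> \<le> A * t * (2 * decay (Re \<tau>))"
        using decay_lower[of "Re \<tau>"] A0 t unfolding s_def by (intro mult_left_mono) auto
      also have "\<dots> = (2 * A * t) * decay (Re \<tau>)" by simp
      also have "\<dots> \<le> \<epsilon> * decay (Re \<tau>)"
      proof (rule mult_right_mono)
        have "0 < 2 * (A + 1)" using A0 by simp
        then have "t * (2 * (A + 1)) < \<epsilon>" using t(4) pos_less_divide_eq by blast
        moreover have "2 * A * t \<le> t * (2 * (A + 1))" using t by (simp add: algebra_simps)
        ultimately show "2 * A * t \<le> \<epsilon>" by linarith
      qed (use decay_le(3) less_imp_le in blast)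
      finally show ?thesis .
    qed
    ultimately show ?thesis by blast
  qed
  show thesis
  proof (rule that[OF \<mu>])
    show "norm (\<chi> j. frame \<nu> T \<mu> \<tau> j * v $ j) < \<rho>" if "\<tau> \<in> strip (-1) 1" "norm v < 2" for \<tau> v
      using main[OF that] g(2) by linarith
  qed (use main in blast)
qed

lemma damping_deriv: "(damping \<mu> has_field_derivative damping \<mu> \<tau> * (1 - exp \<tau>)) (at \<tau>)"
  unfolding damping_def[abs_def] by (auto intro!: derivative_eq_intros simp: algebra_simps)

text \<open>The logarithmic derivative is affine in x = exp \<tau>: its value at x = 0 becomes the
  linear part of the foliation, and the rest is O(x).\<close>

lemma frame_deriv:
  "((\<lambda>\<tau>. frame \<nu> T \<mu> \<tau> i) has_field_derivative
    frame \<nu> T \<mu> \<tau> i * (of_nat (weight \<nu> i) * (1 - exp \<tau>) + bexp T i)) (at \<tau>)"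
proof (cases "weight \<nu> i")
  case 0
  then show ?thesis unfolding frame_def monomial_frame_def by (auto intro!: derivative_eq_intros)
next
  case (Suc k)
  have "((\<lambda>\<tau>. damping \<mu> \<tau> ^ weight \<nu> i) has_field_derivative of_nat (weight \<nu> i) * (damping \<mu> \<tau> * (1 - exp \<tau>) * damping \<mu> \<tau> ^ (weight \<nu> i - 1))) (at \<tau>)"
    using DERIV_power[OF damping_deriv[of \<mu> \<tau>], where n = "weight \<nu> i"] by simp
  then have "((\<lambda>\<tau>. damping \<mu> \<tau> ^ weight \<nu> i) has_field_derivative of_nat (weight \<nu> i) * (1 - exp \<tau>) * damping \<mu> \<tau> ^ weight \<nu> i) (at \<tau>)"
    unfolding Suc by (simp add: mult_ac)
  moreover have "((\<lambda>\<tau>. exp (bexp T i * \<tau>)) has_field_derivative bexp T i * exp (bexp T i * \<tau>)) (at \<tau>)"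
    by (auto intro!: derivative_eq_intros)
  ultimately show ?thesis
    unfolding frame_def monomial_frame_def using DERIV_mult by (fastforce simp: algebra_simps)
qed

lemma holomorphic_frame: "(\<lambda>\<tau>. frame \<nu> T \<mu> \<tau> i) holomorphic_on S"
  unfolding holomorphic_on_def field_differentiable_def
  by (intro ballI exI, rule has_field_derivative_at_within[OF frame_deriv])

lemma frame_nonzero: "0 < \<mu> \<Longrightarrow> frame \<nu> T \<mu> \<tau> i \<noteq> 0"
  by (simp add: frame_def monomial_frame_nonzero)

lemma frame_shift:
  assumes "T $ i $ i \<noteq> 0"
  shows "frame \<nu> T \<mu> (\<tau> + 2 * of_real pi * \<i>) i = T $ i $ i * frame \<nu> T \<mu> \<tau> i"
proof -
  have "exp (\<tau> + 2 * of_real pi * \<i>) = exp \<tau>" by (simp add: exp_add exp_two_pi_i)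
  then have "damping \<mu> (\<tau> + 2 * of_real pi * \<i>) = damping \<mu> \<tau>" by (simp add: damping_def)
  moreover have "exp (bexp T i * (\<tau> + 2 * of_real pi * \<i>)) = exp (bexp T i * \<tau>) * T $ i $ i"
    using bexp_exp[OF assms] by (simp add: distrib_left exp_add)
  ultimately show ?thesis by (simp add: frame_def monomial_frame_def)
qed

lemma ghol_frame: "ghol U (\<lambda>p. frame \<nu> T \<mu> (fst p) i)"
  by (rule ghol_compose[OF ghol_fst holomorphic_frame[of _ _ _ _ UNIV]]) auto

lemma suspension_trivialization:
  fixes g :: "complex^'n \<Rightarrow> complex^'n" and T :: "complex^'n^'n"
  assumes g: "holo_vec (ball 0 \<rho>) g" "0 < \<rho>" "g 0 = 0" "(g has_derivative (\<lambda>v. T *v v)) (at 0)"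
    and tri: "\<And>i j. \<nu> j < \<nu> i \<Longrightarrow> T $ i $ j = 0" and inj: "inj \<nu>" and lt: "\<And>i. \<nu> i < CARD('n)"
    and diag: "\<And>i. T $ i $ i \<noteq> 0" and \<eta>: "0 < \<eta>"
  obtains \<mu> :: real and w :: "complex \<Rightarrow> complex^'n \<Rightarrow> complex^'n" where "0 < \<mu>"
    "\<And>i. ghol (strip (-1/4) (2 * pi + 1/4) \<times> ball 0 1) (\<lambda>p. w (fst p) (snd p) $ i)"
    "\<And>\<tau> Y i. \<tau> \<in> strip (-1/4) (2 * pi + 1/4) \<Longrightarrow> norm Y < 1 \<Longrightarrow> cmod (w \<tau> Y $ i) \<le> \<eta> * min 1 (exp (Re \<tau>))"
    "\<And>\<tau>. \<tau> \<in> strip (-1/4) (2 * pi + 1/4) \<Longrightarrow> w \<tau> 0 = 0"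
    "\<And>\<tau> Y. \<bar>Im \<tau>\<bar> < 1/4 \<Longrightarrow> norm Y < 1 \<Longrightarrow>
       norm (\<chi> i. frame \<nu> T \<mu> \<tau> i * (Y + w \<tau> Y) $ i) < \<rho> \<and>
       (\<chi> i. frame \<nu> T \<mu> (\<tau> + 2 * of_real pi * \<i>) i * (Y + w (\<tau> + 2 * of_real pi * \<i>) Y) $ i) =
         g (\<chi> i. frame \<nu> T \<mu> \<tau> i * (Y + w \<tau> Y) $ i)"
proof -
  \<comment> \<open>The first entry allows for the factor 3 in the bound of the solution, the second
    is the smallness that makes the iteration contract.\<close>
  define \<epsilon> where "\<epsilon> = min (\<eta> / 3) (1 / (100 * real CARD('n)))"
  have \<epsilon>: "0 < \<epsilon>" "3 * \<epsilon> \<le> \<eta>" "real CARD('n) * \<epsilon> \<le> 1/100"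
  proof -
    show "0 < \<epsilon>" using \<eta> by (simp add: \<epsilon>_def)
    have "\<epsilon> \<le> \<eta> / 3" unfolding \<epsilon>_def by (rule min.cobounded1)
    then show "3 * \<epsilon> \<le> \<eta>" by simp
    have "\<epsilon> \<le> 1 / (100 * real CARD('n))" unfolding \<epsilon>_def by (rule min.cobounded2)
    then have "real CARD('n) * \<epsilon> \<le> real CARD('n) * (1 / (100 * real CARD('n)))" by (intro mult_left_mono) auto
    then show "real CARD('n) * \<epsilon> \<le> 1/100" by simp
  qed
  obtain \<mu> where \<mu>: "0 < \<mu>"
    "\<And>\<tau> v. \<tau> \<in> strip (-1) 1 \<Longrightarrow> norm v < 2 \<Longrightarrow> norm (\<chi> j. frame \<nu> T \<mu> \<tau> j * v $ j) < \<rho>"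
    "\<And>\<tau> v i. \<tau> \<in> strip (-1) 1 \<Longrightarrow> norm v < 2 \<Longrightarrow>
      cmod (g (\<chi> j. frame \<nu> T \<mu> \<tau> j * v $ j) $ i / (T $ i $ i * frame \<nu> T \<mu> \<tau> i) - v $ i) \<le> \<epsilon> * decay (Re \<tau>)"
    by (rule small_perturbation[OF g tri inj lt diag \<epsilon>(1)], assumption) (rule that)
  let ?E = "frame \<nu> T \<mu>"
  have E0: "?E \<tau> i \<noteq> 0" for \<tau> i using frame_nonzero[OF \<mu>(1)] .
  \<comment> \<open>By \<open>frame_shift\<close>, dividing the gluing relation by
    \<open>T_ii E_i\<close> leaves w (\<tau> + 2 \<pi> i) = w \<tau> + R \<tau> (Y + w
    \<tau>).\<close>
  define R where "R \<tau> v = (\<chi> i. g (\<chi> j. ?E \<tau> j * v $ j) $ i / (T $ i $ i * ?E \<tau> i) - v $ i)" for \<tau> v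
  have R: "ghol (strip (-1) 1 \<times> ball 0 2) (\<lambda>p. R (fst p) (snd p) $ i)" for i
    unfolding R_def vec_lambda_beta
  proof (intro ghol_diff ghol_divide ghol_snd ghol_mult ghol_const ghol_frame)
    show "ghol (strip (-1) 1 \<times> ball 0 2) (\<lambda>p. g (\<chi> j. ?E (fst p) j * snd p $ j) $ i)"
    proof (rule ghol_compose_holo_vec[OF _ _ g(1)])
      show "open (strip (-1) 1 \<times> (ball 0 2 :: (complex^'n) set))" by (auto intro: open_Times)
      show "ghol (strip (-1) 1 \<times> ball 0 2) (\<lambda>p. (\<chi> j. ?E (fst p) j * snd p $ j) $ i)" for i
        unfolding vec_lambda_beta by (intro ghol_mult ghol_frame ghol_snd)
      show "(\<chi> j. ?E (fst p) j * snd p $ j) \<in> ball 0 \<rho>" if "p \<in> strip (-1) 1 \<times> ball 0 2" for p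
        using \<mu>(2)[of "fst p" "snd p"] that by (auto simp: mem_Times_iff)
    qed
  qed (use diag E0 in auto)
  have R0: "R \<tau> 0 = 0" for \<tau>
  proof -
    have "(\<chi> j. ?E \<tau> j * (0 :: complex^'n) $ j) = 0" by (simp add: vec_eq_iff)
    then show ?thesis unfolding R_def by (simp only: g(3)) (simp add: vec_eq_iff)
  qed
  have Rb: "cmod (R \<tau> v $ i) \<le> \<epsilon> * decay (Re \<tau>)" if "\<tau> \<in> strip (-1) 1" "norm v < 2" for \<tau> v i
    using \<mu>(3)[OF that] by (simp add: R_def)
  obtain w where w: "\<And>i. ghol (strip (-1/4) (2 * pi + 1/4) \<times> ball 0 1) (\<lambda>p. w (fst p) (snd p) $ i)"
    "\<And>\<tau> Y i. \<tau> \<in> strip (-1/4) (2 * pi + 1/4) \<Longrightarrow> norm Y < 1 \<Longrightarrow> cmod (w \<tau> Y $ i) \<le> 3 * \<epsilon> * min 1 (exp (Re \<tau>))"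
    "\<And>\<tau>. \<tau> \<in> strip (-1/4) (2 * pi + 1/4) \<Longrightarrow> w \<tau> 0 = 0"
    "\<And>\<tau> Y. \<bar>Im \<tau>\<bar> < 1/4 \<Longrightarrow> norm Y < 1 \<Longrightarrow> norm (Y + w \<tau> Y) < 2 \<and>
       w (\<tau> + 2 * of_real pi * \<i>) Y = w \<tau> Y + R \<tau> (Y + w \<tau> Y)"
    by (rule nonlinear_cousin[OF R Rb R0 less_imp_le[OF \<epsilon>(1)] \<epsilon>(3)], assumption, assumption) (rule that)
  show thesis
  proof (rule that[OF \<mu>(1) w(1) _ w(3)])
    show "cmod (w \<tau> Y $ i) \<le> \<eta> * min 1 (exp (Re \<tau>))" if "\<tau> \<in> strip (-1/4) (2 * pi + 1/4)" "norm Y < 1" for \<tau> Y i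
      using order_trans[OF w(2)[OF that] mult_right_mono[OF \<epsilon>(2)]] by simp
    fix \<tau> Y assume \<tau>: "\<bar>Im \<tau>\<bar> < 1/4" and Y: "norm (Y :: complex^'n) < 1"
    have S: "\<tau> \<in> strip (-1) 1" using \<tau> by (auto simp: strip_def)
    let ?Z = "Y + w \<tau> Y"
    have Z: "norm ?Z < 2" "w (\<tau> + 2 * of_real pi * \<i>) Y = w \<tau> Y + R \<tau> ?Z" using w(4)[OF \<tau> Y] by auto
    have "?E (\<tau> + 2 * of_real pi * \<i>) i * (Y + w (\<tau> + 2 * of_real pi * \<i>) Y) $ i = g (\<chi> i. ?E \<tau> i * ?Z $ i) $ i" for i
    proof -
      have "(Y + w (\<tau> + 2 * of_real pi * \<i>) Y) $ i = g (\<chi> i. ?E \<tau> i * ?Z $ i) $ i / (T $ i $ i * ?E \<tau> i)"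
        unfolding Z(2) R_def by simp
      then show ?thesis using frame_shift[OF diag, of \<nu> \<mu> \<tau> i] diag[of i] E0[of \<tau> i] by simp
    qed
    then show "norm (\<chi> i. ?E \<tau> i * ?Z $ i) < \<rho> \<and>
       (\<chi> i. ?E (\<tau> + 2 * of_real pi * \<i>) i * (Y + w (\<tau> + 2 * of_real pi * \<i>) Y) $ i) = g (\<chi> i. ?E \<tau> i * ?Z $ i)"
      using \<mu>(2)[OF S Z(1)] by (simp add: vec_eq_iff)
  qed
qed

subsection \<open>The vector field of the suspension\<close>

lemma ddir_bound:
  assumes f: "ghol U f" and r: "0 < r" and b: "\<And>z. z \<in> cball 0 r \<Longrightarrow> p + cscale z v \<in> U \<and> cmod (f (p + cscale z v)) \<le> M"
  shows "cmod (ddir f p v) \<le> M / r"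
proof -
  have "norm ((deriv ^^ 1) (\<lambda>z. f (p + cscale z v)) 0) \<le> fact 1 * M / r ^ 1"
  proof (rule Cauchy_inequality[OF _ _ r])
    show "(\<lambda>z. f (p + cscale z v)) holomorphic_on ball 0 r"
      by (rule ghol_line[OF f]) (use b ball_subset_cball in blast)
    have "(\<lambda>z. f (p + cscale z v)) holomorphic_on cball 0 r" by (rule ghol_line[OF f]) (use b in blast)
    then show "continuous_on (cball 0 r) (\<lambda>z. f (p + cscale z v))" by (rule holomorphic_on_imp_continuous_on)
    show "cmod (f (p + cscale x v)) \<le> M" if "norm (0 - x) = r" for x using b[of x] that by simp
  qed
  then show ?thesis by (simp add: ddir_def)
qed

lemma ghol_det:
  fixes A :: "complex \<times> (complex^'n) \<Rightarrow> complex^'m^'m"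
  assumes "\<And>i j. ghol U (\<lambda>p. A p $ i $ j)"
  shows "ghol U (\<lambda>p. Determinants.det (A p))"
  unfolding Determinants.det_def by (intro ghol_sum ghol_mult ghol_const ghol_prod assms)

text \<open>The frame enters only through its non-vanishing and its logarithmic derivative. The
  bound 1/16 makes w \<tau> Lipschitz in Y with constant 1/8 on the ball of radius 1/2, so that Y +
  w \<tau> Y is injective there.\<close>

locale suspension =
  fixes w :: "complex \<Rightarrow> complex^'n \<Rightarrow> complex^'n" and E :: "complex \<Rightarrow> 'n \<Rightarrow> complex"
    and b k :: "'n \<Rightarrow> complex" and g :: "complex^'n \<Rightarrow> complex^'n" and \<rho> \<eta> :: real
  assumes w_ghol: "\<And>i. ghol (strip (-1/4) (2 * pi + 1/4) \<times> ball 0 1) (\<lambda>p. w (fst p) (snd p) $ i)"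
    and w_bound: "\<And>\<tau> Y i. \<tau> \<in> strip (-1/4) (2 * pi + 1/4) \<Longrightarrow> norm Y < 1 \<Longrightarrow> cmod (w \<tau> Y $ i) \<le> \<eta> * min 1 (exp (Re \<tau>))"
    and w_0: "\<And>\<tau>. \<tau> \<in> strip (-1/4) (2 * pi + 1/4) \<Longrightarrow> w \<tau> 0 = 0"
    and E_nz: "\<And>\<tau> i. E \<tau> i \<noteq> 0"
    and E_deriv: "\<And>\<tau> i. ((\<lambda>\<tau>. E \<tau> i) has_field_derivative E \<tau> i * (b i - k i * exp \<tau>)) (at \<tau>)"
    and g_holo: "holo_vec (ball 0 \<rho>) g"
    and period: "\<And>\<tau> Y. \<bar>Im \<tau>\<bar> < 1/4 \<Longrightarrow> norm Y < 1 \<Longrightarrow>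
       norm (\<chi> i. E \<tau> i * (Y + w \<tau> Y) $ i) < \<rho> \<and>
       (\<chi> i. E (\<tau> + 2 * of_real pi * \<i>) i * (Y + w (\<tau> + 2 * of_real pi * \<i>) Y) $ i) =
         g (\<chi> i. E \<tau> i * (Y + w \<tau> Y) $ i)"
    and \<eta>: "0 < \<eta>" "real CARD('n) * \<eta> \<le> 1/16"
begin

abbreviation "S \<equiv> strip (-1/4) (2 * pi + 1/4)"
text \<open>The margin 1/8 inside \<open>S\<close> is the radius of the Cauchy estimate for the
  \<tau>-derivative; \<open>S1\<close> still overlaps its translate by 2 \<pi> i.\<close>

abbreviation "S1 \<equiv> strip (-1/8) (2 * pi + 1/8)"

definition psi :: "complex \<Rightarrow> complex^'n \<Rightarrow> complex^'n" where
  "psi \<tau> Y = (\<chi> i. E \<tau> i * (Y + w \<tau> Y) $ i)"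

definition Dw :: "complex \<Rightarrow> complex^'n \<Rightarrow> 'n \<Rightarrow> complex \<times> (complex^'n) \<Rightarrow> complex" where
  "Dw \<tau> Y i v = ddir (\<lambda>p. w (fst p) (snd p) $ i) (\<tau>, Y) v"

text \<open>The Jacobian of psi in Y with the invertible frame factored out; \<open>cvec\<close> is
  likewise the \<tau>-derivative of psi.\<close>

definition M :: "complex \<Rightarrow> complex^'n \<Rightarrow> complex^'n^'n" where
  "M \<tau> Y = (\<chi> i j. (if i = j then 1 else 0) + Dw \<tau> Y i (0, axis j 1))"

definition cvec :: "complex \<Rightarrow> complex^'n \<Rightarrow> complex^'n" where
  "cvec \<tau> Y = (\<chi> i. (b i - k i * exp \<tau>) * (Y + w \<tau> Y) $ i + Dw \<tau> Y i (1, 0))"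

text \<open>The slope of the leaves: (1, F) spans the kernel of the differential of psi. Cramer's
  rule makes holomorphic dependence on (\<tau>, Y) visible.\<close>

definition F :: "complex \<Rightarrow> complex^'n \<Rightarrow> complex^'n" where
  "F \<tau> Y = (\<chi> j. Determinants.det (\<chi> i l. if l = j then (- cvec \<tau> Y) $ i else M \<tau> Y $ i $ l) / Determinants.det (M \<tau> Y))"

lemma open_SB: "open (S \<times> (ball 0 s :: (complex^'n) set))"
  by (auto intro: open_Times)

lemma S1_subset: "\<tau> \<in> S1 \<Longrightarrow> \<tau> \<in> S"
  by (auto simp: strip_def)

lemma psi_period:
  "\<bar>Im \<tau>\<bar> < 1/4 \<Longrightarrow> norm Y < 1 \<Longrightarrow> norm (psi \<tau> Y) < \<rho> \<and> psi (\<tau> + 2 * of_real pi * \<i>) Y = g (psi \<tau> Y)"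
  unfolding psi_def by (rule period)

lemma Dw_lin:
  assumes "\<tau> \<in> S" "norm Y < 1"
  shows "Dw \<tau> Y i (u + v) = Dw \<tau> Y i u + Dw \<tau> Y i v" "Dw \<tau> Y i (cscale a u) = a * Dw \<tau> Y i u"
  using assms ddir_add[OF open_SB w_ghol] ddir_cscale[OF open_SB w_ghol] unfolding Dw_def by auto

lemma M_apply:
  assumes "\<tau> \<in> S" "norm Y < 1"
  shows "(M \<tau> Y *v u) $ i = u $ i + Dw \<tau> Y i (0, u)"
proof -
  have fin: "Dw \<tau> Y i (\<Sum>j\<in>J. cscale (u $ j) (0, axis j 1)) = (\<Sum>j\<in>J. u $ j * Dw \<tau> Y i (0, axis j 1))" if "finite J" for J
    using that
  proof (induction J)
    case empty
    show ?case using Dw_lin(2)[OF assms, of i 0 0] by simp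
  qed (simp add: Dw_lin[OF assms])
  have "(\<Sum>j\<in>UNIV. cscale (u $ j) (0 :: complex, axis j 1)) = (0, u)"
    by (simp add: prod_eq_iff fst_sum snd_sum vec_eq_iff axis_def if_distrib sum.delta cong: if_cong)
  then have "Dw \<tau> Y i (0, u) = (\<Sum>j\<in>UNIV. u $ j * Dw \<tau> Y i (0, axis j 1))" using fin[of UNIV] by simp
  moreover have "(\<Sum>j\<in>UNIV. (if i = j then 1 else 0) * u $ j) = u $ i" by (simp add: if_distrib[of "\<lambda>x. x * _"] sum.delta cong: if_cong)
  ultimately show ?thesis by (simp add: M_def matrix_vector_mult_def distrib_left sum.distrib mult.commute)
qed

lemma Dw_bound_Y:
  assumes "\<tau> \<in> S" "norm Y < 1/2"
  shows "cmod (Dw \<tau> Y i (0, u)) \<le> 2 * \<eta> * min 1 (exp (Re \<tau>)) * norm u"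
proof (cases "u = 0")
  case True
  then show ?thesis using Dw_lin(2)[OF assms(1), of Y i 0 0] assms(2) \<eta>(1) by (simp add: zero_prod_def)
next
  case False
  have "cmod (Dw \<tau> Y i (0, u)) \<le> \<eta> * min 1 (exp (Re \<tau>)) / (1/2 / norm u)"
    unfolding Dw_def
  proof (rule ddir_bound[OF w_ghol])
    show "0 < 1/2 / norm u" using False by simp
    fix z :: complex assume z: "z \<in> cball 0 (1/2 / norm u)"
    have "cmod z * norm u \<le> 1/2" using z False by (simp add: field_simps)
    then have n: "norm (Y + z *s u) < 1" using assms(2) norm_triangle_ineq[of Y "z *s u"] by (simp add: norm_vector_smult)
    show "(\<tau>, Y) + cscale z (0, u) \<in> S \<times> ball 0 1 \<and>
      cmod (w (fst ((\<tau>, Y) + cscale z (0, u))) (snd ((\<tau>, Y) + cscale z (0, u))) $ i) \<le> \<eta> * min 1 (exp (Re \<tau>))"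
      using n assms(1) w_bound[OF assms(1) n] by (simp add: cscale_def)
  qed
  then show ?thesis by (simp add: mult_ac)
qed

text \<open>Cauchy's inequality on a disc of radius 1/8, on which exp (Re \<tau>) grows by at most
  exp (1/8) \<le> 2; hence 8 times 2.\<close>

lemma Dw_bound_tau:
  assumes "\<tau> \<in> S1" "norm Y < 1"
  shows "cmod (Dw \<tau> Y i (1, 0)) \<le> 16 * \<eta> * exp (Re \<tau>)"
proof -
  have "cmod (Dw \<tau> Y i (1, 0)) \<le> \<eta> * (2 * exp (Re \<tau>)) / (1/8)"
    unfolding Dw_def
  proof (rule ddir_bound[OF w_ghol])
    fix z :: complex assume "z \<in> cball 0 (1/8)"
    then have z: "cmod z \<le> 1/8" by simp
    have zi: "\<bar>Im z\<bar> \<le> 1/8" "Re z \<le> 1/8" using abs_Im_le_cmod[of z] complex_Re_le_cmod[of z] z by linarith+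
    have s: "\<tau> + z \<in> S" using assms(1) zi unfolding strip_def by auto
    have e: "exp (1/8 :: real) \<le> 2" using exp_bound[of "1/8"] by (simp add: power2_eq_square)
    have "exp (Re (\<tau> + z)) \<le> exp (Re \<tau> + 1/8)" using zi by simp
    also have "\<dots> = exp (Re \<tau>) * exp (1/8)" by (rule exp_add)
    also have "\<dots> \<le> exp (Re \<tau>) * 2" using e by (intro mult_left_mono) auto
    finally have "min 1 (exp (Re (\<tau> + z))) \<le> 2 * exp (Re \<tau>)" by linarith
    then have "cmod (w (\<tau> + z) Y $ i) \<le> \<eta> * (2 * exp (Re \<tau>))"
      using w_bound[OF s assms(2), of i] \<eta>(1) mult_left_mono[of "min 1 (exp (Re (\<tau> + z)))" "2 * exp (Re \<tau>)" \<eta>] by linarith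
    then show "(\<tau>, Y) + cscale z (1, 0) \<in> S \<times> ball 0 1 \<and>
      cmod (w (fst ((\<tau>, Y) + cscale z (1, 0))) (snd ((\<tau>, Y) + cscale z (1, 0))) $ i) \<le> \<eta> * (2 * exp (Re \<tau>))"
      using s assms(2) by (simp add: cscale_def)
  qed simp
  then show ?thesis by simp
qed

text \<open>M differs from the identity by an operator of norm at most 2 n \<eta> \<le> 1/8. The
  inequality is used for invertibility and again to bound \<open>Gh\<close>.\<close>

lemma M_lower:
  assumes "\<tau> \<in> S" "norm Y < 1/2"
  shows "norm u \<le> 2 * norm (M \<tau> Y *v u)"
proof -
  have "cmod ((u - M \<tau> Y *v u) $ i) \<le> 2 * \<eta> * norm u" for i
  proof -
    have "(u - M \<tau> Y *v u) $ i = - Dw \<tau> Y i (0, u)" using assms by (simp add: M_apply)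
    moreover have "2 * \<eta> * min 1 (exp (Re \<tau>)) * norm u \<le> 2 * \<eta> * 1 * norm u"
      using \<eta>(1) by (intro mult_right_mono mult_left_mono) auto
    ultimately show ?thesis using Dw_bound_Y[OF assms, of i u] by simp
  qed
  then have "norm (u - M \<tau> Y *v u) \<le> real CARD('n) * (2 * \<eta> * norm u)" by (rule norm_vec_le_card)
  also have "\<dots> = 2 * (real CARD('n) * \<eta>) * norm u" by simp
  also have "\<dots> \<le> 2 * (1/16) * norm u" using \<eta>(2) by (intro mult_right_mono mult_left_mono) auto
  finally have "norm (u - M \<tau> Y *v u) \<le> norm u / 8" by simp
  then show ?thesis using norm_triangle_sub[of u "M \<tau> Y *v u"] norm_ge_zero[of "M \<tau> Y *v u"] by linarith
qed

lemma det_M: "\<tau> \<in> S \<Longrightarrow> norm Y < 1/2 \<Longrightarrow> Determinants.det (M \<tau> Y) \<noteq> 0"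
  using M_lower[of \<tau> Y] matrix_left_invertible_ker[of "M \<tau> Y"] invertible_left_inverse[of "M \<tau> Y"] invertible_det_nz[of "M \<tau> Y"]
  by (metis mult_zero_right norm_le_zero_iff norm_zero)

lemma F_iff: "\<tau> \<in> S \<Longrightarrow> norm Y < 1/2 \<Longrightarrow> M \<tau> Y *v u = - cvec \<tau> Y \<longleftrightarrow> u = F \<tau> Y"
  unfolding F_def by (rule cramer[OF det_M])

lemma ghol_Dw: "ghol (S \<times> ball 0 1) (\<lambda>p. Dw (fst p) (snd p) i v)"
  unfolding Dw_def prod.collapse by (rule ghol_ddir[OF open_SB w_ghol])

lemma ghol_F: "ghol (S \<times> ball 0 (1/2)) (\<lambda>p. F (fst p) (snd p) $ i)"
proof -
  let ?U = "S \<times> (ball 0 (1/2) :: (complex^'n) set)"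
  have sub: "?U \<subseteq> S \<times> ball 0 1" by auto
  note D = ghol_subset[OF ghol_Dw sub]
  have M: "ghol ?U (\<lambda>p. M (fst p) (snd p) $ i $ j)" for i j
    unfolding M_def vec_lambda_beta by (intro ghol_add ghol_const D)
  have e: "ghol ?U (\<lambda>p. exp (fst p))" by (rule ghol_compose[OF ghol_fst, of exp UNIV]) (auto intro: holomorphic_intros)
  have c: "ghol ?U (\<lambda>p. (- cvec (fst p) (snd p)) $ i)" for i
    unfolding cvec_def vec_lambda_beta vector_uminus_component vector_add_component
    by (intro ghol_uminus ghol_add ghol_mult ghol_diff ghol_const D e ghol_snd ghol_subset[OF w_ghol sub])
  show ?thesis
    unfolding F_def vec_lambda_beta
  proof (intro ghol_divide ghol_det)
    show "ghol ?U (\<lambda>p. (\<chi> i l. if l = i' then (- cvec (fst p) (snd p)) $ i else M (fst p) (snd p) $ i $ l) $ a $ c)" for i' a c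
      unfolding vec_lambda_beta using M[of a c] \<open>\<And>i. ghol ?U (\<lambda>p. (- cvec (fst p) (snd p)) $ i)\<close>[of a]
      by (cases "c = i'") simp_all
    show "Determinants.det (M (fst p) (snd p)) \<noteq> 0" if "p \<in> ?U" for p
      using that by (intro det_M) (auto simp: mem_Times_iff)
  qed (rule M)
qed

lemma psi_line_deriv:
  assumes "\<tau> \<in> S" "norm Y < 1"
  shows "((\<lambda>z. psi (\<tau> + z * a) (Y + z *s u) $ i) has_field_derivative E \<tau> i * (a * cvec \<tau> Y $ i + (M \<tau> Y *v u) $ i)) (at 0)"
proof -
  have "((\<lambda>z. (\<lambda>p. w (fst p) (snd p) $ i) ((\<tau>, Y) + cscale z (a, u))) has_field_derivative Dw \<tau> Y i (a, u)) (at 0)"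
    unfolding Dw_def by (rule ghol_line_deriv[OF open_SB w_ghol]) (use assms in auto)
  then have w: "((\<lambda>z. w (\<tau> + z * a) (Y + z *s u) $ i) has_field_derivative Dw \<tau> Y i (a, u)) (at 0)"
    by (simp add: cscale_def)
  have "(a, u) = cscale a (1, 0) + (0, u)" by (simp add: cscale_def)
  then have D: "Dw \<tau> Y i (a, u) = a * Dw \<tau> Y i (1, 0) + Dw \<tau> Y i (0, u)"
    by (simp only: Dw_lin[OF assms])
  have "((\<lambda>\<tau>. E \<tau> i) has_field_derivative E \<tau> i * (b i - k i * exp \<tau>)) (at (\<tau> + 0 * a))" using E_deriv[of i \<tau>] by simp
  then have e: "((\<lambda>z. E (\<tau> + z * a) i) has_field_derivative E \<tau> i * (b i - k i * exp \<tau>) * a) (at 0)"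
    by (rule DERIV_chain2) (auto intro!: derivative_eq_intros)
  have y: "((\<lambda>z. Y $ i + z * u $ i) has_field_derivative u $ i) (at 0)" by (auto intro!: derivative_eq_intros)
  have "((\<lambda>z. E (\<tau> + z * a) i * ((Y $ i + z * u $ i) + w (\<tau> + z * a) (Y + z *s u) $ i)) has_field_derivative
     E \<tau> i * (b i - k i * exp \<tau>) * a * ((Y $ i + 0 * u $ i) + w (\<tau> + 0 * a) (Y + 0 *s u) $ i) +
       (u $ i + Dw \<tau> Y i (a, u)) * E (\<tau> + 0 * a) i) (at 0)"
    by (rule DERIV_mult[OF e DERIV_add[OF y w]])
  then show ?thesis
    by (simp add: psi_def cvec_def M_apply[OF assms] D algebra_simps)
qed

text \<open>In the direction (1, F \<tau> Y) psi is stationary to first order, hence so is g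
  composed with psi, which is psi one turn later. The same direction thus lies in the kernel at
  \<tau> + 2 \<pi> i, and the kernel determines F.\<close>

lemma F_period:
  assumes \<tau>: "\<bar>Im \<tau>\<bar> < 1/4" and Y: "norm Y < 1/2"
  shows "F (\<tau> + 2 * of_real pi * \<i>) Y = F \<tau> Y"
proof -
  let ?\<tau> = "\<tau> + 2 * of_real pi * \<i>"
  let ?u = "F \<tau> Y"
  have S: "\<tau> \<in> S" "?\<tau> \<in> S" using \<tau> pi_gt3 by (auto simp: strip_def)
  have Y1: "norm Y < 1" using Y by simp
  have "M \<tau> Y *v ?u = - cvec \<tau> Y" using F_iff[OF S(1) Y] by simp
  then have z: "(M \<tau> Y *v ?u) $ i = - cvec \<tau> Y $ i" for i by simp
  have d1: "((\<lambda>z. psi (\<tau> + z * 1) (Y + z *s ?u) $ i) has_field_derivative 0) (at 0)" for i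
    using psi_line_deriv[OF S(1) Y1, of 1 ?u i] by (simp add: z)
  have d0: "((\<lambda>z. psi (\<tau> + z) (Y + z *s ?u)) has_derivative (\<lambda>h. 0)) (at 0)"
    by (rule has_derivative_vecI) (use d1 in \<open>simp add: has_field_derivative_def mult_zero_left[abs_def]\<close>)
  have "psi \<tau> Y \<in> ball 0 \<rho>" using psi_period[OF \<tau> Y1] by simp
  from bspec[OF g_holo[unfolded holo_vec_def] this] obtain L where "(g has_derivative L) (at (psi \<tau> Y))"
    by blast
  then have L: "(g has_derivative L) (at (psi (\<tau> + 0) (Y + 0 *s ?u)))" by simp
  have gd: "((\<lambda>z. g (psi (\<tau> + z) (Y + z *s ?u))) has_derivative (\<lambda>h. L 0)) (at 0)"
    by (rule has_derivative_compose[OF d0 L])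
  have L0: "L 0 = 0" using has_derivative_linear[OF L] by (rule linear_0)
  have g0: "((\<lambda>z. g (psi (\<tau> + z) (Y + z *s ?u)) $ i) has_field_derivative 0) (at 0)" for i
    using bounded_linear.has_derivative[OF bounded_linear_vec_nth gd, of i]
    by (simp add: has_field_derivative_def L0 mult_zero_left[abs_def])
  have ev: "\<forall>\<^sub>F z in nhds 0. psi (?\<tau> + z * 1) (Y + z *s ?u) $ i = g (psi (\<tau> + z) (Y + z *s ?u)) $ i" for i
  proof -
    have "open {z. \<bar>Im (\<tau> + z)\<bar> < 1/4 \<and> norm (Y + z *s ?u) < 1}"
    proof -
      have c: "continuous_on UNIV (\<lambda>z. Y + z *s ?u)"
        by (intro continuous_on_add continuous_on_const) 
          (use continuous_on_snd[OF continuous_on_cscale[OF continuous_on_id, of UNIV "(0, ?u)"]] in simp)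
      show ?thesis by (intro open_Collect_conj open_Collect_less continuous_intros c)
    qed
    moreover have "0 \<in> {z. \<bar>Im (\<tau> + z)\<bar> < 1/4 \<and> norm (Y + z *s ?u) < 1}" using \<tau> Y1 by simp
    ultimately have "\<forall>\<^sub>F z in nhds 0. z \<in> {z. \<bar>Im (\<tau> + z)\<bar> < 1/4 \<and> norm (Y + z *s ?u) < 1}"
      by (rule eventually_nhds_in_open)
    then show ?thesis
    proof (rule eventually_mono)
      fix z assume "z \<in> {z. \<bar>Im (\<tau> + z)\<bar> < 1/4 \<and> norm (Y + z *s ?u) < 1}"
      then show "psi (?\<tau> + z * 1) (Y + z *s ?u) $ i = g (psi (\<tau> + z) (Y + z *s ?u)) $ i"
        using psi_period[of "\<tau> + z" "Y + z *s ?u"] by (simp add: algebra_simps)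
    qed
  qed
  have "((\<lambda>z. psi (?\<tau> + z * 1) (Y + z *s ?u) $ i) has_field_derivative 0) (at 0)" for i
    using g0[of i] DERIV_cong_ev[OF refl ev[of i] refl] by simp
  then have "E ?\<tau> i * (1 * cvec ?\<tau> Y $ i + (M ?\<tau> Y *v ?u) $ i) = 0" for i
    using psi_line_deriv[OF S(2) Y1, of 1 ?u i] DERIV_unique by blast
  then have "1 * cvec ?\<tau> Y $ i + (M ?\<tau> Y *v ?u) $ i = 0" for i
    using E_nz by (metis mult_eq_0_iff)
  then have "(M ?\<tau> Y *v ?u) $ i = - cvec ?\<tau> Y $ i" for i
    by (simp add: add_eq_0_iff)
  then have "M ?\<tau> Y *v ?u = - cvec ?\<tau> Y" by (simp add: vec_eq_iff)
  then show ?thesis using F_iff[OF S(2) Y] by simp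
qed

section \<open>Descent to x and extension across x = 0\<close>

text \<open>The field F freed of its linear part - b Y at x = 0.\<close>

definition Gh :: "complex \<Rightarrow> complex^'n \<Rightarrow> complex^'n" where
  "Gh \<tau> Y = (\<chi> i. F \<tau> Y $ i + b i * Y $ i)"

lemma ghol_Gh: "ghol (S \<times> ball 0 (1/2)) (\<lambda>p. Gh (fst p) (snd p) $ i)"
  unfolding Gh_def vec_lambda_beta by (intro ghol_add ghol_mult ghol_const ghol_F ghol_snd)

text \<open>In M applied to \<open>Gh\<close> the terms b_i Y_i cancel. Every remaining term
  contains exp \<tau>, w or a derivative of w, and all of these are O(x) by the Cauchy estimates;
  \<open>M_lower\<close> removes M.\<close>

lemma Gh_bound:
  obtains C where "0 \<le> C" "\<And>\<tau> Y. \<tau> \<in> S1 \<Longrightarrow> Re \<tau> \<le> 0 \<Longrightarrow> norm Y < 1/2 \<Longrightarrow> norm (Gh \<tau> Y) \<le> C * exp (Re \<tau>)"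
proof -
  define A where "A = (\<Sum>i\<in>UNIV. cmod (b i)) + (\<Sum>i\<in>UNIV. cmod (k i))"
  have A: "cmod (b i) + cmod (k i) \<le> A" for i
    unfolding A_def by (intro add_mono member_le_sum) auto
  have A0: "0 \<le> A" unfolding A_def by (intro add_nonneg_nonneg sum_nonneg) auto
  have kA: "cmod (k i) \<le> A" for i using A[of i] norm_ge_zero[of "b i"] by linarith
  define C1 where "C1 = A + A * \<eta> + 16 * \<eta> + 2 * \<eta> * (real CARD('n) * A)"
  have C10: "0 \<le> C1" unfolding C1_def using A0 \<eta> by (intro add_nonneg_nonneg mult_nonneg_nonneg) auto
  show thesis
  proof (rule that)
    show "0 \<le> 2 * (real CARD('n) * C1)" using C10 by simp
    fix \<tau> Y assume \<tau>: "\<tau> \<in> S1" "Re \<tau> \<le> 0" and Y: "norm (Y :: complex^'n) < 1/2"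
    let ?e = "exp (Re \<tau>)"
    have S: "\<tau> \<in> S" using \<tau>(1) by (rule S1_subset)
    have Y1: "norm Y < 1" using Y by simp
    have m: "min 1 ?e = ?e" "?e \<le> 1" using \<tau>(2) by auto
    define u where "u = (\<chi> i. b i * Y $ i)"
    have Yi: "cmod (Y $ i) \<le> 1" for i using Y Finite_Cartesian_Product.norm_nth_le[of Y i] by linarith
    have un: "norm u \<le> real CARD('n) * A"
    proof (rule norm_vec_le_card)
      fix i
      have "cmod (b i) * cmod (Y $ i) \<le> cmod (b i) * 1" using Yi by (intro mult_left_mono) auto
      moreover have "cmod (u $ i) = cmod (b i) * cmod (Y $ i)" by (simp add: u_def norm_mult)
      ultimately show "cmod (u $ i) \<le> A" using A[of i] norm_ge_zero[of "k i"] by linarith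
    qed
    have Gu: "Gh \<tau> Y = F \<tau> Y + u" by (simp add: Gh_def u_def vec_eq_iff)
    have MF: "M \<tau> Y *v F \<tau> Y = - cvec \<tau> Y" using F_iff[OF S Y] by simp
    have "cmod ((M \<tau> Y *v Gh \<tau> Y) $ i) \<le> C1 * ?e" for i
    proof -
      have "(M \<tau> Y *v Gh \<tau> Y) $ i = k i * exp \<tau> * Y $ i - (b i - k i * exp \<tau>) * w \<tau> Y $ i - Dw \<tau> Y i (1, 0) + Dw \<tau> Y i (0, u)"
        unfolding Gu matrix_vector_right_distrib MF using M_apply[OF S Y1, of u i]
        by (simp add: cvec_def u_def algebra_simps)
      moreover have "cmod (k i * exp \<tau> * Y $ i) \<le> A * ?e"
      proof -
        have "cmod (k i) * ?e * cmod (Y $ i) \<le> A * ?e * 1"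
          using kA A0 Yi by (intro mult_mono) auto
        then show ?thesis by (simp add: norm_mult)
      qed
      moreover have "cmod ((b i - k i * exp \<tau>) * w \<tau> Y $ i) \<le> A * \<eta> * ?e"
      proof -
        have "cmod (k i) * ?e \<le> cmod (k i) * 1" using m by (intro mult_left_mono) auto
        then have "cmod (b i - k i * exp \<tau>) \<le> A"
          using norm_triangle_ineq4[of "b i" "k i * exp \<tau>"] A[of i] by (simp add: norm_mult)
        then have "cmod (b i - k i * exp \<tau>) * cmod (w \<tau> Y $ i) \<le> A * (\<eta> * ?e)"
          using w_bound[OF S Y1, of i] A0 unfolding m(1) by (intro mult_mono) auto
        then show ?thesis by (simp add: norm_mult)
      qed
      moreover have "cmod (Dw \<tau> Y i (1, 0)) \<le> 16 * \<eta> * ?e" by (rule Dw_bound_tau[OF \<tau>(1) Y1])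
      moreover have "cmod (Dw \<tau> Y i (0, u)) \<le> 2 * \<eta> * (real CARD('n) * A) * ?e"
      proof -
        have "2 * \<eta> * ?e * norm u \<le> 2 * \<eta> * ?e * (real CARD('n) * A)"
          using un \<eta>(1) by (intro mult_left_mono) auto
        then show ?thesis using Dw_bound_Y[OF S Y, of i u] unfolding m(1) by (simp add: mult_ac)
      qed
      moreover have "cmod (x - y - z + t) \<le> cmod x + cmod y + cmod z + cmod t" for x y z t
        by (meson add_mono norm_triangle_ineq norm_triangle_ineq4 order_refl order_trans)
      ultimately have "cmod ((M \<tau> Y *v Gh \<tau> Y) $ i) \<le> A * ?e + A * \<eta> * ?e + 16 * \<eta> * ?e + 2 * \<eta> * (real CARD('n) * A) * ?e"
        by (smt (verit))
      then show ?thesis by (simp add: C1_def distrib_right)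
    qed
    then have "norm (M \<tau> Y *v Gh \<tau> Y) \<le> real CARD('n) * (C1 * ?e)" by (rule norm_vec_le_card)
    then show "norm (Gh \<tau> Y) \<le> 2 * (real CARD('n) * C1) * ?e" using M_lower[OF S Y, of "Gh \<tau> Y"] by simp
  qed
qed

text \<open>A point of the strip lying over x; the argument of the logarithm is turned so that the branch
  cut is the positive real axis.\<close>

definition Lg :: "complex \<Rightarrow> complex" where "Lg x = Ln (- x) + of_real pi * \<i>"

lemma Lg: "x \<noteq> 0 \<Longrightarrow> exp (Lg x) = x" "x \<noteq> 0 \<Longrightarrow> 0 < Im (Lg x)" "x \<noteq> 0 \<Longrightarrow> Im (Lg x) \<le> 2 * pi"
  "x \<noteq> 0 \<Longrightarrow> Lg x \<in> S1" "x \<noteq> 0 \<Longrightarrow> exp (Re (Lg x)) = cmod x"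
proof -
  assume x: "x \<noteq> 0"
  show e: "exp (Lg x) = x" using x by (simp add: Lg_def exp_add exp_Ln exp_pi_i')
  have "- pi < Im (Ln (- x))" "Im (Ln (- x)) \<le> pi" using x mpi_less_Im_Ln Im_Ln_le_pi by auto
  then show "0 < Im (Lg x)" "Im (Lg x) \<le> 2 * pi" by (auto simp: Lg_def)
  then show "Lg x \<in> S1" by (auto simp: strip_def)
  show "exp (Re (Lg x)) = cmod x" using e norm_exp_eq_Re by metis
qed

definition G :: "complex \<times> (complex^'n) \<Rightarrow> complex^'n" where
  "G p = (if fst p = 0 then 0 else Gh (Lg (fst p)) (snd p))"

lemma Gh_period: "\<bar>Im \<tau>\<bar> < 1/4 \<Longrightarrow> norm Y < 1/2 \<Longrightarrow> Gh (\<tau> + 2 * of_real pi * \<i>) Y = Gh \<tau> Y"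
  by (simp add: Gh_def F_period)

text \<open>Every lift of x in \<open>S1\<close> gives the same value, although the branch
  \<open>Lg\<close> jumps along the positive axis.\<close>

lemma G_exp:
  assumes \<tau>: "\<tau> \<in> S1" and Y: "norm Y < 1/2"
  shows "G (exp \<tau>, Y) = Gh \<tau> Y"
proof -
  let ?l = "Lg (exp \<tau>)"
  have l: "exp ?l = exp \<tau>" "0 < Im ?l" "Im ?l \<le> 2 * pi" using Lg[of "exp \<tau>"] by auto
  obtain n :: int where n: "?l = \<tau> + of_real (2 * of_int n * pi) * \<i>"
    using l(1) by (auto simp: exp_eq)
  have im: "Im ?l = Im \<tau> + 2 * of_int n * pi" by (simp add: n)
  have t: "-1/8 < Im \<tau>" "Im \<tau> < 2 * pi + 1/8" using \<tau> by (auto simp: strip_def)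
  have "real_of_int n * pi < 2 * pi" "(- 2) * pi < real_of_int n * pi" using im t l pi_gt3 by linarith+
  then have "real_of_int n < 2" "-2 < real_of_int n"
    unfolding mult_less_cancel_right_pos[OF pi_gt_zero] by auto
  \<comment> \<open>The heights of both lifts lie between -1/8 and 2 \<pi> + 1/8. If they differ by
    a turn, the lower one is close enough to the real axis for \<open>Gh_period\<close>.\<close>
  then have "n = 0 \<or> n = 1 \<or> n = -1" by linarith
  then have "Gh ?l Y = Gh \<tau> Y"
  proof (elim disjE)
    assume n1: "n = 1"
    then have "\<bar>Im \<tau>\<bar> < 1/4" using im l t by auto
    moreover have "?l = \<tau> + 2 * of_real pi * \<i>" using n n1 by simp
    ultimately show ?thesis using Gh_period Y by simp
  next
    assume n1: "n = -1"
    then have "\<bar>Im ?l\<bar> < 1/4" using im l t by auto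
    moreover have "\<tau> = ?l + 2 * of_real pi * \<i>" using n n1 by simp
    ultimately show ?thesis using Gh_period Y by metis
  qed (use n in simp)
  then show ?thesis by (simp add: G_def)
qed

lemma ghol_G_nonzero: "ghol ((- {0}) \<times> ball 0 (1/2)) (\<lambda>p. G p $ i)"
proof (rule ghol_local)
  fix p :: "complex \<times> (complex^'n)" assume "p \<in> (- {0}) \<times> ball 0 (1/2)"
  then have p: "fst p \<noteq> 0" "norm (snd p) < 1/2" by (auto simp: mem_Times_iff)
  \<comment> \<open>A local branch of the logarithm through the lift of p, holomorphic near p even
    if p lies over the cut of \<open>Lg\<close>.\<close>
  define lg where "lg x = Lg (fst p) + Ln (x / fst p)" for x
  define X where "X = {x. x / fst p \<notin> \<real>\<^sub>\<le>\<^sub>0} \<inter> lg -` S1"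
  have h: "lg holomorphic_on {x. x / fst p \<notin> \<real>\<^sub>\<le>\<^sub>0}" unfolding lg_def by (intro holomorphic_intros) (use p in auto)
  have o: "open {x. x / fst p \<notin> \<real>\<^sub>\<le>\<^sub>0}"
  proof -
    have "open ((\<lambda>x. x / fst p) -` (- \<real>\<^sub>\<le>\<^sub>0))"
      by (intro open_vimage continuous_intros) (use p in \<open>auto simp: open_Compl closed_nonpos_Reals_complex\<close>)
    then show ?thesis by (simp add: vimage_def)
  qed
  have oX: "open X" unfolding X_def
    using continuous_on_open_vimage[OF o, of lg] holomorphic_on_imp_continuous_on[OF h] open_strip
    by (metis inf_commute)
  have e: "exp (lg x) = x" "x \<noteq> 0" if "x \<in> X" for x
  proof -
    have "x / fst p \<noteq> 0" using that by (auto simp: X_def)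
    then show "exp (lg x) = x" "x \<noteq> 0" using p(1) by (auto simp: lg_def exp_add exp_Ln Lg(1))
  qed
  have "ghol (X \<times> ball 0 (1/2)) (\<lambda>q. (\<lambda>r. Gh (fst r) (snd r) $ i) (lg (fst q), snd q))"
  proof (rule ghol_compose_ghol[OF _ _ ghol_snd open_SB ghol_Gh])
    show "open (X \<times> (ball 0 (1/2) :: (complex^'n) set))" using oX by (auto intro: open_Times)
    have "lg holomorphic_on X" using h by (rule holomorphic_on_subset) (auto simp: X_def)
    then show "ghol (X \<times> ball 0 (1/2)) (\<lambda>q. lg (fst q))" by (rule ghol_compose[OF ghol_fst]) auto
    show "(lg (fst q), snd q) \<in> S \<times> ball 0 (1/2)" if "q \<in> X \<times> ball 0 (1/2)" for q
      using that S1_subset by (auto simp: X_def)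
  qed
  moreover have "G q $ i = Gh (lg (fst q)) (snd q) $ i" if "q \<in> X \<times> ball 0 (1/2)" for q
    using G_exp[of "lg (fst q)" "snd q"] that e(1)[of "fst q"] by (auto simp: X_def mem_Times_iff)
  ultimately have "ghol (X \<times> ball 0 (1/2)) (\<lambda>q. G q $ i)" by (subst ghol_cong) auto
  moreover have "fst p \<in> X" using p Lg(4)[of "fst p"] by (auto simp: X_def lg_def)
  ultimately show "\<exists>V. open V \<and> p \<in> V \<and> ghol V (\<lambda>p. G p $ i)"
    using p oX by (intro exI[of _ "X \<times> ball 0 (1/2)"]) (auto intro: open_Times simp: mem_Times_iff)
qed

text \<open>The bound O(x) gives continuity at x = 0. A complex line lies in x = 0, where G
  vanishes, or avoids it, or meets it in one point, which is a removable singularity.\<close>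

lemma ghol_G: "ghol (ball 0 1 \<times> ball 0 (1/2)) (\<lambda>p. G p $ i)"
proof -
  let ?U = "ball 0 1 \<times> ball 0 (1/2) :: (complex \<times> (complex^'n)) set"
  have oU: "open ?U" by (auto intro: open_Times)
  obtain C where C: "0 \<le> C" "\<And>\<tau> Y. \<tau> \<in> S1 \<Longrightarrow> Re \<tau> \<le> 0 \<Longrightarrow> norm Y < 1/2 \<Longrightarrow> norm (Gh \<tau> Y) \<le> C * exp (Re \<tau>)"
    by (rule Gh_bound) (rule that)
  have Gb: "cmod (G p $ i) \<le> C * cmod (fst p)" if p: "p \<in> ?U" for p
  proof (cases "fst p = 0")
    case False
    have "exp (Re (Lg (fst p))) \<le> exp 0" using Lg(5)[OF False] p by (simp add: mem_Times_iff)
    then have "Re (Lg (fst p)) \<le> 0" by simp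
    then have "norm (Gh (Lg (fst p)) (snd p)) \<le> C * cmod (fst p)"
      using C(2)[OF Lg(4)[OF False]] p Lg(5)[OF False] by (simp add: mem_Times_iff)
    then show ?thesis using False Finite_Cartesian_Product.norm_nth_le[of "Gh (Lg (fst p)) (snd p)" i] by (simp add: G_def)
  qed (simp add: G_def)
  have o0: "open ((- {0}) \<times> ball 0 (1/2) :: (complex \<times> (complex^'n)) set)" by (auto intro!: open_Times)
  have cont: "continuous_on ?U (\<lambda>p. G p $ i)"
  proof (rule continuous_at_imp_continuous_on, rule ballI)
    fix p assume p: "p \<in> ?U"
    show "isCont (\<lambda>p. G p $ i) p"
    proof (cases "fst p = 0")
      case True
      have "((\<lambda>q. G q $ i) \<longlongrightarrow> 0) (at p)"
      proof (rule Lim_null_comparison)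
        have "((\<lambda>q. C * cmod (fst q)) \<longlongrightarrow> C * cmod (fst p)) (at p)" by (intro tendsto_intros)
        then show "((\<lambda>q. C * cmod (fst q)) \<longlongrightarrow> 0) (at p)" using True by simp
        have "\<forall>\<^sub>F q in at p. q \<in> ?U" using oU p by (rule eventually_at_in_open')
        then show "\<forall>\<^sub>F q in at p. cmod (G q $ i) \<le> C * cmod (fst q)" by (rule eventually_mono) (rule Gb)
      qed
      then show ?thesis using True by (simp add: isCont_def G_def)
    next
      case False
      then have "p \<in> (- {0}) \<times> ball 0 (1/2)" using p by (auto simp: mem_Times_iff)
      then show ?thesis
        using ghol_continuous[OF ghol_G_nonzero[of i]] continuous_on_eq_continuous_at[OF o0] by blast
    qed
  qed
  show ?thesis
    unfolding ghol_def
  proof (intro conjI cont allI)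
    fix p v
    let ?L = "{z. p + cscale z v \<in> ?U}"
    have oL: "open ?L" by (rule open_cscale_line[OF oU])
    have hol: "(\<lambda>z. G (p + cscale z v) $ i) holomorphic_on ?L - {z. fst p + z * fst v = 0}"
      by (rule ghol_line[OF ghol_G_nonzero]) (auto simp: mem_Times_iff)
    show "(\<lambda>z. G (p + cscale z v) $ i) holomorphic_on ?L"
    proof (cases "fst v = 0")
      case True
      show ?thesis
      proof (cases "fst p = 0")
        case False
        have "{z. fst p + z * fst v = 0} = {}" using True False by simp
        then show ?thesis using hol by simp
      qed (simp add: G_def True)
    next
      case False
      have fin: "finite {z. fst p + z * fst v = 0}"
      proof (rule finite_subset)
        show "{z. fst p + z * fst v = 0} \<subseteq> {- fst p / fst v}" using False by (auto simp: field_simps add_eq_0_iff)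
      qed simp
      have "continuous_on ?L (\<lambda>z. G (p + cscale z v) $ i)"
        by (rule continuous_on_compose2[OF cont]) (auto intro!: continuous_intros)
      then show ?thesis using no_isolated_singularity[OF _ hol oL fin] by blast
    qed
  qed
qed

end

subsection \<open>Leaves and holonomy\<close>

context suspension
begin

lemma w_contraction:
  assumes \<tau>: "\<tau> \<in> S" and Y: "norm Y < 1/2" "norm Y' < 1/2"
  shows "norm (w \<tau> Y' - w \<tau> Y) \<le> 1/8 * norm (Y' - Y)"
proof -
  have "cmod (w \<tau> v $ i) \<le> \<eta>" if "norm v < 1" for v i
    using w_bound[OF \<tau> that, of i] mult_left_mono[of "min 1 (exp (Re \<tau>))" 1 \<eta>] \<eta>(1) by linarith
  then have "cmod ((\<lambda>p. w (fst p) (snd p) $ i) (\<tau>, Y') - (\<lambda>p. w (fst p) (snd p) $ i) (\<tau>, Y)) \<le> \<eta> / (1/2) * norm (Y' - Y)" for i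
    by (intro ghol_Lipschitz_snd[OF w_ghol \<tau> _ _ Y(2,1)]) auto
  then have "cmod ((w \<tau> Y' - w \<tau> Y) $ i) \<le> 2 * \<eta> * norm (Y' - Y)" for i by (simp add: mult_ac)
  then have "norm (w \<tau> Y' - w \<tau> Y) \<le> real CARD('n) * (2 * \<eta> * norm (Y' - Y))" by (rule norm_vec_le_card)
  also have "\<dots> = 2 * (real CARD('n) * \<eta>) * norm (Y' - Y)" by simp
  also have "\<dots> \<le> 2 * (1/16) * norm (Y' - Y)" using \<eta>(2) by (intro mult_right_mono mult_left_mono) auto
  finally show ?thesis by simp
qed

lemma w_small: "\<tau> \<in> S \<Longrightarrow> norm Y < 1/2 \<Longrightarrow> norm (w \<tau> Y) \<le> 1/8 * norm Y"
  using w_contraction[of \<tau> 0 Y] w_0[of \<tau>] by simp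

lemma psi_inj:
  assumes "\<tau> \<in> S" "norm Y < 1/2" "norm Y' < 1/2" "psi \<tau> Y = psi \<tau> Y'"
  shows "Y = Y'"
proof -
  have "(Y + w \<tau> Y) $ i = (Y' + w \<tau> Y') $ i" for i
    using arg_cong[OF assms(4), of "\<lambda>v. v $ i"] E_nz[of \<tau> i] by (simp add: psi_def)
  then have "Y + w \<tau> Y = Y' + w \<tau> Y'" by (simp add: vec_eq_iff)
  then have "Y' - Y = - (w \<tau> Y' - w \<tau> Y)" by (simp add: algebra_simps)
  then have "norm (Y' - Y) = norm (w \<tau> Y' - w \<tau> Y)" by (metis norm_minus_cancel)
  then show ?thesis using w_contraction[OF assms(1-3)] by simp
qed

lemma psi_0: "\<tau> \<in> S \<Longrightarrow> psi \<tau> 0 = 0"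
  using w_0[of \<tau>] by (simp add: psi_def vec_eq_iff)

text \<open>Banach's fixed point theorem for Y = z - w \<tau> Y on the ball of radius 1/5; it is
  mapped into itself because 1/8 + 1/40 < 1/5.\<close>

lemma solve_near_identity:
  assumes \<tau>: "\<tau> \<in> S" and z: "norm z < 1/8"
  shows "\<exists>Y. norm Y < 1/4 \<and> Y + w \<tau> Y = z"
proof -
  have "\<exists>!Y\<in>cball 0 (1/5). z - w \<tau> Y = Y"
  proof (rule Banach_fix)
    show "complete (cball (0 :: complex^'n) (1/5))" by (simp add: complete_eq_closed)
    show "(\<lambda>Y. z - w \<tau> Y) ` cball 0 (1/5) \<subseteq> cball 0 (1/5)"
    proof (rule image_subsetI)
      fix Y :: "complex^'n" assume Y: "Y \<in> cball 0 (1/5)"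
      then have "norm (w \<tau> Y) \<le> 1/8 * (1/5)" using w_small[OF \<tau>, of Y] by simp
      then show "z - w \<tau> Y \<in> cball 0 (1/5)" using z norm_triangle_ineq4[of z "w \<tau> Y"] by simp
    qed
    show "dist (z - w \<tau> Y) (z - w \<tau> Y') \<le> 1/8 * dist Y Y'" if "Y \<in> cball 0 (1/5)" "Y' \<in> cball 0 (1/5)" for Y Y'
      using w_contraction[OF \<tau>, of Y Y'] that by (simp add: dist_norm norm_minus_commute)
  qed auto
  then obtain Y where "norm Y \<le> 1/5" "z - w \<tau> Y = Y" by auto
  then show ?thesis by (intro exI[of _ Y]) (auto simp: algebra_simps)
qed

lemma holomorphic_E: "(\<lambda>\<tau>. E \<tau> i) holomorphic_on A"
  unfolding holomorphic_on_def field_differentiable_def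
  by (intro ballI exI, rule has_field_derivative_at_within[OF E_deriv])

lemma ghol_psi: "ghol (S \<times> ball 0 1) (\<lambda>p. psi (fst p) (snd p) $ i)"
  unfolding psi_def vec_lambda_beta vector_add_component
  by (intro ghol_mult ghol_add ghol_snd w_ghol ghol_compose[OF ghol_fst holomorphic_E[of i UNIV]]) auto

definition Dpsi :: "complex \<Rightarrow> complex^'n \<Rightarrow> complex \<times> (complex^'n) \<Rightarrow> complex^'n" where
  "Dpsi \<tau> Y v = (\<chi> i. E \<tau> i * (fst v * cvec \<tau> Y $ i + (M \<tau> Y *v snd v) $ i))"

lemma psi_has_derivative:
  assumes "\<tau> \<in> S" "norm Y < 1"
  shows "((\<lambda>p. psi (fst p) (snd p)) has_derivative Dpsi \<tau> Y) (at (\<tau>, Y))"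
proof -
  have p: "(\<tau>, Y) \<in> S \<times> ball 0 1" using assms by simp
  have "ddir (\<lambda>p. psi (fst p) (snd p) $ i) (\<tau>, Y) v = Dpsi \<tau> Y v $ i" for i v
  proof -
    have "((\<lambda>z. (\<lambda>p. psi (fst p) (snd p) $ i) ((\<tau>, Y) + cscale z v)) has_field_derivative ddir (\<lambda>p. psi (fst p) (snd p) $ i) (\<tau>, Y) v) (at 0)"
      by (rule ghol_line_deriv[OF open_SB ghol_psi p])
    then show ?thesis
      using DERIV_unique psi_line_deriv[OF assms, of "fst v" "snd v" i] by (simp add: cscale_def Dpsi_def)
  qed
  then show ?thesis using ghol_vec_has_derivative[OF open_SB ghol_psi p] by (simp add: vec_eq_iff)
qed

text \<open>This makes psi a first integral: the kernel of its differential is the tangent line of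
  the leaf.\<close>

lemma Dpsi_eq_0_iff:
  assumes "\<tau> \<in> S" "norm Y < 1/2"
  shows "Dpsi \<tau> Y (a, u) = 0 \<longleftrightarrow> u = a *s F \<tau> Y"
proof -
  have "Dpsi \<tau> Y (a, u) = 0 \<longleftrightarrow> (\<forall>i. a * cvec \<tau> Y $ i + (M \<tau> Y *v u) $ i = 0)"
    using E_nz by (simp add: Dpsi_def vec_eq_iff)
  also have "\<dots> \<longleftrightarrow> M \<tau> Y *v u = a *s (- cvec \<tau> Y)"
    by (auto simp: vec_eq_iff add_eq_0_iff)
  also have "a *s (- cvec \<tau> Y) = M \<tau> Y *v (a *s F \<tau> Y)"
    using F_iff[OF assms, of "F \<tau> Y"] by (simp add: matrix_vector_mult_scaleR vector_scalar_commute)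
  also have "M \<tau> Y *v u = M \<tau> Y *v (a *s F \<tau> Y) \<longleftrightarrow> u = a *s F \<tau> Y"
  proof
    assume "M \<tau> Y *v u = M \<tau> Y *v (a *s F \<tau> Y)"
    then have "M \<tau> Y *v (u - a *s F \<tau> Y) = 0" by (simp add: matrix_vector_mult_diff_distrib)
    then show "u = a *s F \<tau> Y" using M_lower[OF assms, of "u - a *s F \<tau> Y"] by simp
  qed simp
  finally show ?thesis .
qed

lemma psi_path_deriv:
  assumes "\<tau>0 + \<i> * of_real t \<in> S" "norm (y t) < 1" "(y has_vector_derivative y') (at t within A)"
  shows "((\<lambda>t. psi (\<tau>0 + \<i> * of_real t) (y t)) has_vector_derivative Dpsi (\<tau>0 + \<i> * of_real t) (y t) (\<i>, y')) (at t within A)"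
proof -
  have "((\<lambda>t. \<tau>0 + \<i> * complex_of_real t) has_vector_derivative 0 + \<i> * 1) (at t within A)"
    unfolding has_vector_derivative_def
    by (auto intro!: derivative_eq_intros simp: scaleR_conv_of_real)
  then have 1: "((\<lambda>t. (\<tau>0 + \<i> * complex_of_real t, y t)) has_vector_derivative (\<i>, y')) (at t within A)"
    using assms(3) by (intro has_vector_derivative_Pair) auto
  have 2: "((\<lambda>p. psi (fst p) (snd p)) has_derivative Dpsi (\<tau>0 + \<i> * of_real t) (y t)) (at (\<tau>0 + \<i> * of_real t, y t))"
    by (rule psi_has_derivative[OF assms(1,2)])
  have "((\<lambda>t. psi (fst (\<tau>0 + \<i> * complex_of_real t, y t)) (snd (\<tau>0 + \<i> * complex_of_real t, y t))) has_derivative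
     (\<lambda>h. Dpsi (\<tau>0 + \<i> * of_real t) (y t) (h *\<^sub>R (\<i>, y')))) (at t within A)"
    by (rule has_derivative_compose[OF 1[unfolded has_vector_derivative_def] 2])
  moreover have "Dpsi (\<tau>0 + \<i> * of_real t) (y t) (h *\<^sub>R (\<i>, y')) = h *\<^sub>R Dpsi (\<tau>0 + \<i> * of_real t) (y t) (\<i>, y')" for h
    using linear_cmul[OF has_derivative_linear[OF 2]] .
  ultimately show ?thesis by (simp add: has_vector_derivative_def)
qed

text \<open>Conservation of psi along a solution fixes its endpoint, psi being injective in Y. It
  thus does the work of uniqueness for the differential equation.\<close>

lemma leaf_constant:
  assumes \<tau>0: "Im \<tau>0 = 0" and y: "\<And>t. t \<in> {0..2*pi} \<Longrightarrow> norm (y t) < 1/2"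
    "\<And>t. t \<in> {0..2*pi} \<Longrightarrow> (y has_vector_derivative \<i> *s F (\<tau>0 + \<i> * of_real t) (y t)) (at t within {0..2*pi})"
  shows "psi (\<tau>0 + 2 * of_real pi * \<i>) (y (2 * pi)) = psi \<tau>0 (y 0)"
proof -
  let ?f = "\<lambda>t. psi (\<tau>0 + \<i> * of_real t) (y t)"
  have "(?f has_vector_derivative 0) (at t within {0..2*pi})" if t: "t \<in> {0..2*pi}" for t
  proof -
    have S: "\<tau>0 + \<i> * of_real t \<in> S" using \<tau>0 t by (auto simp: strip_def)
    have "(?f has_vector_derivative Dpsi (\<tau>0 + \<i> * of_real t) (y t) (\<i>, \<i> *s F (\<tau>0 + \<i> * of_real t) (y t))) (at t within {0..2*pi})"
      using y(1)[OF t] by (intro psi_path_deriv S y(2) t) simp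
    moreover have "Dpsi (\<tau>0 + \<i> * of_real t) (y t) (\<i>, \<i> *s F (\<tau>0 + \<i> * of_real t) (y t)) = 0"
      using Dpsi_eq_0_iff[OF S y(1)[OF t]] by simp
    ultimately show ?thesis by simp
  qed
  then have "?f (2*pi) = ?f 0"
    by (intro Derivative.has_derivative_zero_unique[of "{0..2*pi}" ?f]) (auto simp: has_vector_derivative_def)
  then show ?thesis by (simp add: mult_ac)
qed

text \<open>The map (\<tau>, psi) straightens the leaves; its differential is injective because psi
  has an invertible Y-derivative. The differentiable inverse supplies smoothness of the leaves in
  \<open>leaf_exists\<close>.\<close>

lemma Theta_inverse:
  fixes A :: "(complex \<times> (complex^'n)) set"
  defines "\<Theta> \<equiv> \<lambda>p. (fst p, psi (fst p) (snd p))"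
  defines "A \<equiv> S \<times> ball 0 (1/2)"
  assumes p: "p \<in> A"
  shows "(inv_into A \<Theta> has_derivative inv_into UNIV (\<lambda>v. (fst v, Dpsi (fst p) (snd p) v))) (at (\<Theta> p))"
proof -
  have pp: "fst p \<in> S" "norm (snd p) < 1/2" using p by (auto simp: A_def mem_Times_iff)
  have inj: "inj_on \<Theta> A"
    by (rule inj_onI) (auto simp: \<Theta>_def A_def prod_eq_iff mem_Times_iff intro: psi_inj)
  let ?D = "\<lambda>v. (fst v, Dpsi (fst p) (snd p) v)"
  have der: "(\<Theta> has_derivative (\<lambda>v. (fst v, Dpsi (fst q) (snd q) v))) (at q)" if "q \<in> A" for q
    unfolding \<Theta>_def using psi_has_derivative[of "fst q" "snd q"] that
    by (intro has_derivative_Pair has_derivative_fst has_derivative_ident) (auto simp: A_def mem_Times_iff)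
  have lin: "linear ?D" using has_derivative_linear[OF der[OF p]] .
  have "inj ?D"
  proof (subst linear_injective_0[OF lin], intro allI impI)
    fix v :: "complex \<times> (complex^'n)" assume "?D v = 0"
    then have "fst v = 0" "Dpsi (fst p) (snd p) (0, snd v) = 0" by (auto simp: zero_prod_def prod_eq_iff Dpsi_def)
    then show "v = 0" using Dpsi_eq_0_iff[OF pp, of 0 "snd v"] by (simp add: prod_eq_iff)
  qed
  then have "bij ?D" using linear_injective_imp_surjective[OF lin] by (simp add: bij_def)
  then have "?D \<circ> inv_into UNIV ?D = id" unfolding bij_def surj_iff by blast
  moreover have "continuous_on A \<Theta>"
    using der by (meson continuous_at_imp_continuous_on has_derivative_continuous)
  ultimately show ?thesis
  proof (intro has_derivative_inverse_strong[OF _ p _ _ der[OF p]])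
    show "open A" unfolding A_def by (rule open_SB)
    show "inv_into A \<Theta> (\<Theta> q) = q" if "q \<in> A" for q using inj that by (rule inv_into_f_f)
  qed
qed

text \<open>The solution is read off from a level set of psi: at each time the equation psi = q is
  solved by \<open>solve_near_identity\<close>, the straightening map shows that the result is
  differentiable, and \<open>Dpsi_eq_0_iff\<close> identifies its velocity.\<close>

lemma leaf_exists:
  assumes \<tau>0: "Im \<tau>0 = 0"
  obtains \<delta> where "0 < \<delta>" "\<delta> \<le> 1/2" "\<And>y0. norm y0 < \<delta> \<Longrightarrow> \<exists>y. y 0 = y0 \<and> (\<forall>t\<in>{0..2*pi}. norm (y t) < 1/4 \<and>
    (y has_vector_derivative \<i> *s F (\<tau>0 + \<i> * of_real t) (y t)) (at t within {0..2*pi}))"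
proof -
  let ?\<tau> = "\<lambda>t. \<tau>0 + \<i> * complex_of_real t"
  have S: "?\<tau> t \<in> S" if "t \<in> {0..2*pi}" for t using \<tau>0 that by (auto simp: strip_def)
  have "\<exists>K. \<forall>t\<in>{0..2*pi}. cmod (E \<tau>0 i / E (?\<tau> t) i) \<le> K" for i
  proof -
    have "continuous_on {0..2*pi} (\<lambda>t. E \<tau>0 i / E (?\<tau> t) i)"
      by (intro continuous_intros continuous_on_compose2[OF holomorphic_on_imp_continuous_on[OF holomorphic_E[of i UNIV]]])
        (use E_nz in auto)
    then have "compact ((\<lambda>t. E \<tau>0 i / E (?\<tau> t) i) ` {0..2*pi})" by (rule compact_continuous_image) simp
    from compact_imp_bounded[OF this] show ?thesis unfolding bounded_iff by blast
  qed
  then obtain K where K: "\<And>i t. t \<in> {0..2*pi} \<Longrightarrow> cmod (E \<tau>0 i / E (?\<tau> t) i) \<le> K i" by metis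
  define K' where "K' = 1 + (\<Sum>i\<in>UNIV. K i)"
  have K0: "0 \<le> K i" for i using K[of 0 i] by (simp add: order_trans[OF norm_ge_zero])
  have KK: "K i \<le> K'" for i using member_le_sum[of i UNIV K] K0 by (simp add: K'_def)
  have K'1: "1 \<le> K'" unfolding K'_def using K0 by (simp add: sum_nonneg)
  \<comment> \<open>Chosen so that the vector z below has norm at most 9/128, within the radius 1/8
    of \<open>solve_near_identity\<close>.\<close>
  define \<delta> where "\<delta> = 1 / (16 * (real CARD('n) * K'))"
  have nK: "1 \<le> real CARD('n) * K'" using mult_mono[of 1 "real CARD('n)" 1 K'] K'1 by simp
  have \<delta>: "0 < \<delta>" "\<delta> \<le> 1/16" "16 * (real CARD('n) * K') * \<delta> = 1" using nK unfolding \<delta>_def by (auto simp: divide_le_eq)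
  have "\<exists>y. y 0 = y0 \<and> (\<forall>t\<in>{0..2*pi}. norm (y t) < 1/4 \<and>
    (y has_vector_derivative \<i> *s F (?\<tau> t) (y t)) (at t within {0..2*pi}))" if y0: "norm y0 < \<delta>" for y0
  proof -
    have y01: "norm y0 < 1/2" using y0 \<delta> by linarith
    define q where "q = psi \<tau>0 y0"
    have \<tau>0S: "\<tau>0 \<in> S" using S[of 0] by simp
    have "\<exists>Y. norm Y < 1/4 \<and> psi (?\<tau> t) Y = q" if t: "t \<in> {0..2*pi}" for t
    proof -
      \<comment> \<open>The value that Y + w must take for psi to keep its initial value: the frame
        at the start divided by the frame at time t, bounded by K' over the whole turn.\<close>
      define z where "z = (\<chi> i. E \<tau>0 i / E (?\<tau> t) i * (y0 + w \<tau>0 y0) $ i)"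
      have "norm (y0 + w \<tau>0 y0) \<le> 9/8 * norm y0" using w_small[OF \<tau>0S y01] norm_triangle_ineq[of y0 "w \<tau>0 y0"] by linarith
      then have n: "norm (y0 + w \<tau>0 y0) \<le> 9/8 * \<delta>" using y0 by linarith
      have "cmod (z $ i) \<le> K' * (9/8 * \<delta>)" for i
        unfolding z_def vec_lambda_beta norm_mult
        using order_trans[OF K[OF t] KK[of i]] n K'1 Finite_Cartesian_Product.norm_nth_le[of "y0 + w \<tau>0 y0" i]
        by (intro mult_mono) (auto intro: order_trans)
      then have "norm z \<le> real CARD('n) * (K' * (9/8 * \<delta>))" by (rule norm_vec_le_card)
      also have "\<dots> = 9/128 * (16 * (real CARD('n) * K') * \<delta>)" by simp
      also have "\<dots> < 1/8" unfolding \<delta>(3) by simp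
      finally obtain Y where Y: "norm Y < 1/4" "Y + w (?\<tau> t) Y = z" using solve_near_identity[OF S[OF t]] by blast
      have "psi (?\<tau> t) Y = q" unfolding psi_def Y(2) q_def z_def using E_nz by (simp add: vec_eq_iff)
      with Y(1) show ?thesis by blast
    qed
    then obtain y where y: "\<And>t. t \<in> {0..2*pi} \<Longrightarrow> norm (y t) < 1/4 \<and> psi (?\<tau> t) (y t) = q" by metis
    let ?A = "S \<times> (ball 0 (1/2) :: (complex^'n) set)"
    let ?\<Theta> = "\<lambda>p. (fst p, psi (fst p) (snd p))"
    have inj: "inj_on ?\<Theta> ?A" by (rule inj_onI) (auto simp: prod_eq_iff mem_Times_iff intro: psi_inj)
    have y_eq: "y t = snd (inv_into ?A ?\<Theta> (?\<tau> t, q))" if t: "t \<in> {0..2*pi}" for t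
    proof -
      have "(?\<tau> t, y t) \<in> ?A" using S[OF t] y[OF t] by auto
      from inv_into_f_f[OF inj this] show ?thesis using y[OF t] by simp
    qed
    have "y 0 = y0" using psi_inj[OF \<tau>0S _ y01, of "y 0"] y[of 0] by (simp add: q_def)
    moreover have "(y has_vector_derivative \<i> *s F (?\<tau> t) (y t)) (at t within {0..2*pi})" if t: "t \<in> {0..2*pi}" for t
    proof -
      have p: "(?\<tau> t, y t) \<in> ?A" using S[OF t] y[OF t] by auto
      have yt: "norm (y t) < 1/2" "norm (y t) < 1" using y[OF t] by auto
      note inv = Theta_inverse[OF p, simplified fst_conv snd_conv, unfolded conjunct2[OF y[OF t]]]
      have "((\<lambda>t. (?\<tau> t, q)) has_derivative (\<lambda>h. (\<i> * of_real h, 0))) (at t within {0..2*pi})"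
        by (auto intro!: derivative_eq_intros)
      from has_derivative_snd[OF has_derivative_compose[OF this inv]]
      obtain D where D: "((\<lambda>t. snd (inv_into ?A ?\<Theta> (?\<tau> t, q))) has_derivative D) (at t within {0..2*pi})" by blast
      have "(y has_derivative D) (at t within {0..2*pi})"
        by (rule has_derivative_transform[OF t _ D]) (use y_eq in auto)
      moreover have "D h = h *\<^sub>R D 1" for h using linear_cmul[OF has_derivative_linear[OF D], of h 1] by simp
      ultimately have yd: "(y has_vector_derivative D 1) (at t within {0..2*pi})"
        unfolding has_vector_derivative_def by (metis (no_types, lifting) HOL.ext)
      have "((\<lambda>t. psi (?\<tau> t) (y t)) has_vector_derivative Dpsi (?\<tau> t) (y t) (\<i>, D 1)) (at t within {0..2*pi})"
        by (rule psi_path_deriv[OF S[OF t] yt(2) yd])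
      moreover have "((\<lambda>t. psi (?\<tau> t) (y t)) has_vector_derivative 0) (at t within {0..2*pi})"
        by (rule has_vector_derivative_transform[OF t _ has_vector_derivative_const[of q]]) (use y in auto)
      ultimately have "Dpsi (?\<tau> t) (y t) (\<i>, D 1) = 0"
        using t pi_gt_zero by (intro vector_derivative_unique_within[where x = t and S = "{0..2*pi}"])
          (auto simp: trivial_limit_within intro!: islimpt_Icc[THEN iffD2])
      then have "D 1 = \<i> *s F (?\<tau> t) (y t)" using Dpsi_eq_0_iff[OF S[OF t] yt(1)] by blast
      with yd show ?thesis by simp
    qed
    ultimately show ?thesis using y by blast
  qed
  then show thesis using that[of \<delta>] \<delta> by auto
qed

text \<open>w vanishes identically on Y = 0, hence so does its \<tau>-derivative, and
  \<open>cvec\<close> is zero there.\<close>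

lemma F_0: assumes "\<tau> \<in> S" shows "F \<tau> 0 = 0"
proof -
  have "\<forall>\<^sub>F z in nhds 0. w (\<tau> + z) 0 $ i = 0" for i
  proof -
    have "open ((\<lambda>z. \<tau> + z) -` S)" by (intro open_vimage continuous_intros open_strip)
    then have "\<forall>\<^sub>F z in nhds 0. z \<in> (\<lambda>z. \<tau> + z) -` S" using assms by (intro eventually_nhds_in_open) auto
    then show ?thesis by (rule eventually_mono) (use w_0 in auto)
  qed
  then have "deriv (\<lambda>z. w (\<tau> + z) 0 $ i) 0 = deriv (\<lambda>z. 0) 0" for i by (intro deriv_cong_ev) auto
  then have "cvec \<tau> 0 = 0" using w_0[OF assms] by (simp add: cvec_def Dw_def ddir_def cscale_def vec_eq_iff)
  then show ?thesis using F_iff[OF assms, of 0 0] by simp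
qed

lemma G_axis: "G (x, 0) = 0"
proof -
  have "Gh \<tau> 0 = 0" if "\<tau> \<in> S" for \<tau> using F_0[OF that] by (simp add: Gh_def vec_eq_iff)
  then show ?thesis using Lg(4)[of x] S1_subset by (auto simp: G_def)
qed

text \<open>G vanishes on both Y = 0 and x = 0, which together span all directions at the
  origin.\<close>

lemma G_has_derivative_0: "(G has_derivative (\<lambda>_. 0)) (at 0)"
proof -
  let ?U = "ball 0 1 \<times> ball 0 (1/2) :: (complex \<times> (complex^'n)) set"
  have U: "open ?U" "0 \<in> ?U" by (auto intro: open_Times simp: zero_prod_def)
  have "ddir (\<lambda>p. G p $ i) 0 v = 0" for i v
  proof -
    have "ddir (\<lambda>p. G p $ i) 0 v = ddir (\<lambda>p. G p $ i) 0 (fst v, 0) + ddir (\<lambda>p. G p $ i) 0 (0, snd v)"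
      using ddir_add[OF U(1) ghol_G U(2), of i "(fst v, 0)" "(0, snd v)"] by simp
    moreover have "ddir (\<lambda>p. G p $ i) 0 (fst v, 0) = 0"
      unfolding ddir_def by (simp add: cscale_def G_axis)
    moreover have "ddir (\<lambda>p. G p $ i) 0 (0, snd v) = 0"
      unfolding ddir_def by (simp add: cscale_def G_def)
    ultimately show ?thesis by simp
  qed
  then have "(\<lambda>v. \<chi> i. ddir (\<lambda>p. G p $ i) 0 v) = (\<lambda>_. 0)" by (simp add: fun_eq_iff vec_eq_iff)
  then show ?thesis using ghol_vec_has_derivative[OF U(1) ghol_G U(2)] by simp
qed

end

section \<open>Triangularization and germs of biholomorphisms\<close>

text \<open>Schur decomposition, transported to matrices indexed by a finite type. The enumeration
  \<open>nu\<close> is part of the result because the weights must increase along the triangular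
  order.\<close>

lemma triangularization:
  fixes L :: "complex^'n^'n"
  obtains P Q T :: "complex^'n^'n" and nu :: "'n \<Rightarrow> nat"
  where "P ** Q = Finite_Cartesian_Product.mat 1" "Q ** P = Finite_Cartesian_Product.mat 1" "L = P ** T ** Q"
    "inj nu" "\<And>i. nu i < CARD('n)" "\<And>i j. nu j < nu i \<Longrightarrow> T $ i $ j = 0"
    "\<And>i. invertible L \<Longrightarrow> T $ i $ i \<noteq> 0"
proof -
  let ?n = "CARD('n)"
  obtain nu :: "'n \<Rightarrow> nat" where bij: "bij_betw nu UNIV {0..<?n}"
    using ex_bij_betw_finite_nat[of "UNIV :: 'n set"] by auto
  then have inj: "inj nu" and lt: "nu i < ?n" for i
    by (auto simp: bij_betw_def)
  define rk where "rk = inv_into UNIV nu"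
  have rk_inv: "rk (nu i) = i" for i using inj by (simp add: rk_def)
  have inv_rk: "nu (rk k) = k" if "k < ?n" for k
    using bij that unfolding rk_def bij_betw_def by (metis atLeastLessThan_iff f_inv_into_f le0)
  \<comment> \<open>Transport along \<open>nu\<close>; it respects products and the
    identity.\<close>
  define V :: "complex Matrix.mat \<Rightarrow> complex^'n^'n" where "V M = (\<chi> i j. M $$ (nu i, nu j))" for M
  have Vmult: "V (M * N) = V M ** V N" if "M \<in> carrier_mat ?n ?n" "N \<in> carrier_mat ?n ?n" for M N
  proof -
    have "(\<Sum>k = 0..<?n. M $$ (nu i, k) * N $$ (k, nu j)) = (\<Sum>k\<in>UNIV. M $$ (nu i, nu k) * N $$ (nu k, nu j))" for i j
      using sum.reindex_bij_betw[OF bij, of "\<lambda>k. M $$ (nu i, k) * N $$ (k, nu j)"] by simp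
    moreover have "(M * N) $$ (nu i, nu j) = (\<Sum>k = 0..<?n. M $$ (nu i, k) * N $$ (k, nu j))" for i j
      using that lt[of i] lt[of j] by (auto simp: scalar_prod_def intro!: sum.cong)
    ultimately show ?thesis by (simp add: V_def matrix_matrix_mult_def vec_eq_iff)
  qed
  have V1: "V (1\<^sub>m ?n) = Finite_Cartesian_Product.mat 1"
    using lt inj by (auto simp: V_def Finite_Cartesian_Product.mat_def vec_eq_iff inj_eq)
  define A where "A = Matrix.mat ?n ?n (\<lambda>(i, j). L $ rk i $ rk j)"
  have A: "A \<in> carrier_mat ?n ?n" by (simp add: A_def)
  have VA: "V A = L" using lt rk_inv by (simp add: V_def A_def vec_eq_iff)
  obtain as where "char_poly A = (\<Prod>a\<leftarrow>as. [:- a, 1:])" using char_poly_factorized[OF A] by blast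
  from schur_decomposition_exists[OF A this]
  obtain B where B: "B \<in> carrier_mat ?n ?n" "upper_triangular B" "similar_mat A B" by blast
  then obtain P Q where "similar_mat_wit A B P Q" by (auto simp: similar_mat_def)
  then have PQ: "P \<in> carrier_mat ?n ?n" "Q \<in> carrier_mat ?n ?n" "P * Q = 1\<^sub>m ?n" "Q * P = 1\<^sub>m ?n" "A = P * B * Q"
    using A by (auto simp: similar_mat_wit_def Let_def)
  show thesis
  proof (rule that[of "V P" "V Q" "V B" nu])
    show "V P ** V Q = Finite_Cartesian_Product.mat 1" "V Q ** V P = Finite_Cartesian_Product.mat 1"
      using Vmult PQ V1 by metis+
    show "L = V P ** V B ** V Q"
      using Vmult[of "P * B" Q] Vmult[of P B] PQ B VA by (metis mult_carrier_mat)
    show "V B $ i $ j = 0" if "nu j < nu i" for i j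
      using B(1,2) lt that by (auto simp: V_def upper_triangular_def)
    show "V B $ i $ i \<noteq> 0" if L: "invertible L" for i
    proof -
      obtain L' where L': "L ** L' = Finite_Cartesian_Product.mat 1" using L by (auto simp: invertible_def)
      \<comment> \<open>A right inverse of the triangular factor. Transported back as N, it makes
        the determinant of B, which is the product of the diagonal entries, nonzero.\<close>
      define X where "X = V Q ** L' ** V P"
      define N where "N = Matrix.mat ?n ?n (\<lambda>(i, j). X $ rk i $ rk j)"
      have N: "N \<in> carrier_mat ?n ?n" "V N = X" using lt rk_inv by (simp_all add: V_def N_def vec_eq_iff)
      have VV: "V P ** V Q = Finite_Cartesian_Product.mat 1" "V Q ** V P = Finite_Cartesian_Product.mat 1"
        using Vmult PQ V1 by metis+
      have "V B = V Q ** L ** V P"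
      proof -
        have "L = V P ** V B ** V Q"
          using Vmult[of "P * B" Q] Vmult[of P B] PQ B VA by (metis mult_carrier_mat)
        then have "V Q ** L ** V P = (V Q ** V P) ** V B ** (V Q ** V P)" by (simp only: matrix_mul_assoc)
        then show ?thesis using VV by (simp add: matrix_mul_lid matrix_mul_rid)
      qed
      then have "V B ** X = V Q ** (L ** (V P ** V Q) ** L') ** V P" by (simp only: X_def matrix_mul_assoc)
      also have "\<dots> = Finite_Cartesian_Product.mat 1" using VV L' by (simp add: matrix_mul_lid matrix_mul_rid)
      finally have BX: "V (B * N) = Finite_Cartesian_Product.mat 1" using Vmult[OF B(1) N(1)] N(2) by simp
      have "B * N = 1\<^sub>m ?n"
      proof (rule eq_matI)
        fix i j assume "i < dim_row (1\<^sub>m ?n :: complex Matrix.mat)" "j < dim_col (1\<^sub>m ?n :: complex Matrix.mat)"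
        then have ij: "i < ?n" "j < ?n" by auto
        have "V (B * N) $ rk i $ rk j = (B * N) $$ (i, j)" using inv_rk ij by (simp add: V_def)
        moreover have "rk i = rk j \<longleftrightarrow> i = j" using inv_rk ij by metis
        ultimately show "(B * N) $$ (i, j) = 1\<^sub>m ?n $$ (i, j)"
          using ij unfolding BX by (simp add: Finite_Cartesian_Product.mat_def)
      qed (use B(1) N(1) in auto)
      then have "Determinant.det B * Determinant.det N = 1"
        using det_mult[OF B(1) N(1)] by (simp add: Determinant.det_one)
      then have "prod_list (diag_mat B) \<noteq> 0"
        unfolding det_upper_triangular[OF B(2,1)] by (metis mult_zero_left zero_neq_one)
      then have "B $$ (nu i, nu i) \<noteq> 0" using B(1) lt[of i] by (auto simp: prod_list_zero_iff diag_mat_def)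
      then show ?thesis by (simp add: V_def)
    qed
  qed (use inj lt in auto)
qed

lemma complex_linear_matrix:
  fixes L :: "complex^'n \<Rightarrow> complex^'m"
  assumes "linear L" "\<And>c v. L (c *s v) = c *s L v"
  shows "L = (\<lambda>v. (\<chi> i j. L (axis j 1) $ i) *v v)"
proof
  fix v :: "complex^'n"
  have "v = (\<Sum>j\<in>UNIV. (v $ j) *s axis j 1)"
    by (simp add: vec_eq_iff axis_def if_distrib sum.delta cong: if_cong)
  then have "L v = (\<Sum>j\<in>UNIV. (v $ j) *s L (axis j 1))"
    using linear_sum[OF assms(1), of "\<lambda>j. (v $ j) *s axis j 1" UNIV] assms(2) by simp
  then show "L v = (\<chi> i j. L (axis j 1) $ i) *v v"
    by (simp add: vec_eq_iff matrix_vector_mult_def mult.commute)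
qed

text \<open>Invariance of domain makes the image open, and the inverse of a bijective complex linear
  derivative is complex linear.\<close>

lemma biholo_germI:
  fixes f :: "complex^'n \<Rightarrow> complex^'n"
  assumes U: "open U" "0 \<in> U" "f 0 = 0" "inj_on f U"
    and D: "\<And>z. z \<in> U \<Longrightarrow> \<exists>L. (f has_derivative L) (at z) \<and> (\<forall>c v. L (c *s v) = c *s L v) \<and> inj L"
  shows "biholo_germ f"
proof -
  have cont: "continuous_on U f"
    using D by (meson continuous_at_imp_continuous_on has_derivative_continuous)
  have "holo_vec U f" using D unfolding holo_vec_def by blast
  moreover have "open (f ` U)" using invariance_of_domain[OF cont U(1,4)] .
  moreover have "holo_vec (f ` U) (inv_into U f)"
    unfolding holo_vec_def
  proof
    fix y assume "y \<in> f ` U"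
    then obtain z where z: "z \<in> U" "y = f z" by blast
    obtain L where L: "(f has_derivative L) (at z)" "\<And>c v. L (c *s v) = c *s L v" "inj L" using D[OF z(1)] by blast
    have lin: "linear L" using has_derivative_linear[OF L(1)] .
    have bij: "bij L" using linear_injective_imp_surjective[OF lin L(3)] L(3) by (simp add: bij_def)
    have id: "L \<circ> inv_into UNIV L = id" using bij unfolding bij_def surj_iff by blast
    have "(inv_into U f has_derivative inv_into UNIV L) (at (f z))"
      by (rule has_derivative_inverse_strong[OF U(1) z(1) cont _ L(1) id]) (rule inv_into_f_f[OF U(4)])
    moreover have "inv_into UNIV L (c *s v) = c *s inv_into UNIV L v" for c v
    proof -
      have "L (c *s inv_into UNIV L v) = c *s v" using L(2) bij by (simp add: bij_is_surj surj_f_inv_f)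
      then show ?thesis using bij by (metis bij_inv_eq_iff)
    qed
    ultimately show "\<exists>L. (inv_into U f has_derivative L) (at y) \<and> (\<forall>c v. L (c *s v) = c *s L v)"
      using z(2) by blast
  qed
  ultimately show ?thesis using U unfolding biholo_germ_def by blast
qed

lemma biholo_germ_local_inverse:
  fixes h :: "complex^'n \<Rightarrow> complex^'n"
  assumes "biholo_germ h"
  obtains V g \<Lambda> where "open V" "0 \<in> V" "holo_vec V g" "g 0 = 0" "(g has_derivative (\<lambda>v. \<Lambda> *v v)) (at 0)"
    "invertible \<Lambda>" "\<And>z. z \<in> V \<Longrightarrow> h (g z) = z"
proof -
  obtain U where U: "h 0 = 0" "open U" "0 \<in> U" "holo_vec U h" "inj_on h U" "open (h ` U)" "holo_vec (h ` U) (inv_into U h)"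
    using assms unfolding biholo_germ_def by blast
  let ?g = "inv_into U h"
  have V0: "0 \<in> h ` U" using U(1,3) by force
  have g0: "?g 0 = 0" using inv_into_f_f[OF U(5,3)] U(1) by simp
  have hg: "h (?g z) = z" if "z \<in> h ` U" for z using that by (rule f_inv_into_f)
  obtain L where L: "(?g has_derivative L) (at 0)" "\<And>c v. L (c *s v) = c *s L v"
    using U(7) V0 unfolding holo_vec_def by blast
  obtain L' where L': "(h has_derivative L') (at (?g 0))" using U(3,4) g0 unfolding holo_vec_def by auto
  have "((\<lambda>z. h (?g z)) has_derivative (\<lambda>v. L' (L v))) (at 0)" by (rule has_derivative_compose[OF L(1) L'])
  then have "((\<lambda>z. z) has_derivative (\<lambda>v. L' (L v))) (at 0)"
    by (rule has_derivative_transform_within_open[OF _ U(6) V0]) (rule hg)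
  then have id: "(\<lambda>v. L' (L v)) = (\<lambda>v. v)" using has_derivative_ident has_derivative_unique by blast
  define \<Lambda> where "\<Lambda> = (\<chi> i j. L (axis j 1) $ i)"
  have L\<Lambda>: "L = (\<lambda>v. \<Lambda> *v v)" unfolding \<Lambda>_def
    by (rule complex_linear_matrix[OF has_derivative_linear[OF L(1)] L(2)])
  have "L' 0 = 0" using has_derivative_linear[OF L'] by (rule linear_0)
  then have "v = 0" if "\<Lambda> *v v = 0" for v using fun_cong[OF id, of v] that by (simp add: L\<Lambda>)
  then have "invertible \<Lambda>" using matrix_left_invertible_ker[of \<Lambda>] invertible_left_inverse[of \<Lambda>] by blast
  then show thesis using that[of "h ` U" ?g \<Lambda>] U(6,7) V0 g0 L(1) hg unfolding L\<Lambda> by blast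
qed

section \<open>Assembling the foliation with holonomy h\<close>

theorem theorem1:
  fixes h :: "complex^'n \<Rightarrow> complex^'n"
  assumes "biholo_germ h"
  shows "\<exists>(A :: complex^'n^'n) (G :: complex \<times> (complex^'n) \<Rightarrow> complex^'n) r x0 H.
           0 < r \<and> holo_pair (ball 0 r) G \<and>
           (\<forall>x. (x, 0) \<in> ball 0 r \<longrightarrow> G (x, 0) = 0) \<and>
           (G has_derivative (\<lambda>_. 0)) (at 0) \<and>
           x0 \<noteq> 0 \<and> cmod x0 < r \<and>
           is_holonomy A G (ball 0 r) x0 H \<and> holo_conj H h"
proof -
  obtain V g \<Lambda> where g: "open V" "0 \<in> V" "holo_vec V g" "g 0 = 0" "(g has_derivative (\<lambda>v. \<Lambda> *v v)) (at 0)"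
    "invertible \<Lambda>" "\<And>z. z \<in> V \<Longrightarrow> h (g z) = z"
    by (rule biholo_germ_local_inverse[OF assms]) (rule that)
  obtain P Q T :: "complex^'n^'n" and nu :: "'n \<Rightarrow> nat"
    where PQ: "P ** Q = Finite_Cartesian_Product.mat 1" "Q ** P = Finite_Cartesian_Product.mat 1" "\<Lambda> = P ** T ** Q"
    and nu: "inj nu" "\<And>i. nu i < CARD('n)" and tri: "\<And>i j. nu j < nu i \<Longrightarrow> T $ i $ j = 0"
    and diag: "\<And>i. invertible \<Lambda> \<Longrightarrow> T $ i $ i \<noteq> 0"
    by (rule triangularization[of \<Lambda>]) (rule that)
  have PQv: "P *v (Q *v v) = v" "Q *v (P *v v) = v" for v
    using PQ by (simp_all add: matrix_vector_mul_assoc)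
  note bl = matrix_vector_mul_bounded_linear
  \<comment> \<open>The local inverse g in the coordinates in which its linear part is the
    triangular T.\<close>
  define g1 where "g1 y = Q *v g (P *v y)" for y
  have "open ((\<lambda>y. P *v y) -` V)"
    by (intro open_vimage g(1) linear_continuous_on bl)
  moreover have "0 \<in> (\<lambda>y. P *v y) -` V" using g(2) by simp
  ultimately obtain \<rho> where \<rho>: "0 < \<rho>" "ball 0 \<rho> \<subseteq> (\<lambda>y. P *v y) -` V" by (meson openE)
  have g1_deriv: "(g1 has_derivative (\<lambda>v. Q *v L (P *v v))) (at y)" if "(g has_derivative L) (at (P *v y))" for y L
  proof -
    have "((\<lambda>y. P *v y) has_derivative (\<lambda>v. P *v v)) (at y)" by (rule bounded_linear_imp_has_derivative[OF bl])
    from has_derivative_compose[OF this that] show ?thesis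
      unfolding g1_def[abs_def] by (rule bounded_linear.has_derivative[OF bl])
  qed
  have g1: "holo_vec (ball 0 \<rho>) g1"
    unfolding holo_vec_def
  proof
    fix y :: "complex^'n" assume "y \<in> ball 0 \<rho>"
    then have "P *v y \<in> V" using \<rho>(2) by blast
    then obtain L where L: "(g has_derivative L) (at (P *v y))" "\<And>c v. L (c *s v) = c *s L v"
      using g(3) unfolding holo_vec_def by blast
    show "\<exists>L. (g1 has_derivative L) (at y) \<and> (\<forall>c v. L (c *s v) = c *s L v)"
      using g1_deriv[OF L(1)] L(2) by (intro exI conjI) (auto simp: vector_scalar_commute)
  qed
  have g10: "g1 0 = 0" by (simp add: g1_def g(4))
  have "(g has_derivative (\<lambda>v. \<Lambda> *v v)) (at (P *v 0))" using g(5) by simp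
  from g1_deriv[OF this] have "(g1 has_derivative (\<lambda>v. Q *v (\<Lambda> *v (P *v v)))) (at 0)" .
  moreover have "Q *v (\<Lambda> *v (P *v v)) = T *v v" for v
    unfolding PQ(3) matrix_vector_mul_assoc[symmetric] PQv ..
  ultimately have g1T: "(g1 has_derivative (\<lambda>v. T *v v)) (at 0)" by simp
  define \<eta> where "\<eta> = 1 / (16 * real CARD('n))"
  have \<eta>: "0 < \<eta>" "real CARD('n) * \<eta> \<le> 1/16" by (simp_all add: \<eta>_def)
  obtain \<mu> and w :: "complex \<Rightarrow> complex^'n \<Rightarrow> complex^'n" where \<mu>: "0 < \<mu>"
    and w: "\<And>i. ghol (strip (-1/4) (2 * pi + 1/4) \<times> ball 0 1) (\<lambda>p. w (fst p) (snd p) $ i)"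
    "\<And>\<tau> Y i. \<tau> \<in> strip (-1/4) (2 * pi + 1/4) \<Longrightarrow> norm Y < 1 \<Longrightarrow> cmod (w \<tau> Y $ i) \<le> \<eta> * min 1 (exp (Re \<tau>))"
    "\<And>\<tau>. \<tau> \<in> strip (-1/4) (2 * pi + 1/4) \<Longrightarrow> w \<tau> 0 = 0"
    "\<And>\<tau> Y. \<bar>Im \<tau>\<bar> < 1/4 \<Longrightarrow> norm Y < 1 \<Longrightarrow>
       norm (\<chi> i. frame nu T \<mu> \<tau> i * (Y + w \<tau> Y) $ i) < \<rho> \<and>
       (\<chi> i. frame nu T \<mu> (\<tau> + 2 * of_real pi * \<i>) i * (Y + w (\<tau> + 2 * of_real pi * \<i>) Y) $ i) =
         g1 (\<chi> i. frame nu T \<mu> \<tau> i * (Y + w \<tau> Y) $ i)"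
    by (rule suspension_trivialization[OF g1 \<rho>(1) g10 g1T tri nu diag[OF g(6)] \<eta>(1)], assumption) (rule that)
  define b where "b i = of_nat (weight nu i) + bexp T i" for i
  have E_deriv: "((\<lambda>\<tau>. frame nu T \<mu> \<tau> i) has_field_derivative
      frame nu T \<mu> \<tau> i * (b i - of_nat (weight nu i) * exp \<tau>)) (at \<tau>)" for i \<tau>
    using frame_deriv[of nu T \<mu> i \<tau>] by (simp add: b_def algebra_simps)
  interpret suspension w "frame nu T \<mu>" b "\<lambda>i. of_nat (weight nu i)" g1 \<rho> \<eta>
    by unfold_locales (use w frame_nonzero[OF \<mu>, of nu T] E_deriv g1 \<eta> in auto)
  \<comment> \<open>The sign comes from following level sets: where the frame grows like x^b, a leaf
    behaves like x^(-b).\<close>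
  define A :: "complex^'n^'n" where "A = (\<chi> i j. if i = j then - b i else 0)"
  have A: "A *v Y = (\<chi> i. - b i * Y $ i)" for Y
    by (simp add: A_def matrix_vector_mult_def vec_eq_iff if_distrib[of "\<lambda>x. x * _"] sum.delta cong: if_cong)
  \<comment> \<open>The base point is x0 = 1/4: with leaves of norm below 1/4 the whole path stays
    in the ball of radius 1/2.\<close>
  define \<tau>0 where "\<tau>0 = complex_of_real (ln (1/4))"
  have \<tau>0: "Im \<tau>0 = 0" "exp \<tau>0 = 1/4" by (simp_all add: \<tau>0_def exp_of_real)
  have \<tau>0S: "\<tau>0 \<in> S" using \<tau>0(1) pi_gt3 by (auto simp: strip_def)
  have field: "A *v Y + G (1/4 * exp (\<i> * of_real t), Y) = F (\<tau>0 + \<i> * of_real t) Y"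
    if "t \<in> {0..2*pi}" "norm Y < 1/2" for t Y
  proof -
    have "\<tau>0 + \<i> * of_real t \<in> S1" using \<tau>0(1) that(1) by (auto simp: strip_def)
    from G_exp[OF this that(2)] have "G (1/4 * exp (\<i> * of_real t), Y) = Gh (\<tau>0 + \<i> * of_real t) Y"
      by (simp add: exp_add \<tau>0(2))
    then show ?thesis by (simp add: A Gh_def vec_eq_iff)
  qed
  obtain \<delta> where \<delta>: "0 < \<delta>" "\<delta> \<le> 1/2" "\<And>y0. norm y0 < \<delta> \<Longrightarrow> \<exists>y. y 0 = y0 \<and> (\<forall>t\<in>{0..2*pi}. norm (y t) < 1/4 \<and>
    (y has_vector_derivative \<i> *s F (\<tau>0 + \<i> * of_real t) (y t)) (at t within {0..2*pi}))"
    by (rule leaf_exists[OF \<tau>0(1)]) (rule that)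
  define \<phi> where "\<phi> Y = P *v psi \<tau>0 Y" for Y
  have \<phi>_inj: "Y = Y'" if "norm Y < 1/2" "norm Y' < 1/2" "\<phi> Y = \<phi> Y'" for Y Y'
    using psi_inj[OF \<tau>0S that(1,2)] that(3) PQv(2) unfolding \<phi>_def by metis
  \<comment> \<open>The holonomy is h read in the chart \<phi>. The point is unique by
    \<open>\<phi>_inj\<close>; for small \<open>y0\<close> it exists as the endpoint of the leaf
    constructed in \<open>path_ex\<close>.\<close>
  define H where "H y0 = (THE Y. norm Y < 1/2 \<and> \<phi> Y = h (\<phi> y0))" for y0
  have path: "y (2 * pi) = H y0 \<and> \<phi> (H y0) = h (\<phi> y0)"
    if hp: "hol_path A G (ball 0 (1/2)) (1/4) y0 y" for y0 y
  proof -
    have in_ball: "norm (y t) < 1/2" if "t \<in> {0..2*pi}" for t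
    proof -
      have "norm (1/4 * exp (\<i> * complex_of_real t), y t) < 1/2" using hp that by (auto simp: hol_path_def)
      then show ?thesis using norm_snd_le[of "y t" "1/4 * exp (\<i> * complex_of_real t)"] by linarith
    qed
    have yd: "(y has_vector_derivative \<i> *s F (\<tau>0 + \<i> * of_real t) (y t)) (at t within {0..2*pi})" if "t \<in> {0..2*pi}" for t
    proof -
      have "(y has_vector_derivative \<i> *s (A *v y t + G (1/4 * exp (\<i> * of_real t), y t))) (at t within {0..2*pi})"
        using hp that unfolding hol_path_def by blast
      then show ?thesis by (simp only: field[OF that in_ball[OF that]])
    qed
    define Y where "Y = y (2 * pi)"
    have Y: "norm Y < 1/2" using in_ball[of "2 * pi"] by (simp add: Y_def)
    \<comment> \<open>Conservation along the leaf meets the gluing relation: g maps \<phi> of the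
      endpoint to \<phi> of the start, and applying h reverses this.\<close>
    have "psi (\<tau>0 + 2 * of_real pi * \<i>) Y = psi \<tau>0 y0"
      using leaf_constant[OF \<tau>0(1) in_ball yd] hp by (simp add: Y_def hol_path_def)
    moreover have per: "norm (psi \<tau>0 Y) < \<rho>" "psi (\<tau>0 + 2 * of_real pi * \<i>) Y = g1 (psi \<tau>0 Y)"
      using psi_period[of \<tau>0 Y] \<tau>0(1) Y by auto
    ultimately have "Q *v g (\<phi> Y) = psi \<tau>0 y0" by (simp add: g1_def \<phi>_def)
    then have "g (\<phi> Y) = \<phi> y0" using PQv(1) unfolding \<phi>_def by metis
    moreover have "\<phi> Y \<in> V" using per(1) \<rho>(2) by (auto simp: \<phi>_def)
    ultimately have eq: "\<phi> Y = h (\<phi> y0)" using g(7) by metis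
    then have "H y0 = Y" unfolding H_def using Y \<phi>_inj by (intro the_equality) auto
    then show ?thesis using eq by (simp add: Y_def)
  qed
  have path_ex: "\<exists>y. hol_path A G (ball 0 (1/2)) (1/4) y0 y" if y0: "norm y0 < \<delta>" for y0
  proof -
    obtain y where y: "y 0 = y0" "\<And>t. t \<in> {0..2*pi} \<Longrightarrow> norm (y t) < 1/4"
      "\<And>t. t \<in> {0..2*pi} \<Longrightarrow> (y has_vector_derivative \<i> *s F (\<tau>0 + \<i> * of_real t) (y t)) (at t within {0..2*pi})"
      using \<delta>(3)[OF y0] by blast
    have inb: "norm (1/4 * exp (\<i> * complex_of_real t), y t) < 1/2" if t: "t \<in> {0..2*pi}" for t
    proof -
      have "norm (1/4 * exp (\<i> * complex_of_real t), y t) \<le> norm (1/4 * exp (\<i> * complex_of_real t)) + norm (y t)"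
        by (rule norm_Pair_le)
      also have "norm (1/4 * exp (\<i> * complex_of_real t)) = 1/4" by (simp add: norm_mult)
      finally show ?thesis using y(2)[OF t] by linarith
    qed
    have der: "\<i> *s (A *v y t + G (1/4 * exp (\<i> * of_real t), y t)) = \<i> *s F (\<tau>0 + \<i> * of_real t) (y t)"
      if t: "t \<in> {0..2*pi}" for t
    proof -
      have "norm (y t) < 1/2" using y(2)[OF t] by linarith
      then show ?thesis by (simp only: field[OF t])
    qed
    have "hol_path A G (ball 0 (1/2)) (1/4) y0 y"
      unfolding hol_path_def
    proof (intro conjI ballI)
      fix t :: real assume t: "t \<in> {0..2*pi}"
      show "(1/4 * exp (\<i> * complex_of_real t), y t) \<in> ball 0 (1/2)" using inb[OF t] by (simp only: mem_ball_0)
      show "(y has_vector_derivative \<i> *s (A *v y t + G (1/4 * exp (\<i> * complex_of_real t), y t))) (at t within {0..2*pi})"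
        unfolding der[OF t] by (rule y(3)[OF t])
    qed (rule y(1))
    then show ?thesis by blast
  qed
  have hol: "is_holonomy A G (ball 0 (1/2)) (1/4) H"
    unfolding is_holonomy_def
    by (rule exI[of _ "ball 0 \<delta>"]) (use \<delta>(1) path path_ex in auto)
  have \<phi>: "biholo_germ \<phi>"
  proof (rule biholo_germI)
    show "open (ball (0 :: complex^'n) (1/2))" "(0 :: complex^'n) \<in> ball 0 (1/2)" by auto
    show "\<phi> 0 = 0" by (simp add: \<phi>_def psi_0[OF \<tau>0S])
    show "inj_on \<phi> (ball 0 (1/2))" by (rule inj_onI) (use \<phi>_inj in auto)
    fix Y :: "complex^'n" assume "Y \<in> ball 0 (1/2)"
    then have Y: "norm Y < 1/2" "norm Y < 1" by auto
    let ?L = "\<lambda>u. P *v Dpsi \<tau>0 Y (0, u)"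
    have "((\<lambda>Y. (\<tau>0, Y)) has_derivative (\<lambda>u. (0, u))) (at Y)" by (auto intro!: derivative_eq_intros)
    from has_derivative_compose[OF this psi_has_derivative[OF \<tau>0S Y(2)]]
    have "((\<lambda>Y. psi \<tau>0 Y) has_derivative (\<lambda>u. Dpsi \<tau>0 Y (0, u))) (at Y)" by simp
    then have L: "(\<phi> has_derivative ?L) (at Y)"
      unfolding \<phi>_def[abs_def] by (rule bounded_linear.has_derivative[OF bl])
    have "Dpsi \<tau>0 Y (0, c *s u) = c *s Dpsi \<tau>0 Y (0, u)" for c u
      by (simp add: Dpsi_def vec_eq_iff vector_scalar_commute)
    then have "\<forall>c u. ?L (c *s u) = c *s ?L u" by (simp add: vector_scalar_commute)
    moreover have "inj ?L"
    proof (subst linear_injective_0[OF has_derivative_linear[OF L]], intro allI impI)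
      fix u assume "?L u = 0"
      then have "Dpsi \<tau>0 Y (0, u) = 0" using PQv(2)[of "Dpsi \<tau>0 Y (0, u)"] by simp
      then show "u = 0" using Dpsi_eq_0_iff[OF \<tau>0S Y(1), of 0 u] by simp
    qed
    ultimately show "\<exists>L. (\<phi> has_derivative L) (at Y) \<and> (\<forall>c v. L (c *s v) = c *s L v) \<and> inj L" using L by blast
  qed
  have conj: "holo_conj H h"
    unfolding holo_conj_def
    by (rule exI[of _ \<phi>], rule conjI[OF \<phi>], rule exI[of _ "ball 0 \<delta>"]) (use \<delta>(1) path path_ex in fastforce)
  have sub: "ball 0 (1/2) \<subseteq> (ball 0 1 \<times> ball 0 (1/2) :: (complex \<times> (complex^'n)) set)"
  proof
    fix p :: "complex \<times> (complex^'n)" assume "p \<in> ball 0 (1/2)"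
    then show "p \<in> ball 0 1 \<times> ball 0 (1/2)"
      using norm_fst_le[of "fst p" "snd p"] norm_snd_le[of "snd p" "fst p"] by (auto simp: mem_Times_iff)
  qed
  have "holo_pair (ball 0 (1/2)) G"
    by (rule ghol_vec_imp_holo_pair[OF open_ball ghol_subset[OF ghol_G sub]])
  then show ?thesis
    using G_axis G_has_derivative_0 hol conj
    by (intro exI[of _ A] exI[of _ G] exI[of _ "1/2"] exI[of _ "1/4"] exI[of _ H]) (simp add: norm_divide)
qed

end
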